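(* Let $n\ge 2$ and let $f_n,f_{n-1}:\mathbb R^n\to[0,\infty)$ be even continuous functions such that for every fixed $x\in S^{n-1}$ the function $$t\mapsto t\,\frac{f_n(tx)}{f_{n-1}(tx)},\qquad t>0,$$ is increasing. Assume also that $f_{n-1}\in C^\infty(\mathbb R^n\setminus\{0\})$ and that $f_{n-1}$ is strictly positive on $\mathbb R^n\setminus\{0\}$. Let $L$ be an infinitely smooth, origin-symmetric convex body in $\mathbb R^n$ with positive curvature such that the function $$x\mapsto \|x\|_L^{-1}\,\frac{f_n\left(\frac{x}{\|x\|_L}\right)}{f_{n-1}\left(\frac{x}{\|x\|_L}\right)}$$ is in $C^\infty(\mathbb R^n\setminus\{0\})$ and does not represent a positive definite distribution on $\mathbb R^n$. Then there exists an origin-symmetric convex body $D$ in $\mathbb R^n$ such that $$\mu_{n-1}(D\cap\xi^\perp)\le\mu_{n-1}(L\cap\xi^\perp)\qquad\text{for all }\xi\in S^{n-1},$$ but $$\mu_n(D)>\mu_n(L).$$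
   Context: $\mu_n$ is the measure on $\mathbb R^n$ with density $f_n$. For $\xi\in S^{n-1}$, $\xi^\perp$ is the hyperplane through the origin orthogonal to $\xi$, and $\mu_{n-1}(B)=\int_B f_{n-1}(x)\,dx$ for bounded Borel $B\subset\xi^\perp$, where $dx$ is $(n-1)$-dimensional Lebesgue measure on $\xi^\perp$. A convex body is a compact convex set with non-empty interior; $\|x\|_L=\min\{a>0:x\in aL\}$ (for $x\ne 0$) is the Minkowski functional. "Infinitely smooth with positive curvature" means that the boundary is a $C^\infty$ hypersurface with everywhere positive Gaussian curvature. "Increasing" is in the non-strict sense. The Fourier transform of a tempered distribution $f$ is defined by $\langle\hat f,\phi\rangle=\langle f,\hat\phi\rangle$ for Schwartz functions $\phi$, with $\hat\phi(\xi)=\int\phi(x)e^{-i(x,\xi)}dx$. A distribution $f$ is positive definite iff $\langle\hat f,\phi\rangle\ge0$ for every nonnegative Schwartz function $\phi$. *)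

theory Defs
  imports "HOL-Analysis.Analysis"
begin

fun iter_partial :: "'n list \<Rightarrow> (real^'n \<Rightarrow> 'b) \<Rightarrow> real^'n \<Rightarrow> 'b::real_normed_vector" where
  "iter_partial [] f = f"
| "iter_partial (i # is) f = (\<lambda>x. frechet_derivative (iter_partial is f) (at x) (axis i 1))"

text \<open>\<open>C\<^sup>\<infinity>\<close> on an open set: every iterated partial derivative is differentiable, hence continuous,
  at each point.\<close>

definition smooth_on :: "(real^'n) set \<Rightarrow> (real^'n \<Rightarrow> 'b::real_normed_vector) \<Rightarrow> bool" where
  "smooth_on S f \<longleftrightarrow> (\<forall>is. \<forall>x\<in>S. iter_partial is f differentiable (at x))"

definition convex_body :: "(real^'n) set \<Rightarrow> bool" where
  "convex_body K \<longleftrightarrow> compact K \<and> convex K \<and> interior K \<noteq> {}"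

definition origin_symmetric :: "(real^'n) set \<Rightarrow> bool" where
  "origin_symmetric K \<longleftrightarrow> (\<forall>x\<in>K. - x \<in> K)"

text \<open>For an origin-symmetric convex body and \<open>x \<noteq> 0\<close> the infimum is attained; the value at
  \<open>x = 0\<close> is \<open>0\<close>.\<close>

definition minkowski_functional :: "(real^'n) set \<Rightarrow> real^'n \<Rightarrow> real" where
  "minkowski_functional K x = Inf {a. 0 < a \<and> x \<in> (*\<^sub>R) a ` K}"

definition smooth_hypersurface :: "(real^'n) set \<Rightarrow> bool" where
  "smooth_hypersurface M \<longleftrightarrow>
     (\<forall>p\<in>M. \<exists>U (g :: real^'n \<Rightarrow> real). open U \<and> p \<in> U \<and> smooth_on U g \<and>
        (\<forall>x\<in>U. frechet_derivative g (at x) \<noteq> (\<lambda>v. 0)) \<and>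
        M \<inter> U = {x\<in>U. g x = 0})"

definition outer_unit_normal :: "(real^'n) set \<Rightarrow> real^'n \<Rightarrow> real^'n" where
  "outer_unit_normal K p = (THE u. norm u = 1 \<and> (\<forall>x\<in>K. u \<bullet> (x - p) \<le> 0))"

text \<open>The Gaussian curvature of the boundary at \<open>p\<close> is the determinant of the differential of the
  Gauss map, an endomorphism of the tangent space at \<open>p\<close>. A derivative within the boundary is
  determined on the tangent space only; requiring \<open>W\<close> to fix the normal vector determines \<open>W\<close>
  on the whole space without changing the determinant. The outer normal makes the curvature of
  spheres positive.\<close>

definition has_gaussian_curvature :: "(real^'n) set \<Rightarrow> real^'n \<Rightarrow> real \<Rightarrow> bool" where
  "has_gaussian_curvature K p \<kappa> \<longleftrightarrow>
     (\<exists>W. (outer_unit_normal K has_derivative W) (at p within frontier K) \<and>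
          W (outer_unit_normal K p) = outer_unit_normal K p \<and>
          \<kappa> = det (matrix W))"

definition smooth_positively_curved :: "(real^'n) set \<Rightarrow> bool" where
  "smooth_positively_curved K \<longleftrightarrow>
     smooth_hypersurface (frontier K) \<and>
     (\<forall>p\<in>frontier K. \<exists>\<kappa>>0. has_gaussian_curvature K p \<kappa>)"

text \<open>Lebesgue measure of dimension \<open>dim V\<close> on a linear subspace \<open>V\<close>, as a Borel measure on the
  ambient space concentrated on \<open>V\<close>: the analogue of the definition of \<^const>\<open>lborel\<close>, with an
  orthonormal basis of \<open>V\<close> in place of \<^const>\<open>Basis\<close>. The measure does not depend on the chosen
  basis.\<close>

definition orthonormal_basis_of :: "'a::euclidean_space set \<Rightarrow> 'a set \<Rightarrow> bool" where
  "orthonormal_basis_of V B \<longleftrightarrow> pairwise orthogonal B \<and> (\<forall>b\<in>B. norm b = 1) \<and> span B = V"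

definition lborel_subspace :: "'a::euclidean_space set \<Rightarrow> 'a measure" where
  "lborel_subspace V =
     (let B = (SOME B. orthonormal_basis_of V B)
      in distr (\<Pi>\<^sub>M b\<in>B. (lborel :: real measure)) borel (\<lambda>c. \<Sum>b\<in>B. c b *\<^sub>R b))"

definition mu :: "(real^'n \<Rightarrow> real) \<Rightarrow> (real^'n) measure" where
  "mu f = density lborel (\<lambda>x. ennreal (f x))"

definition mu_hyperplane :: "(real^'n \<Rightarrow> real) \<Rightarrow> real^'n \<Rightarrow> (real^'n) measure" where
  "mu_hyperplane f \<xi> = density (lborel_subspace ({\<xi>}\<^sup>\<bottom>)) (\<lambda>x. ennreal (f x))"

definition schwartz :: "(real^'n \<Rightarrow> complex) \<Rightarrow> bool" where
  "schwartz \<phi> \<longleftrightarrow> smooth_on UNIV \<phi> \<and>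
     (\<forall>k is. bounded (range (\<lambda>x. norm x ^ k *\<^sub>R iter_partial is \<phi> x)))"

definition fourier :: "(real^'n \<Rightarrow> complex) \<Rightarrow> real^'n \<Rightarrow> complex" where
  "fourier \<phi> \<xi> = (LINT x|lborel. \<phi> x * exp (- (\<i> * complex_of_real (x \<bullet> \<xi>))))"

text \<open>Tempered distributions are functionals on functions, of which only the values at Schwartz
  functions matter.\<close>

type_synonym 'n functional = "(real^'n \<Rightarrow> complex) \<Rightarrow> complex"

definition distribution_of :: "(real^'n \<Rightarrow> real) \<Rightarrow> 'n functional" where
  "distribution_of h \<phi> = (LINT x|lborel. complex_of_real (h x) * \<phi> x)"

definition fourier_distribution :: "'n::finite functional \<Rightarrow> 'n functional" where
  "fourier_distribution T \<phi> = T (fourier \<phi>)"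

definition positive_definite :: "'n::finite functional \<Rightarrow> bool" where
  "positive_definite T \<longleftrightarrow>
     (\<forall>\<phi>. schwartz \<phi> \<and> (\<forall>x. \<phi> x \<in> \<real>\<^sub>\<ge>\<^sub>0) \<longrightarrow> fourier_distribution T \<phi> \<in> \<real>\<^sub>\<ge>\<^sub>0)"

end

theory Submission
  imports Defs "HOL-Probability.Probability"
begin

text \<open>
  Since \<open>h\<close> is not positive definite, some Schwartz function \<open>\<phi> \<ge> 0\<close> satisfies \<open>\<integral> h \<psi> < 0\<close>, where \<open>\<psi>\<close>
  is the real part of the Fourier transform of \<open>\<phi>\<close>. The integral of \<open>\<psi>\<close> over every hyperplane through the origin is
  nonnegative: after multiplication by a Gaussian it becomes an integral of \<open>\<phi>\<close> against a positive
  function. Hence \<open>G x = \<integral>\<^sub>0\<^sup>\<infinity> r\<^sup>n\<^sup>-\<^sup>2 \<psi> (r x) dr\<close>, which is homogeneous of degree \<open>1 - n\<close>, has nonnegative spherical Radon transform and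
  negative pairing with \<open>h\<close> on the boundary of \<open>L\<close>. It plays the role of the perturbation obtained
  in the paper from the smoothness of the Fourier transform of \<open>h\<close>.

  Let \<open>k\<close> be an even polynomial slightly larger than \<open>G / f_n1\<close> on the boundary of \<open>L\<close>, and let
  \<open>D\<close> have the gauge \<open>p x (1 + \<epsilon> k (x / p x))\<close>, where \<open>p\<close> is the gauge of \<open>L\<close>. Along each ray the integral
  of \<open>r\<^sup>n\<^sup>-\<^sup>2 f_n1\<close> over \<open>D\<close> then differs from that over \<open>L\<close> by at most \<open>- \<epsilon> G\<close> and at least \<open>- \<epsilon> (G + \<eta>)\<close>. The upper
  bound gives the inequality for sections. The lower bound and the monotonicity of
  \<open>t f_n (t x) / f_n1 (t x)\<close> give \<open>\<mu>\<^sub>n(D) - \<mu>\<^sub>n(L) \<ge> - \<epsilon> \<integral> h \<psi> - O(\<epsilon> \<eta>) > 0\<close>.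

  Positive curvature and compactness make \<open>L\<close> uniformly convex: \<open>u x \<bullet> (x - y) \<ge> c |x - y|\<^sup>2\<close> for boundary
  points \<open>x\<close>, \<open>y\<close> and suitable normals \<open>u x\<close>. This quadratic gap absorbs the second-order error of the polynomial
  \<open>k\<close>, so that \<open>D\<close> is convex.
\<close>

section \<open>Second-order calculus along level sets\<close>

text \<open>\<open>G\<close> is shown only to be continuous on the boundary of \<open>L\<close>,
  whereas convexity of the perturbed body needs second-order control; this is why a polynomial takes
  the place of \<open>G / f_n1\<close>. The replacement has to be one-sided. The integrals of
  \<open>\<psi>\<close> over hyperplanes are known to be nonnegative but not positive, so the
  section inequality leaves no room for an error; the volume inequality has a strict margin, the
  negativity of the pairing of \<open>h\<close> with \<open>\<psi>\<close>, and this margin pays for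
  the approximation and for the terms of second order in the size of the perturbation. The same
  \<open>G\<close> serves both inequalities because \<open>h\<close> is homogeneous of degree
  \<open>-1\<close>: the additional factor \<open>r\<close> of the polar weight in the full
  dimension cancels against \<open>h (r x) = h x / r\<close>. No measure on the sphere is
  introduced. Each comparison of integrals is reduced to one point on every ray, and that point is
  taken on the boundary of \<open>L\<close>.\<close>

lemma iter_partial_derivative:
  fixes g :: "real^'n \<Rightarrow> 'b::real_normed_vector"
  assumes "iter_partial is g differentiable (at x)"
  shows "(iter_partial is g has_derivative (\<lambda>v. \<Sum>i\<in>UNIV. (v $ i) *\<^sub>R iter_partial (i # is) g x)) (at x)"
proof -
  let ?D = "frechet_derivative (iter_partial is g) (at x)"
  have D: "(iter_partial is g has_derivative ?D) (at x)"
    using assms frechet_derivative_works by blast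
  then have lin: "linear ?D" by (rule has_derivative_linear)
  have "?D v = (\<Sum>i\<in>UNIV. (v $ i) *\<^sub>R iter_partial (i # is) g x)" for v
  proof -
    have "v = (\<Sum>i\<in>UNIV. (v $ i) *\<^sub>R axis i 1)"
      by (simp add: vec_eq_iff axis_def if_distrib cong: if_cong)
    then have "?D v = ?D (\<Sum>i\<in>UNIV. (v $ i) *\<^sub>R axis i 1)" by simp
    also have "\<dots> = (\<Sum>i\<in>UNIV. (v $ i) *\<^sub>R ?D (axis i 1))"
      by (simp add: linear_sum[OF lin] linear_scale[OF lin])
    finally show ?thesis by simp
  qed
  then have "?D = (\<lambda>v. \<Sum>i\<in>UNIV. (v $ i) *\<^sub>R iter_partial (i # is) g x)" by (rule ext)
  then show ?thesis using D by metis
qed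

text \<open>Gradient \<open>P\<close> and Hessian \<open>H\<close> are kept as explicit data. Joint
  continuity in point and direction lets \<open>H (z k) (d k)\<close> converge when both arguments
  vary, as happens with the intermediate points of Taylor expansions.\<close>

definition C2_on :: "'a::euclidean_space set \<Rightarrow> ('a \<Rightarrow> real) \<Rightarrow> ('a \<Rightarrow> 'a) \<Rightarrow> ('a \<Rightarrow> 'a \<Rightarrow> 'a) \<Rightarrow> bool"
  where "C2_on U g P H \<longleftrightarrow> open U \<and>
    (\<forall>x\<in>U. (g has_derivative (\<lambda>v. P x \<bullet> v)) (at x) \<and> (P has_derivative H x) (at x)) \<and>
    continuous_on (U \<times> UNIV) (\<lambda>(x, v). H x v)"

lemma smooth_on_C2:
  fixes g :: "real^'n \<Rightarrow> real"
  assumes "open U" "smooth_on U g"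
  obtains P H where "C2_on U g P H"
proof -
  define P where "P x = (\<chi> i. iter_partial [i] g x)" for x
  define H where "H x v = (\<chi> j. \<Sum>i\<in>UNIV. v $ i * iter_partial [i, j] g x)" for x v
  have d: "iter_partial is g differentiable (at x)" if "x \<in> U" for "is" x
    using assms that by (auto simp: smooth_on_def)
  have cont: "continuous_on (U \<times> UNIV) (\<lambda>z. iter_partial is g (fst z))" for "is"
  proof -
    have "continuous_on U (iter_partial is g)"
      using d differentiable_imp_continuous_within continuous_at_imp_continuous_on by blast
    then show ?thesis
      by (rule continuous_on_compose2) (auto intro!: continuous_intros)
  qed
  have g': "(g has_derivative (\<lambda>v. P x \<bullet> v)) (at x)" if "x \<in> U" for x
    using iter_partial_derivative[OF d[OF that, of "[]"]]
    by (simp add: P_def inner_vec_def mult.commute)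
  have P': "(P has_derivative H x) (at x)" if "x \<in> U" for x
  proof (subst has_derivative_componentwise_within, intro ballI)
    fix b :: "real^'n" assume "b \<in> Basis"
    then obtain j where b: "b = axis j 1" by (auto simp: Basis_vec_def)
    show "((\<lambda>x. P x \<bullet> b) has_derivative (\<lambda>y. H x y \<bullet> b)) (at x)"
      using iter_partial_derivative[OF d[OF that, of "[j]"]]
      by (simp add: P_def H_def b inner_axis)
  qed
  have "continuous_on (U \<times> UNIV) (\<lambda>(x, v). H x v)"
    unfolding H_def split_beta
    by (intro continuous_intros continuous_on_vec_lambda cont)
  with g' P' assms have "C2_on U g P H" by (auto simp: C2_on_def)
  then show thesis by (rule that)
qed

lemma C2_on_taylor:
  assumes "C2_on U g P H" "closed_segment x (x + d) \<subseteq> U"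
  obtains z where "z \<in> closed_segment x (x + d)" "g (x + d) = g x + P x \<bullet> d + (H z d \<bullet> d) / 2"
proof -
  \<comment> \<open>The derivatives of orders 0, 1 and 2 of \<open>g\<close> along the segment;
    order 2 is the fallback branch.\<close>
  define df where "df m s = (if m = 0 then g (x + s *\<^sub>R d) else if m = Suc 0 then P (x + s *\<^sub>R d) \<bullet> d
      else H (x + s *\<^sub>R d) d \<bullet> d)" for m :: nat and s :: real
  have seg: "x + s *\<^sub>R d \<in> closed_segment x (x + d)" if "0 \<le> s" "s \<le> 1" for s
    using that unfolding in_segment by (intro exI[of _ s]) (simp add: algebra_simps)
  have a: "((\<lambda>s. x + s *\<^sub>R d) has_derivative (\<lambda>h. h *\<^sub>R d)) (at s)" for s
    by (auto intro!: derivative_eq_intros)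
  have "\<exists>t>0. t < 1 \<and> df 0 1 = (\<Sum>m<2. df m 0 / fact m * 1 ^ m) + df 2 t / fact 2 * 1 ^ 2"
  proof (rule Maclaurin)
    show "\<forall>m t. m < 2 \<and> 0 \<le> t \<and> t \<le> 1 \<longrightarrow> (df m has_real_derivative df (Suc m) t) (at t)"
    proof (intro allI impI)
      fix m :: nat and t :: real assume mt: "m < 2 \<and> 0 \<le> t \<and> t \<le> 1"
      then have U: "x + t *\<^sub>R d \<in> U" using seg assms(2) by blast
      have g: "(g has_derivative (\<lambda>v. P (x + t *\<^sub>R d) \<bullet> v)) (at (x + t *\<^sub>R d))"
        and P: "(P has_derivative H (x + t *\<^sub>R d)) (at (x + t *\<^sub>R d))"
        using assms(1) U by (auto simp: C2_on_def)
      have lin: "H (x + t *\<^sub>R d) (h *\<^sub>R d) = h *\<^sub>R H (x + t *\<^sub>R d) d" for h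
        using has_derivative_linear[OF P] by (rule linear_scale)
      consider "m = 0" | "m = Suc 0" using mt by linarith
      then show "(df m has_real_derivative df (Suc m) t) (at t)"
      proof cases
        case 1
        then show ?thesis
          using has_derivative_compose[OF a g]
          by (simp add: df_def[abs_def] has_field_derivative_def mult_commute_abs)
      next
        case 2
        have "((\<lambda>s. P (x + s *\<^sub>R d) \<bullet> d) has_derivative (\<lambda>h. H (x + t *\<^sub>R d) (h *\<^sub>R d) \<bullet> d)) (at t)"
          by (rule has_derivative_inner_left, rule has_derivative_compose[OF a P])
        with 2 show ?thesis
          by (simp add: df_def[abs_def] has_field_derivative_def lin mult_commute_abs)
      qed
    qed
  qed auto
  then obtain t where t: "0 < t" "t < 1"
    "df 0 1 = (\<Sum>m<2. df m 0 / fact m * 1 ^ m) + df 2 t / fact 2 * 1 ^ 2" by blast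
  show thesis
  proof (rule that)
    show "x + t *\<^sub>R d \<in> closed_segment x (x + d)" using seg t by simp
    show "g (x + d) = g x + P x \<bullet> d + H (x + t *\<^sub>R d) d \<bullet> d / 2"
      using t(3) by (simp add: df_def numeral_2_eq_2)
  qed
qed

lemma C2_on_tendsto:
  assumes "C2_on U g P H" "q \<in> U" "(z \<longlongrightarrow> q) F" "(d \<longlongrightarrow> e) F"
  shows "((\<lambda>k. H (z k) (d k)) \<longlongrightarrow> H q e) F"
proof -
  have "open (U \<times> UNIV)" using assms(1) by (auto simp: C2_on_def open_Times)
  then have "isCont (\<lambda>(x, v). H x v) (q, e)"
    using assms(1,2) continuous_on_eq_continuous_at unfolding C2_on_def by blast
  then have "((\<lambda>k. (\<lambda>(x, v). H x v) (z k, d k)) \<longlongrightarrow> (\<lambda>(x, v). H x v) (q, e)) F"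
    by (rule isCont_tendsto_compose) (intro tendsto_Pair assms)
  then show ?thesis by simp
qed

lemma segment_dist_le:
  fixes x :: "'a::real_normed_vector"
  assumes "z \<in> closed_segment x y" "dist q x \<le> r" "dist q y \<le> r"
  shows "dist q z \<le> r"
proof -
  have "closed_segment x y \<subseteq> cball q r"
    using assms by (intro closed_segment_subset convex_cball) auto
  with assms(1) show ?thesis by auto
qed

text \<open>\<open>g (q + s (v + w))\<close> is expanded once from \<open>q\<close> in direction
  \<open>v + w\<close> and once from \<open>q + s v\<close> in direction \<open>w\<close>. Comparing
  the two writes the difference quotient of \<open>P\<close> along \<open>v\<close>, paired with
  \<open>w\<close>, in second-order terms only. In the limit \<open>H q v \<bullet> w\<close> is
  half the polarization of the quadratic form of \<open>H q\<close>, which by bilinearity is the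
  mean of the two mixed terms.\<close>

lemma C2_on_symmetric:
  assumes C: "C2_on U g P H" and q: "q \<in> U"
  shows "H q v \<bullet> w = H q w \<bullet> v"
proof -
  have P': "(P has_derivative H q) (at q)" and "open U" using C q by (auto simp: C2_on_def)
  have linH: "linear (H z)" if "z \<in> U" for z
    using C that by (auto simp: C2_on_def dest: has_derivative_linear)
  obtain r where r: "0 < r" "cball q r \<subseteq> U" using \<open>open U\<close> q open_contains_cball by blast
  define M where "M = norm v + norm w + 1"
  have M: "0 < M" by (auto simp: M_def add_nonneg_pos)
  \<comment> \<open>Scaled so that \<open>q + s k a\<close> stays in \<open>cball q r\<close> for
    \<open>a\<close> among \<open>0\<close>, \<open>v\<close>, \<open>w\<close> and
    \<open>v + w\<close>.\<close>
  define s where "s k = r / M / real (Suc k)" for k :: nat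
  have s0: "0 < s k" for k using r M by (simp add: s_def)
  have sM: "s k * M \<le> r" for k
  proof -
    have "s k * M = r / real (Suc k)" using M by (simp add: s_def)
    also have "\<dots> \<le> r / 1" using r by (intro divide_left_mono) auto
    finally show ?thesis by simp
  qed
  have slim: "s \<longlonglongrightarrow> 0"
    unfolding s_def by (rule tendsto_divide_0[OF tendsto_const])
      (metis filterlim_compose filterlim_Suc filterlim_real_sequentially filterlim_at_top_imp_at_infinity)
  have near: "dist q (q + s k *\<^sub>R a) \<le> r" if "norm a \<le> M" for a k
  proof -
    have "dist q (q + s k *\<^sub>R a) = s k * norm a" using s0[of k] by (simp add: dist_norm)
    also have "\<dots> \<le> s k * M" using s0[of k] that by (simp add: mult_left_mono)
    finally show ?thesis using sM[of k] by linarith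
  qed
  have nv: "norm 0 \<le> M" "norm v \<le> M" "norm w \<le> M" "norm (v + w) \<le> M"
    using norm_triangle_ineq[of v w] by (auto simp: M_def)
  \<comment> \<open>\<open>z\<close> is the intermediate point of the expansion at
    \<open>q + s k a\<close> in direction \<open>b\<close>; its distance from \<open>q\<close>
    vanishes with \<open>s k\<close>.\<close>
  define Q where "Q k a b z \<longleftrightarrow> dist q z \<le> s k * M \<and>
      g (q + s k *\<^sub>R (a + b)) = g (q + s k *\<^sub>R a) + s k * (P (q + s k *\<^sub>R a) \<bullet> b)
        + s k * s k * (H z b \<bullet> b) / 2" for k a b z
  have tay: "\<exists>z. Q k a b z" if ab: "norm a \<le> M" "norm (a + b) \<le> M" for a b k
  proof -
    let ?x = "q + s k *\<^sub>R a"
    have eq: "?x + s k *\<^sub>R b = q + s k *\<^sub>R (a + b)" by (simp add: algebra_simps)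
    have dd: "dist q z \<le> s k * M" if "z \<in> closed_segment ?x (?x + s k *\<^sub>R b)" for z
    proof (rule segment_dist_le[OF that])
      show "dist q ?x \<le> s k * M" using s0[of k] ab by (simp add: dist_norm mult_left_mono)
      show "dist q (?x + s k *\<^sub>R b) \<le> s k * M"
        unfolding eq using s0[of k] ab by (simp add: dist_norm mult_left_mono)
    qed
    have "closed_segment ?x (?x + s k *\<^sub>R b) \<subseteq> U"
      using dd r sM[of k] by (force simp: subset_eq)
    from C2_on_taylor[OF C this] obtain z where z: "z \<in> closed_segment ?x (?x + s k *\<^sub>R b)"
       "g (?x + s k *\<^sub>R b) = g ?x + P ?x \<bullet> (s k *\<^sub>R b) + (H z (s k *\<^sub>R b) \<bullet> (s k *\<^sub>R b)) / 2" .
    have "z \<in> U" using dd[OF z(1)] sM[of k] r by (auto simp: subset_eq)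
    then have "H z (s k *\<^sub>R b) = s k *\<^sub>R H z b" using linH linear_scale by blast
    with z dd[OF z(1)] have "Q k a b z"
      unfolding Q_def eq[symmetric] by (simp add: mult.assoc)
    then show ?thesis ..
  qed
  obtain z1 where z1: "\<And>k. Q k v w (z1 k)" using tay[of v w] nv by metis
  obtain z2 where z2: "\<And>k. Q k 0 v (z2 k)" using tay[of 0 v] nv by (metis add_0)
  obtain z3 where z3: "\<And>k. Q k 0 (v + w) (z3 k)" using tay[of 0 "v + w"] nv by (metis add_0)
  have lim: "z \<longlonglongrightarrow> q" if "\<And>k. Q k a b (z k)" for z a b
  proof -
    have "(\<lambda>k. dist (z k) q) \<longlonglongrightarrow> 0"
    proof (rule tendsto_sandwich[where f="\<lambda>_. 0" and h="\<lambda>k. s k * M"])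
      show "(\<lambda>k. s k * M) \<longlonglongrightarrow> 0" using tendsto_mult_right[OF slim, of M] by simp
      show "\<forall>\<^sub>F k in sequentially. dist (z k) q \<le> s k * M"
        using that by (auto simp: Q_def dist_commute)
    qed auto
    then show ?thesis by (subst tendsto_dist_iff)
  qed
  have eq: "(P (q + s k *\<^sub>R v) - P q) \<bullet> w / s k
      = (H (z3 k) (v + w) \<bullet> (v + w) - H (z2 k) v \<bullet> v - H (z1 k) w \<bullet> w) / 2" for k
  proof -
    have alg: "(pv - pw) / t = (h3 - h2 - h1) / 2"
      if "0 < t" "g3 = g1 + t * pv + t * t * h1 / 2" "g1 = g0 + t * p + t * t * h2 / 2"
        "g3 = g0 + t * (p + pw) + t * t * h3 / 2" for t g0 g1 g3 p pv pw h1 h2 h3 :: real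
    proof -
      have "t * (pv - pw) = t * (t * ((h3 - h2 - h1) / 2))"
        using that(2-4) by (simp add: algebra_simps)
      then have "pv - pw = t * ((h3 - h2 - h1) / 2)"
        using that(1) unfolding mult_cancel_left by linarith
      then show ?thesis using that(1) by (simp only: nonzero_mult_div_cancel_left)
    qed
    show ?thesis
      unfolding inner_diff_left[of "P _" "P q"]
    proof (rule alg[OF s0])
      show "g (q + s k *\<^sub>R (v + w)) = g (q + s k *\<^sub>R v) + s k * (P (q + s k *\<^sub>R v) \<bullet> w)
          + s k * s k * (H (z1 k) w \<bullet> w) / 2"
        using z1[of k] by (simp add: Q_def)
      show "g (q + s k *\<^sub>R v) = g q + s k * (P q \<bullet> v) + s k * s k * (H (z2 k) v \<bullet> v) / 2"
        using z2[of k] by (simp add: Q_def)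
      show "g (q + s k *\<^sub>R (v + w)) = g q + s k * (P q \<bullet> v + P q \<bullet> w)
          + s k * s k * (H (z3 k) (v + w) \<bullet> (v + w)) / 2"
        using z3[of k] by (simp add: Q_def inner_add_right)
    qed
  qed
  have l1: "(\<lambda>k. (H (z3 k) (v + w) \<bullet> (v + w) - H (z2 k) v \<bullet> v - H (z1 k) w \<bullet> w) / 2) \<longlonglongrightarrow>
     (H q (v + w) \<bullet> (v + w) - H q v \<bullet> v - H q w \<bullet> w) / 2"
    by (intro tendsto_intros C2_on_tendsto[OF C q] lim[OF z1] lim[OF z2] lim[OF z3]) simp
  have l2: "(\<lambda>k. (P (q + s k *\<^sub>R v) - P q) \<bullet> w / s k) \<longlonglongrightarrow> H q v \<bullet> w"
  proof -
    have a: "((\<lambda>t. q + t *\<^sub>R v) has_derivative (\<lambda>h. h *\<^sub>R v)) (at 0)"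
      by (auto intro!: derivative_eq_intros)
    have P'0: "(P has_derivative H q) (at (q + 0 *\<^sub>R v))" using P' by simp
    have "((\<lambda>t. P (q + t *\<^sub>R v) \<bullet> w) has_derivative (\<lambda>h. H q (h *\<^sub>R v) \<bullet> w)) (at 0)"
      by (rule has_derivative_inner_left, rule has_derivative_compose[OF a P'0])
    then have "((\<lambda>t. P (q + t *\<^sub>R v) \<bullet> w) has_real_derivative (H q v \<bullet> w)) (at 0)"
      by (simp add: has_field_derivative_def linear_scale[OF linH[OF q]] mult_commute_abs)
    then have "((\<lambda>h. (P (q + h *\<^sub>R v) \<bullet> w - P q \<bullet> w) / h) \<longlongrightarrow> H q v \<bullet> w) (at 0)"
      by (simp add: DERIV_def)
    moreover have "filterlim s (at 0) sequentially"
    proof -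
      have "s k \<noteq> 0" for k using s0[of k] by simp
      then show ?thesis using slim unfolding filterlim_at by simp
    qed
    ultimately have "(\<lambda>k. (P (q + s k *\<^sub>R v) \<bullet> w - P q \<bullet> w) / s k) \<longlonglongrightarrow> H q v \<bullet> w"
      by (rule filterlim_compose)
    then show ?thesis by (simp add: inner_simps)
  qed
  have e1: "H q v \<bullet> w = (H q (v + w) \<bullet> (v + w) - H q v \<bullet> v - H q w \<bullet> w) / 2"
    by (rule LIMSEQ_unique[OF l2[unfolded eq] l1])
  have e2: "H q (v + w) \<bullet> (v + w) = H q v \<bullet> v + H q v \<bullet> w + H q w \<bullet> v + H q w \<bullet> w"
    by (simp only: linear_add[OF linH[OF q]] inner_add_left inner_add_right add.assoc)
  have alg: "x = y" if "x = (s - a - b) / 2" "s = a + x + y + b" for x y s a b :: real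
    using that by argo
  show ?thesis by (rule alg[OF e1 e2])
qed

text \<open>A substitute for the implicit function theorem. From \<open>x + s e\<close> one moves by
  \<open>t\<close> along the gradient; there \<open>g\<close> equals \<open>t m\<^sup>2\<close> up
  to half of its size at the ends \<open>t = - \<eta> s\<close> and \<open>t = \<eta> s\<close>, so
  the signs at the ends differ and the intermediate value theorem yields a zero.\<close>

lemma C2_on_level_set_tangent:
  assumes C: "C2_on U g P H" and x: "x \<in> U" "g x = 0" "P x \<noteq> 0" and e: "P x \<bullet> e = 0" and "0 < \<delta>"
  shows "\<exists>s0>0. \<forall>s. 0 < s \<and> s < s0 \<longrightarrow> (\<exists>y\<in>U. g y = 0 \<and> norm (y - (x + s *\<^sub>R e)) \<le> \<delta> * s)"
proof -
  define m where "m = norm (P x)"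
  define \<eta> where "\<eta> = \<delta> / m"
  define A where "A = norm e + \<delta>"
  have pos: "0 < m" "0 < \<eta>" "0 < A" using x \<open>0 < \<delta>\<close> by (auto simp: m_def \<eta>_def A_def add_nonneg_pos)
  have "open U" and g': "(g has_derivative (\<lambda>v. P x \<bullet> v)) (at x)"
    and gU: "\<And>y. y \<in> U \<Longrightarrow> (g has_derivative (\<lambda>v. P y \<bullet> v)) (at y)"
    using C x by (auto simp: C2_on_def)
  obtain r where r: "0 < r" "cball x r \<subseteq> U" using \<open>open U\<close> x open_contains_cball by blast
  \<comment> \<open>With this tolerance the linearization error, for
    \<open>norm (Y t - x) \<le> s * A\<close>, is at most
    \<open>\<eta> * s * m\<^sup>2 / 2\<close>.\<close>
  define e0 where "e0 = \<eta> * m\<^sup>2 / (2 * A)"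
  have e0: "0 < e0" using pos by (simp add: e0_def)
  obtain d where d: "0 < d" "\<And>y. norm (y - x) < d \<Longrightarrow> norm (g y - g x - P x \<bullet> (y - x)) \<le> e0 * norm (y - x)"
    using g'[unfolded has_derivative_at_alt] e0 by metis
  define s0 where "s0 = min d r / A"
  have "0 < s0" using d r pos by (simp add: s0_def)
  moreover have "\<exists>y\<in>U. g y = 0 \<and> norm (y - (x + s *\<^sub>R e)) \<le> \<delta> * s" if s: "0 < s" "s < s0" for s
  proof -
    have sA: "s * A < d" "s * A < r" using s pos by (auto simp: s0_def pos_less_divide_eq)
    define Y where "Y t = x + s *\<^sub>R e + t *\<^sub>R P x" for t
    have nY: "norm (Y t - x) \<le> s * A" if "\<bar>t\<bar> \<le> \<eta> * s" for t
    proof -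
      have "norm (Y t - x) \<le> norm (s *\<^sub>R e) + norm (t *\<^sub>R P x)"
        unfolding Y_def by (metis add.assoc add_diff_cancel_left' norm_triangle_ineq)
      also have "\<dots> \<le> s * norm e + (\<eta> * s) * m"
        using s that pos by (auto simp: m_def intro!: mult_right_mono)
      also have "\<dots> = s * A" using pos by (simp add: A_def \<eta>_def algebra_simps)
      finally show ?thesis .
    qed
    have YU: "Y t \<in> U" if "\<bar>t\<bar> \<le> \<eta> * s" for t
      using nY[OF that] sA r by (auto simp: subset_eq dist_norm norm_minus_commute)
    have gY: "\<bar>g (Y t) - t * m\<^sup>2\<bar> \<le> \<eta> * s * m\<^sup>2 / 2" if t: "\<bar>t\<bar> \<le> \<eta> * s" for t
    proof -
      have "P x \<bullet> (Y t - x) = t * m\<^sup>2"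
        using e by (simp add: Y_def inner_simps m_def dot_square_norm)
      then have "\<bar>g (Y t) - t * m\<^sup>2\<bar> \<le> e0 * norm (Y t - x)"
        using d(2)[of "Y t"] nY[OF t] sA x by simp
      also have "\<dots> \<le> e0 * (s * A)" using nY[OF t] e0 by (intro mult_left_mono) auto
      also have "\<dots> = \<eta> * s * m\<^sup>2 / 2" using pos by (simp add: e0_def)
      finally show ?thesis .
    qed
    have es: "0 < \<eta> * s" "0 < \<eta> * s * m\<^sup>2" using pos s by auto
    have "\<exists>t\<ge>- (\<eta> * s). t \<le> \<eta> * s \<and> g (Y t) = 0"
    proof (rule IVT')
      have "\<bar>g (Y (- (\<eta> * s))) - - (\<eta> * s * m\<^sup>2)\<bar> \<le> \<eta> * s * m\<^sup>2 / 2"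
        using gY[of "- (\<eta> * s)"] es by simp
      then show "g (Y (- (\<eta> * s))) \<le> 0" using es by linarith
      have "\<bar>g (Y (\<eta> * s)) - \<eta> * s * m\<^sup>2\<bar> \<le> \<eta> * s * m\<^sup>2 / 2"
        using gY[of "\<eta> * s"] es by simp
      then show "0 \<le> g (Y (\<eta> * s))" using es by linarith
      show "- (\<eta> * s) \<le> \<eta> * s" using es by auto
      have "continuous_on U g"
        using gU has_derivative_continuous continuous_at_imp_continuous_on by blast
      moreover have "continuous_on {- (\<eta> * s)..\<eta> * s} Y" unfolding Y_def by (intro continuous_intros)
      ultimately show "continuous_on {- (\<eta> * s)..\<eta> * s} (\<lambda>t. g (Y t))"
        by (rule continuous_on_compose2) (use YU in auto)
    qed
    then obtain t where "- (\<eta> * s) \<le> t" "t \<le> \<eta> * s" and gt: "g (Y t) = 0" by blast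
    then have t: "\<bar>t\<bar> \<le> \<eta> * s" "g (Y t) = 0" by (auto simp: abs_le_iff)
    have "norm (Y t - (x + s *\<^sub>R e)) = \<bar>t\<bar> * m" by (simp add: Y_def m_def)
    also have "\<dots> \<le> \<eta> * s * m" using t pos by (intro mult_right_mono) auto
    also have "\<dots> = \<delta> * s" using pos by (simp add: \<eta>_def)
    finally show ?thesis using YU[OF t(1)] t(2) by blast
  qed
  ultimately show ?thesis by blast
qed

lemma C2_on_tangent_sequence:
  assumes C: "C2_on U g P H" and x: "x \<in> U" "g x = 0" "P x \<noteq> 0" and e: "P x \<bullet> e = 0"
  obtains y and s :: "nat \<Rightarrow> real" where "\<And>k. y k \<in> U" "\<And>k. g (y k) = 0" "\<And>k. 0 < s k"
    "s \<longlonglongrightarrow> 0" "(\<lambda>k. (y k - x) /\<^sub>R s k) \<longlonglongrightarrow> e"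
proof -
  have inv: "(\<lambda>k. inverse (real (Suc k))) \<longlonglongrightarrow> 0" by (rule LIMSEQ_inverse_real_of_nat)
  have "\<exists>y s. y \<in> U \<and> g y = 0 \<and> 0 < s \<and> s \<le> inverse (real (Suc k)) \<and>
      norm (y - (x + s *\<^sub>R e)) \<le> inverse (real (Suc k)) * s" for k
  proof -
    obtain s0 where s0: "0 < s0" "\<And>s. 0 < s \<Longrightarrow> s < s0 \<Longrightarrow>
        \<exists>y\<in>U. g y = 0 \<and> norm (y - (x + s *\<^sub>R e)) \<le> inverse (real (Suc k)) * s"
      using C2_on_level_set_tangent[OF C x e, of "inverse (real (Suc k))"] by auto
    define s where "s = min (s0 / 2) (inverse (real (Suc k)))"
    have "0 < s" "s < s0" "s \<le> inverse (real (Suc k))" using s0(1) by (auto simp: s_def)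
    with s0(2)[of s] show ?thesis by blast
  qed
  then obtain y s where ys: "\<And>k. y k \<in> U" "\<And>k. g (y k) = 0" "\<And>k. 0 < s k"
      "\<And>k. s k \<le> inverse (real (Suc k))"
      "\<And>k. norm (y k - (x + s k *\<^sub>R e)) \<le> inverse (real (Suc k)) * s k"
    by metis
  have "s \<longlonglongrightarrow> 0"
    by (rule tendsto_sandwich[OF _ _ tendsto_const inv]) (use ys in \<open>auto intro!: always_eventually less_imp_le\<close>)
  moreover have "(\<lambda>k. (y k - x) /\<^sub>R s k) \<longlonglongrightarrow> e"
  proof -
    have "norm ((y k - x) /\<^sub>R s k - e) \<le> inverse (real (Suc k))" for k
    proof -
      have "(y k - x) /\<^sub>R s k - e = (y k - (x + s k *\<^sub>R e)) /\<^sub>R s k"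
        using ys(3)[of k] by (simp add: algebra_simps)
      then have "norm ((y k - x) /\<^sub>R s k - e) = norm (y k - (x + s k *\<^sub>R e)) / s k"
        using ys(3)[of k] by (simp add: divide_inverse mult.commute)
      also have "\<dots> \<le> inverse (real (Suc k))"
        using ys(3,5)[of k] by (simp add: pos_divide_le_eq)
      finally show ?thesis .
    qed
    then have "(\<lambda>k. (y k - x) /\<^sub>R s k - e) \<longlonglongrightarrow> 0"
      by (intro Lim_null_comparison[OF _ inv] always_eventually allI)
    then show ?thesis by (simp add: LIM_zero_iff)
  qed
  ultimately show thesis using ys that by blast
qed

lemma tendsto_base_point:
  fixes y :: "nat \<Rightarrow> 'a::real_normed_vector"
  assumes "\<And>k. 0 < s k" "s \<longlonglongrightarrow> 0" "(\<lambda>k. (y k - x) /\<^sub>R s k) \<longlonglongrightarrow> e"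
  shows "y \<longlonglongrightarrow> x"
proof -
  have "(\<lambda>k. x + s k *\<^sub>R ((y k - x) /\<^sub>R s k)) \<longlonglongrightarrow> x + 0 *\<^sub>R e"
    by (intro tendsto_intros assms)
  moreover have "x + s k *\<^sub>R ((y k - x) /\<^sub>R s k) = y k" for k
    using assms(1)[of k] by simp
  ultimately show ?thesis by simp
qed

text \<open>A derivative within \<open>S\<close> can be tested only along points of
  \<open>S\<close>. Convergence of the scaled differences to \<open>d\<close> is all that is asked
  of the sequence, so this applies both to the Gauss map on the boundary and to full
  derivatives.\<close>

lemma has_derivative_along_sequence:
  fixes f :: "'a::real_normed_vector \<Rightarrow> 'b::real_normed_vector"
  assumes D: "(f has_derivative D) (at q within S)" and y: "\<And>k. y k \<in> S"
    and s: "\<And>k. 0 < s k" "s \<longlonglongrightarrow> 0" "(\<lambda>k. (y k - q) /\<^sub>R s k) \<longlonglongrightarrow> d"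
  shows "(\<lambda>k. (f (y k) - f q) /\<^sub>R s k) \<longlonglongrightarrow> D d"
proof -
  have bl: "bounded_linear D" using D by (rule has_derivative_bounded_linear)
  have yq: "y \<longlonglongrightarrow> q" by (rule tendsto_base_point[OF s])
  obtain B where B: "0 < B" "\<And>k. norm ((y k - q) /\<^sub>R s k) \<le> B"
    using convergent_imp_Bseq[OF convergentI[OF s(3)]] by (auto simp: Bseq_def)
  have "(\<lambda>k. (f (y k) - f q) /\<^sub>R s k - D ((y k - q) /\<^sub>R s k)) \<longlonglongrightarrow> 0"
  proof (rule LIMSEQ_I)
    fix e :: real assume e: "0 < e"
    then have "0 < e / (2 * B)" using B by simp
    then obtain \<delta> where \<delta>: "0 < \<delta>"
      "\<And>z. z \<in> S \<Longrightarrow> norm (z - q) < \<delta> \<Longrightarrow> norm (f z - f q - D (z - q)) \<le> e / (2 * B) * norm (z - q)"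
      using D unfolding has_derivative_within_alt by metis
    obtain N where N: "\<And>k. k \<ge> N \<Longrightarrow> norm (y k - q) < \<delta>"
      using LIMSEQ_D[OF yq \<delta>(1)] by auto
    have "norm ((f (y k) - f q) /\<^sub>R s k - D ((y k - q) /\<^sub>R s k)) < e" if "k \<ge> N" for k
    proof -
      have "(f (y k) - f q) /\<^sub>R s k - D ((y k - q) /\<^sub>R s k) = (f (y k) - f q - D (y k - q)) /\<^sub>R s k"
        unfolding linear_scale[OF bounded_linear.linear[OF bl]] by (simp only: scaleR_diff_right)
      then have "norm ((f (y k) - f q) /\<^sub>R s k - D ((y k - q) /\<^sub>R s k))
          = inverse (s k) * norm (f (y k) - f q - D (y k - q))"
        using s(1)[of k] by simp
      also have "\<dots> \<le> inverse (s k) * (e / (2 * B) * norm (y k - q))"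
        using \<delta>(2)[OF y N[OF that]] s(1)[of k] by (intro mult_left_mono) auto
      also have "\<dots> = e / (2 * B) * norm ((y k - q) /\<^sub>R s k)" using s(1)[of k] by simp
      also have "\<dots> \<le> e / (2 * B) * B" using e B by (intro mult_left_mono) auto
      also have "\<dots> < e" using e B by simp
      finally show ?thesis .
    qed
    then show "\<exists>N. \<forall>k\<ge>N. norm ((f (y k) - f q) /\<^sub>R s k - D ((y k - q) /\<^sub>R s k) - 0) < e" by auto
  qed
  moreover have "(\<lambda>k. D ((y k - q) /\<^sub>R s k)) \<longlonglongrightarrow> D d"
    by (rule bounded_linear.tendsto[OF bl s(3)])
  ultimately have "(\<lambda>k. (f (y k) - f q) /\<^sub>R s k - D ((y k - q) /\<^sub>R s k) + D ((y k - q) /\<^sub>R s k)) \<longlonglongrightarrow> 0 + D d"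
    by (rule tendsto_add)
  then show ?thesis by simp
qed

section \<open>Outer normals and gradients of defining functions\<close>

lemma norm_sgn_diff_le:
  fixes a b :: "'a::real_normed_vector"
  assumes "b \<noteq> 0"
  shows "norm (sgn a - sgn b) \<le> 2 * norm (a - b) / norm b"
proof (cases "a = 0")
  case True
  then show ?thesis using assms by (simp add: norm_sgn)
next
  case False
  have "sgn a - sgn b = (inverse (norm a) - inverse (norm b)) *\<^sub>R a + (a - b) /\<^sub>R norm b"
    by (simp add: sgn_div_norm algebra_simps)
  then have "norm (sgn a - sgn b) \<le> \<bar>inverse (norm a) - inverse (norm b)\<bar> * norm a + norm (a - b) / norm b"
    by (metis (no_types, lifting) norm_triangle_ineq norm_scaleR divide_inverse mult.commute
        abs_norm_cancel abs_inverse)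
  also have "\<bar>inverse (norm a) - inverse (norm b)\<bar> * norm a = \<bar>norm b - norm a\<bar> / norm b"
    using False assms by (simp add: abs_mult[symmetric] inverse_eq_divide diff_divide_distrib
        left_diff_distrib abs_divide[symmetric] del: abs_divide) (simp add: field_simps)
  also have "\<dots> \<le> norm (a - b) / norm b"
    using norm_triangle_ineq3[of b a] by (intro divide_right_mono) (auto simp: norm_minus_commute)
  finally show ?thesis by (simp add: field_simps)
qed

text \<open>The support inequality is tested at the point of an inner ball in direction
  \<open>u\<close>. The positivity later fixes the sign of gradients.\<close>

lemma inner_support_pos:
  fixes L :: "'a::euclidean_space set"
  assumes "0 \<in> interior L" "u \<noteq> 0" "\<And>y. y \<in> L \<Longrightarrow> u \<bullet> (y - x) \<le> 0"
  shows "0 < u \<bullet> x"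
proof -
  obtain r where r: "0 < r" "cball 0 r \<subseteq> L" using assms(1) mem_interior_cball by blast
  have "(r / norm u) *\<^sub>R u \<in> L" using r assms(2) by (auto simp: subset_eq)
  from assms(3)[OF this] have "(r / norm u) * (u \<bullet> u) \<le> u \<bullet> x" by (simp add: inner_diff_right)
  moreover have "0 < (r / norm u) * (u \<bullet> u)" using r assms(2) by simp
  ultimately show ?thesis by linarith
qed

text \<open>The component \<open>e\<close> of \<open>u\<close> orthogonal to \<open>P x\<close> is
  tangent, so boundary points approach \<open>x\<close> in direction \<open>e\<close>. The support
  inequality then gives \<open>u \<bullet> e \<le> 0\<close>, although
  \<open>u \<bullet> e = e \<bullet> e\<close>.\<close>

lemma normal_parallel_gradient:
  assumes C: "C2_on U g P H" and M: "frontier L \<inter> U = {x\<in>U. g x = 0}" and "closed L"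
    and x: "x \<in> frontier L" "x \<in> U" "P x \<noteq> 0" and u: "\<And>y. y \<in> L \<Longrightarrow> u \<bullet> (y - x) \<le> 0"
  shows "u = (u \<bullet> P x / (P x \<bullet> P x)) *\<^sub>R P x"
proof -
  define e where "e = u - (u \<bullet> P x / (P x \<bullet> P x)) *\<^sub>R P x"
  have Pe: "P x \<bullet> e = 0" using x by (simp add: e_def inner_simps inner_commute)
  have "g x = 0" using M x by auto
  from C2_on_tangent_sequence[OF C x(2) this x(3) Pe]
  obtain y s where ys: "\<And>k. y k \<in> U" "\<And>k. g (y k) = 0" "\<And>k. 0 < s k"
    "(\<lambda>k. (y k - x) /\<^sub>R s k) \<longlonglongrightarrow> e" by metis
  have "y k \<in> L" for k using M ys \<open>closed L\<close> frontier_subset_closed by blast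
  then have "u \<bullet> ((y k - x) /\<^sub>R s k) \<le> 0" for k
    using u[of "y k"] ys(3)[of k] by (simp add: mult_nonneg_nonpos)
  moreover have "(\<lambda>k. u \<bullet> ((y k - x) /\<^sub>R s k)) \<longlonglongrightarrow> u \<bullet> e" by (intro tendsto_intros ys)
  ultimately have "u \<bullet> e \<le> 0" by (meson LIMSEQ_le_const2)
  moreover have "u \<bullet> e = e \<bullet> e" using Pe by (simp add: e_def inner_simps inner_commute)
  ultimately have "e = 0" using inner_gt_zero_iff[of e] by linarith
  then show ?thesis by (simp add: e_def)
qed

lemma C2_on_scale: "C2_on U g P H \<Longrightarrow> C2_on U (\<lambda>x. c * g x) (\<lambda>x. c *\<^sub>R P x) (\<lambda>x v. c *\<^sub>R H x v)"
  unfolding C2_on_def split_beta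
  by (auto intro!: continuous_intros derivative_eq_intros)

lemma C2_on_subset: "C2_on U g P H \<Longrightarrow> open V \<Longrightarrow> V \<subseteq> U \<Longrightarrow> C2_on V g P H"
  unfolding C2_on_def by (auto elim: continuous_on_subset)

lemma ex_support:
  fixes L :: "'a::euclidean_space set"
  assumes "convex L" "closed L" "interior L \<noteq> {}" "x \<in> frontier L"
  obtains u where "norm u = 1" "\<And>y. y \<in> L \<Longrightarrow> u \<bullet> (y - x) \<le> 0"
proof -
  have xL: "x \<in> L" using assms frontier_subset_closed by blast
  have "x \<notin> rel_interior L"
    using assms by (simp add: frontier_def rel_interior_nonempty_interior)
  then obtain a where a: "a \<noteq> 0" "\<And>y. y \<in> L \<Longrightarrow> a \<bullet> x \<le> a \<bullet> y"
    using supporting_hyperplane_rel_boundary[OF assms(1) xL] by metis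
  show thesis
  proof (rule that)
    show "norm (- sgn a) = 1" using a(1) by (simp add: norm_sgn)
    show "- sgn a \<bullet> (y - x) \<le> 0" if "y \<in> L" for y
      using a(2)[OF that] by (simp add: sgn_div_norm inner_diff_right mult_left_mono)
  qed
qed

section \<open>Uniform convexity of positively curved bodies\<close>

text \<open>A local defining function whose gradient points outward: the last clause makes
  \<open>sgn (P x)\<close> the only possible outer unit normal at a boundary point, so that normals
  can be differentiated through \<open>P\<close>.\<close>

definition boundary_chart where
  "boundary_chart L q U g P H \<longleftrightarrow> C2_on U g P H \<and> q \<in> U \<and> frontier L \<inter> U = {x\<in>U. g x = (0::real)} \<and>
     (\<forall>x\<in>U. P x \<noteq> 0) \<and>
     (\<forall>x u. x \<in> frontier L \<and> x \<in> U \<and> norm u = 1 \<and> (\<forall>y\<in>L. u \<bullet> (y - x) \<le> 0) \<longrightarrow> u = sgn (P x))"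

text \<open>The gradient of a given defining function may point either way. Since the origin is
  interior, an outer normal at \<open>x\<close> has positive inner product with \<open>x\<close>;
  the sign \<open>c\<close> arranges this at \<open>q\<close>, and \<open>U\<close> is shrunk to the
  points where it persists.\<close>

lemma ex_boundary_chart:
  fixes L :: "(real^'n) set"
  assumes L: "convex L" "closed L" "0 \<in> interior L" and sm: "smooth_hypersurface (frontier L)"
    and q: "q \<in> frontier L"
  obtains U g P H where "boundary_chart L q U g P H"
proof -
  obtain U0 and g0 :: "real^'n \<Rightarrow> real" where g0_all: "open U0 \<and> q \<in> U0 \<and> smooth_on U0 g0 \<and>
     (\<forall>x\<in>U0. frechet_derivative g0 (at x) \<noteq> (\<lambda>v. 0)) \<and> frontier L \<inter> U0 = {x\<in>U0. g0 x = 0}"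
    using bspec[OF sm[unfolded smooth_hypersurface_def] q] by (elim exE)
  have g0: "open U0" "q \<in> U0" "smooth_on U0 g0" "frontier L \<inter> U0 = {x\<in>U0. g0 x = 0}"
    and g0': "\<forall>x\<in>U0. frechet_derivative g0 (at x) \<noteq> (\<lambda>v. 0)" using g0_all by simp_all
  obtain P0 H0 where C0: "C2_on U0 g0 P0 H0" using smooth_on_C2[OF g0(1,3)] .
  have P0: "P0 x \<noteq> 0" if "x \<in> U0" for x
  proof
    assume "P0 x = 0"
    moreover have "(g0 has_derivative (\<lambda>v. P0 x \<bullet> v)) (at x)" using C0 that by (auto simp: C2_on_def)
    ultimately have "frechet_derivative g0 (at x) = (\<lambda>v. 0)" using frechet_derivative_at by fastforce
    with bspec[OF g0' that] show False by (rule notE)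
  qed
  obtain u where u: "norm u = 1" "\<And>y. y \<in> L \<Longrightarrow> u \<bullet> (y - q) \<le> 0"
    using ex_support[OF L(1,2) _ q] L(3) by blast
  have uq: "0 < u \<bullet> q" using inner_support_pos[OF L(3) _ u(2)] u(1) by fastforce
  have par: "u = (u \<bullet> P0 q / (P0 q \<bullet> P0 q)) *\<^sub>R P0 q"
    by (rule normal_parallel_gradient[OF C0 g0(4) L(2) q g0(2) P0[OF g0(2)] u(2)])
  have nz: "P0 q \<bullet> q \<noteq> 0"
  proof
    assume "P0 q \<bullet> q = 0"
    moreover have "u \<bullet> q = (u \<bullet> P0 q / (P0 q \<bullet> P0 q)) * (P0 q \<bullet> q)" by (subst par) simp
    ultimately show False using uq by simp
  qed
  define c where "c = sgn (P0 q \<bullet> q)"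
  define U where "U = {x \<in> U0. 0 < (c *\<^sub>R P0 x) \<bullet> x}"
  have "continuous_on U0 P0"
    using C0 has_derivative_continuous continuous_at_imp_continuous_on unfolding C2_on_def by blast
  then have "continuous_on U0 (\<lambda>x. (c *\<^sub>R P0 x) \<bullet> x)" by (intro continuous_intros)
  then have "open ((\<lambda>x. (c *\<^sub>R P0 x) \<bullet> x) -` {0<..} \<inter> U0)"
    using g0(1) continuous_on_open_vimage open_greaterThan by blast
  moreover have "(\<lambda>x. (c *\<^sub>R P0 x) \<bullet> x) -` {0<..} \<inter> U0 = U" by (auto simp: U_def)
  ultimately have "open U" by simp
  have qU: "q \<in> U" using g0(2) nz by (auto simp: U_def c_def sgn_if)
  have c0: "c \<noteq> 0" using nz by (simp add: c_def sgn_zero_iff)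
  have C: "C2_on U (\<lambda>x. c * g0 x) (\<lambda>x. c *\<^sub>R P0 x) (\<lambda>x v. c *\<^sub>R H0 x v)"
    by (rule C2_on_subset[OF C2_on_scale[OF C0] \<open>open U\<close>]) (auto simp: U_def)
  have fr: "frontier L \<inter> U = {x\<in>U. c * g0 x = 0}" using g0(4) c0 by (auto simp: U_def)
  have "boundary_chart L q U (\<lambda>x. c * g0 x) (\<lambda>x. c *\<^sub>R P0 x) (\<lambda>x v. c *\<^sub>R H0 x v)"
    unfolding boundary_chart_def
  proof (intro conjI C qU fr allI ballI impI)
    fix x assume "x \<in> U"
    then show "c *\<^sub>R P0 x \<noteq> 0" using c0 P0 by (auto simp: U_def)
  next
    fix x v assume xv: "x \<in> frontier L \<and> x \<in> U \<and> norm v = 1 \<and> (\<forall>y\<in>L. v \<bullet> (y - x) \<le> 0)"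
    define p where "p = c *\<^sub>R P0 x"
    have p: "p \<noteq> 0" "0 < p \<bullet> x" using xv c0 P0 by (auto simp: U_def p_def)
    have v: "v = (v \<bullet> p / (p \<bullet> p)) *\<^sub>R p"
      unfolding p_def by (rule normal_parallel_gradient[OF C fr L(2)]) (use xv p p_def in auto)
    have "0 < v \<bullet> x" using inner_support_pos[OF L(3), of v x] xv by fastforce
    moreover have "v \<bullet> x = (v \<bullet> p / (p \<bullet> p)) * (p \<bullet> x)" by (subst v) simp
    ultimately have "0 < (v \<bullet> p / (p \<bullet> p)) * (p \<bullet> x)" by linarith
    then have pos: "0 < v \<bullet> p / (p \<bullet> p)" using p(2) by (rule zero_less_mult_pos2)
    have "sgn v = v" using xv by (simp add: sgn_div_norm)
    moreover have "sgn v = sgn p" by (subst v, subst sgn_scaleR, subst sgn_pos[OF pos]) simp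
    ultimately show "v = sgn (c *\<^sub>R P0 x)" by (simp add: p_def)
  qed
  then show thesis by (rule that)
qed

text \<open>Existence by a supporting hyperplane and uniqueness by the chart make the definite
  description in \<open>outer_unit_normal\<close> meaningful.\<close>

lemma boundary_chart_normal:
  assumes "boundary_chart L q U g P H" "convex L" "closed L" "interior L \<noteq> {}" "x \<in> frontier L" "x \<in> U"
  shows "outer_unit_normal L x = sgn (P x)" "\<And>y. y \<in> L \<Longrightarrow> sgn (P x) \<bullet> (y - x) \<le> 0"
proof -
  have uniq: "u = sgn (P x)" if "norm u = 1" "\<And>y. y \<in> L \<Longrightarrow> u \<bullet> (y - x) \<le> 0" for u
    using assms that unfolding boundary_chart_def by blast
  obtain u where u: "norm u = 1" "\<And>y. y \<in> L \<Longrightarrow> u \<bullet> (y - x) \<le> 0"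
    using ex_support[OF assms(2-5)] by blast
  with uniq have eq: "u = sgn (P x)" by blast
  then show "\<And>y. y \<in> L \<Longrightarrow> sgn (P x) \<bullet> (y - x) \<le> 0" using u by simp
  show "outer_unit_normal L x = sgn (P x)"
    unfolding outer_unit_normal_def
  proof (rule the_equality)
    show "norm (sgn (P x)) = 1 \<and> (\<forall>y\<in>L. sgn (P x) \<bullet> (y - x) \<le> 0)"
      using u unfolding eq by blast
  qed (use uniq in blast)
qed

text \<open>For boundary points \<open>y k\<close> near \<open>q\<close> the Taylor expansion of
  \<open>g\<close> has vanishing values and a first-order term that is at most \<open>0\<close> by
  convexity, so the second-order term is nonnegative. Rescaling by \<open>s k\<close> and letting
  the points tend to \<open>q\<close> along \<open>e\<close> gives the claim.\<close>

lemma boundary_chart_form_nonneg: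
  fixes L :: "(real^'n) set"
  assumes ch: "boundary_chart L q U g P H" and L: "convex L" "closed L" "interior L \<noteq> {}"
    and q: "q \<in> frontier L" and e: "P q \<bullet> e = 0"
  shows "0 \<le> H q e \<bullet> e"
proof -
  have C: "C2_on U g P H" and qU: "q \<in> U" and fr: "frontier L \<inter> U = {x\<in>U. g x = 0}" and P0: "P q \<noteq> 0"
    using ch by (auto simp: boundary_chart_def)
  have gq: "g q = 0" using fr q qU by auto
  have "open U" and linH: "\<And>z. z \<in> U \<Longrightarrow> linear (H z)"
    using C by (auto simp: C2_on_def dest: has_derivative_linear)
  obtain r where r: "0 < r" "cball q r \<subseteq> U" using \<open>open U\<close> qU open_contains_cball by blast
  obtain y s where ys: "\<And>k. y k \<in> U" "\<And>k. g (y k) = 0" "\<And>k. 0 < s k" "s \<longlonglongrightarrow> 0"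
    "(\<lambda>k. (y k - q) /\<^sub>R s k) \<longlonglongrightarrow> e"
    using C2_on_tangent_sequence[OF C qU gq P0 e] by blast
  have yq: "y \<longlonglongrightarrow> q" by (rule tendsto_base_point[OF ys(3-5)])
  have Pneg: "P q \<bullet> (y k - q) \<le> 0" for k
  proof -
    have "y k \<in> L" using fr ys(1,2)[of k] frontier_subset_closed[OF L(2)] by auto
    then have "sgn (P q) \<bullet> (y k - q) \<le> 0" using boundary_chart_normal(2)[OF ch L q qU] by blast
    then show ?thesis using P0 by (simp add: sgn_div_norm mult_le_0_iff)
  qed
  have ev: "\<forall>\<^sub>F k in sequentially. dist (y k) q < r" using yq r(1) by (rule tendstoD)
  have "\<forall>\<^sub>F k in sequentially. \<exists>z. dist z q \<le> dist (y k) q \<and> 0 \<le> H z ((y k - q) /\<^sub>R s k) \<bullet> ((y k - q) /\<^sub>R s k)"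
    using ev
  proof (rule eventually_mono)
    fix k assume k: "dist (y k) q < r"
    have near: "dist q z \<le> dist (y k) q" if "z \<in> closed_segment q (q + (y k - q))" for z
      by (rule segment_dist_le[OF that]) (auto simp: dist_commute)
    then have "closed_segment q (q + (y k - q)) \<subseteq> U" using k r(2) by force
    from C2_on_taylor[OF C this] obtain z where z: "z \<in> closed_segment q (q + (y k - q))"
      "g (q + (y k - q)) = g q + P q \<bullet> (y k - q) + H z (y k - q) \<bullet> (y k - q) / 2" by blast
    have "0 \<le> H z (y k - q) \<bullet> (y k - q)" using z(2) gq ys(2)[of k] Pneg[of k] by simp
    moreover have "z \<in> U" using near[OF z(1)] k r(2) by force
    then have "H z ((y k - q) /\<^sub>R s k) = H z (y k - q) /\<^sub>R s k" using linear_scale[OF linH] by blast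
    ultimately have "0 \<le> H z ((y k - q) /\<^sub>R s k) \<bullet> ((y k - q) /\<^sub>R s k)"
      using ys(3)[of k] by simp
    then show "\<exists>z. dist z q \<le> dist (y k) q \<and> 0 \<le> H z ((y k - q) /\<^sub>R s k) \<bullet> ((y k - q) /\<^sub>R s k)"
      using near[OF z(1)] dist_commute by metis
  qed
  then obtain z where z: "\<forall>\<^sub>F k in sequentially. dist (z k) q \<le> dist (y k) q \<and>
      0 \<le> H (z k) ((y k - q) /\<^sub>R s k) \<bullet> ((y k - q) /\<^sub>R s k)"
    unfolding eventually_ex by blast
  have "(\<lambda>k. dist (z k) q) \<longlonglongrightarrow> 0"
  proof (rule tendsto_sandwich[OF _ _ tendsto_const])
    show "(\<lambda>k. dist (y k) q) \<longlonglongrightarrow> 0" using yq by (rule tendsto_dist_iff[THEN iffD1])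
    show "\<forall>\<^sub>F k in sequentially. dist (z k) q \<le> dist (y k) q" using z by (rule eventually_mono) blast
  qed auto
  then have zq: "z \<longlonglongrightarrow> q" by (rule tendsto_dist_iff[THEN iffD2])
  have "(\<lambda>k. H (z k) ((y k - q) /\<^sub>R s k) \<bullet> ((y k - q) /\<^sub>R s k)) \<longlonglongrightarrow> H q e \<bullet> e"
    by (intro tendsto_inner C2_on_tendsto[OF C qU zq] ys(5))
  then show ?thesis
    by (rule tendsto_lowerbound) (use z in \<open>auto elim: eventually_mono\<close>)
qed

text \<open>A null vector of a nonnegative symmetric form lies in its kernel. Here \<open>e\<close>
  is the tangential part of \<open>H q d\<close>; the form would be negative at some
  \<open>d + t e\<close> unless \<open>H q d \<bullet> e = 0\<close>, and this number is
  \<open>e \<bullet> e\<close>.\<close>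

lemma boundary_chart_form_null:
  fixes L :: "(real^'n) set"
  assumes ch: "boundary_chart L q U g P H" and L: "convex L" "closed L" "interior L \<noteq> {}"
    and q: "q \<in> frontier L" and d: "P q \<bullet> d = 0" "H q d \<bullet> d \<le> 0"
  obtains c where "H q d = c *\<^sub>R P q"
proof -
  have C: "C2_on U g P H" and qU: "q \<in> U" and P0: "P q \<noteq> 0"
    using ch by (auto simp: boundary_chart_def)
  have lin: "linear (H q)" using C qU by (auto simp: C2_on_def dest: has_derivative_linear)
  have nn: "0 \<le> H q e \<bullet> e" if "P q \<bullet> e = 0" for e
    by (rule boundary_chart_form_nonneg[OF ch L q that])
  have dd: "H q d \<bullet> d = 0" using nn[OF d(1)] d(2) by simp
  define e where "e = H q d - (H q d \<bullet> P q / (P q \<bullet> P q)) *\<^sub>R P q"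
  have Pe: "P q \<bullet> e = 0" using P0 by (simp add: e_def inner_diff_right inner_commute)
  have quad: "0 \<le> 2 * t * (H q d \<bullet> e) + t\<^sup>2 * (H q e \<bullet> e)" for t
  proof -
    have "P q \<bullet> (d + t *\<^sub>R e) = 0" using d(1) Pe by (simp add: inner_add_right)
    from nn[OF this] have "0 \<le> H q (d + t *\<^sub>R e) \<bullet> (d + t *\<^sub>R e)" .
    also have "\<dots> = H q d \<bullet> d + t * (H q d \<bullet> e) + t * (H q e \<bullet> d) + t * t * (H q e \<bullet> e)"
      by (simp add: linear_add[OF lin] linear_scale[OF lin] inner_add_left inner_add_right distrib_left)
    finally show ?thesis using dd C2_on_symmetric[OF C qU, of e d] by (simp add: power2_eq_square)
  qed
  have "H q d \<bullet> e = 0"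
  proof (rule ccontr)
    assume nz: "H q d \<bullet> e \<noteq> 0"
    define a b where "a = H q d \<bullet> e" and "b = H q e \<bullet> e"
    have "0 \<le> b" using nn[OF Pe] by (simp add: b_def)
    \<comment> \<open>Chosen so that \<open>2 t a + t\<^sup>2 b\<close> becomes
      \<open>- t\<^sup>2 (b + 2)\<close>; the summand \<open>1\<close> covers the case
      \<open>b = 0\<close>.\<close>
    define t where "t = - a / (b + 1)"
    have a: "a = - (t * (b + 1))" using \<open>0 \<le> b\<close> by (simp add: t_def)
    have "0 \<le> 2 * t * a + t\<^sup>2 * b" using quad[of t] by (simp only: a_def b_def)
    also have "\<dots> = - (t\<^sup>2 * (b + 2))" unfolding a by (simp add: algebra_simps power2_eq_square)
    finally have "t\<^sup>2 * (b + 2) \<le> 0" by simp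
    moreover have "t \<noteq> 0" using nz a by (auto simp: a_def)
    then have "0 < t\<^sup>2 * (b + 2)" using \<open>0 \<le> b\<close> by simp
    ultimately show False by simp
  qed
  moreover have "H q d \<bullet> e = e \<bullet> e"
  proof -
    have "H q d = e + (H q d \<bullet> P q / (P q \<bullet> P q)) *\<^sub>R P q" by (simp add: e_def)
    then have "H q d \<bullet> e = e \<bullet> e + (H q d \<bullet> P q / (P q \<bullet> P q)) * (P q \<bullet> e)"
      by (metis inner_add_left inner_scaleR_left)
    then show ?thesis using Pe by simp
  qed
  ultimately have "e = 0" by simp
  then show thesis using that by (simp add: e_def)
qed

lemma det_matrix_eq_0:
  fixes W :: "real^'n \<Rightarrow> real^'n"
  assumes "linear W" "W d = 0" "d \<noteq> 0"
  shows "det (matrix W) = 0"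
proof (rule ccontr)
  assume "det (matrix W) \<noteq> 0"
  then have "inj W" using det_nz_iff_inj[OF assms(1)] by blast
  moreover have "W 0 = 0" using assms(1) by (rule linear_0)
  ultimately show False using assms(2,3) by (metis injD)
qed

text \<open>This is where the determinant condition is exploited: the differential \<open>W\<close>
  of the Gauss map is injective, so normals that are constant to first order along \<open>d\<close>
  force \<open>d = 0\<close>.\<close>

lemma gauss_map_nondegenerate:
  assumes curv: "\<exists>\<kappa>>0. has_gaussian_curvature L q \<kappa>"
    and y: "\<And>k. y k \<in> frontier L" and s: "\<And>k. 0 < s k" "s \<longlonglongrightarrow> 0" "(\<lambda>k. (y k - q) /\<^sub>R s k) \<longlonglongrightarrow> d"
    and n: "(\<lambda>k. (outer_unit_normal L (y k) - outer_unit_normal L q) /\<^sub>R s k) \<longlonglongrightarrow> 0"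
  shows "d = 0"
proof (rule ccontr)
  assume d: "d \<noteq> 0"
  obtain W where W: "(outer_unit_normal L has_derivative W) (at q within frontier L)" "det (matrix W) > 0"
    using curv by (auto simp: has_gaussian_curvature_def)
  have "(\<lambda>k. (outer_unit_normal L (y k) - outer_unit_normal L q) /\<^sub>R s k) \<longlonglongrightarrow> W d"
    by (rule has_derivative_along_sequence[OF W(1) y s])
  then have "W d = 0" using n LIMSEQ_unique by blast
  with det_matrix_eq_0[OF has_derivative_linear[OF W(1)] _ d] W(2) show False by simp
qed

text \<open>If the second-order form vanishes on a tangent vector \<open>d\<close>, then
  \<open>H q d\<close> is a multiple of \<open>P q\<close>. Along \<open>d\<close> the gradient
  changes, to first order, only in length, so the unit normal does not turn and the Gauss map would
  degenerate.\<close>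

lemma boundary_chart_form_pos:
  fixes L :: "(real^'n) set"
  assumes ch: "boundary_chart L q U g P H" and L: "convex L" "closed L" "interior L \<noteq> {}"
    and q: "q \<in> frontier L" and curv: "\<exists>\<kappa>>0. has_gaussian_curvature L q \<kappa>"
    and d: "P q \<bullet> d = 0" "H q d \<bullet> d \<le> 0"
  shows "d = 0"
proof -
  have C: "C2_on U g P H" and qU: "q \<in> U" and fr: "frontier L \<inter> U = {x\<in>U. g x = 0}" and P0: "P q \<noteq> 0"
    using ch by (auto simp: boundary_chart_def)
  have gq: "g q = 0" using fr q qU by auto
  obtain c where c: "H q d = c *\<^sub>R P q" using boundary_chart_form_null[OF ch L q d] .
  obtain y s where ys: "\<And>k. y k \<in> U" "\<And>k. g (y k) = 0" "\<And>k. 0 < s k" "s \<longlonglongrightarrow> 0"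
    "(\<lambda>k. (y k - q) /\<^sub>R s k) \<longlonglongrightarrow> d"
    using C2_on_tangent_sequence[OF C qU gq P0 d(1)] by blast
  have yf: "y k \<in> frontier L" for k using ys(1,2)[of k] fr by auto
  have "(P has_derivative H q) (at q)" using C qU by (auto simp: C2_on_def)
  then have "(\<lambda>k. (P (y k) - P q) /\<^sub>R s k) \<longlonglongrightarrow> c *\<^sub>R P q"
    using has_derivative_along_sequence[OF _ _ ys(3-5)] c by (metis UNIV_I)
  then have l0: "(\<lambda>k. norm ((P (y k) - P q) /\<^sub>R s k - c *\<^sub>R P q)) \<longlonglongrightarrow> 0"
    by (simp add: LIM_zero_iff tendsto_norm_zero)
  have l1: "(\<lambda>k. 1 + s k * c) \<longlonglongrightarrow> 1 + 0 * c" by (intro tendsto_intros ys(4))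
  have ev: "\<forall>\<^sub>F k in sequentially. 1/2 < 1 + s k * c"
    using order_tendstoD(1)[OF l1, of "1/2"] by simp
  have "(\<lambda>k. (outer_unit_normal L (y k) - outer_unit_normal L q) /\<^sub>R s k) \<longlonglongrightarrow> 0"
  proof (rule Lim_null_comparison)
    show "(\<lambda>k. 4 / norm (P q) * norm ((P (y k) - P q) /\<^sub>R s k - c *\<^sub>R P q)) \<longlonglongrightarrow> 0"
      using tendsto_mult_left[OF l0, of "4 / norm (P q)"] by simp
    show "\<forall>\<^sub>F k in sequentially. norm ((outer_unit_normal L (y k) - outer_unit_normal L q) /\<^sub>R s k)
        \<le> 4 / norm (P q) * norm ((P (y k) - P q) /\<^sub>R s k - c *\<^sub>R P q)"
      using ev
    proof (rule eventually_mono)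
      fix k assume k: "1/2 < 1 + s k * c"
      \<comment> \<open>The first-order prediction of \<open>P (y k)\<close>. It has the direction
        of \<open>P q\<close>, so only the deviation from it turns the normal;
        \<open>norm b \<ge> norm (P q) / 2\<close> is the origin of the constant
        \<open>4 / norm (P q)\<close>.\<close>
      define b where "b = (1 + s k * c) *\<^sub>R P q"
      have b: "b \<noteq> 0" "sgn b = sgn (P q)" "norm (P q) / 2 \<le> norm b"
        using k P0 by (auto simp: b_def sgn_scaleR)
      have "norm (outer_unit_normal L (y k) - outer_unit_normal L q) = norm (sgn (P (y k)) - sgn b)"
        using boundary_chart_normal(1)[OF ch L yf ys(1)] boundary_chart_normal(1)[OF ch L q qU] b(2) by simp
      also have "\<dots> \<le> 2 * norm (P (y k) - b) / norm b" by (rule norm_sgn_diff_le[OF b(1)])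
      also have "\<dots> \<le> 2 * norm (P (y k) - b) / (norm (P q) / 2)"
        using b(1,3) P0 by (intro divide_left_mono) auto
      finally have "norm (outer_unit_normal L (y k) - outer_unit_normal L q) \<le> 4 / norm (P q) * norm (P (y k) - b)"
        by simp
      then have "inverse (s k) * norm (outer_unit_normal L (y k) - outer_unit_normal L q)
          \<le> inverse (s k) * (4 / norm (P q) * norm (P (y k) - b))"
        using ys(3)[of k] by (intro mult_left_mono) auto
      moreover have "(P (y k) - P q) /\<^sub>R s k - c *\<^sub>R P q = (P (y k) - b) /\<^sub>R s k"
        using ys(3)[of k] by (simp add: b_def algebra_simps)
      ultimately show "norm ((outer_unit_normal L (y k) - outer_unit_normal L q) /\<^sub>R s k)
          \<le> 4 / norm (P q) * norm ((P (y k) - P q) /\<^sub>R s k - c *\<^sub>R P q)"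
        using ys(3)[of k] by (simp add: mult.left_commute)
    qed
  qed
  then show ?thesis by (rule gauss_map_nondegenerate[OF curv yf ys(3-5)])
qed

text \<open>A blow-up argument. The unit secant directions subconverge to some \<open>d\<close>.
  Taylor expansion between two zeros of \<open>g\<close> shows that \<open>P \<bullet> e\<close> is
  of the order of the secant length, so \<open>d\<close> is tangent at \<open>q\<close>; it also
  turns the assumed failure of the quadratic gap into \<open>H q d \<bullet> d \<le> 0\<close>. Then
  \<open>boundary_chart_form_pos\<close> contradicts \<open>norm d = 1\<close>.\<close>

lemma boundary_no_degenerate_secants:
  fixes L :: "(real^'n) set"
  assumes ch: "boundary_chart L q U g P H" and L: "convex L" "closed L" "interior L \<noteq> {}"
    and q: "q \<in> frontier L" and curv: "\<exists>\<kappa>>0. has_gaussian_curvature L q \<kappa>"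
    and xy: "\<And>k. x k \<in> frontier L" "\<And>k. y k \<in> frontier L" "x \<longlonglongrightarrow> q" "y \<longlonglongrightarrow> q" "\<And>k. x k \<noteq> y k"
    and \<epsilon>: "\<epsilon> \<longlonglongrightarrow> 0"
    and less: "\<And>k. outer_unit_normal L (x k) \<bullet> (x k - y k) \<le> \<epsilon> k * (norm (x k - y k))\<^sup>2"
  shows False
proof -
  have C: "C2_on U g P H" and qU: "q \<in> U" and fr: "frontier L \<inter> U = {x\<in>U. g x = 0}" and P0: "P q \<noteq> 0"
    using ch by (auto simp: boundary_chart_def)
  have "open U" and linH: "\<And>z. z \<in> U \<Longrightarrow> linear (H z)"
    using C by (auto simp: C2_on_def dest: has_derivative_linear)
  have "(P has_derivative H q) (at q)" using C qU by (auto simp: C2_on_def)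
  then have contP: "isCont P q" by (rule has_derivative_continuous)
  define e where "e k = (y k - x k) /\<^sub>R norm (y k - x k)" for k
  have nz: "0 < norm (y k - x k)" for k using xy(5)[of k] by simp
  have ne: "norm (e k) = 1" for k using nz[of k] by (simp add: e_def)
  obtain d r where r: "strict_mono r" and ed: "(e \<circ> r) \<longlonglongrightarrow> d" and d: "d \<in> sphere 0 1"
    using compact_sphere[of "0::real^'n" 1, unfolded compact_def] ne
    by (metis (no_types, lifting) dist_0_norm mem_sphere)
  define X where "X k = x (r k)" for k
  define Y where "Y k = y (r k)" for k
  have X: "X \<longlonglongrightarrow> q" and Y: "Y \<longlonglongrightarrow> q"
    using LIMSEQ_subseq_LIMSEQ[OF xy(3) r] LIMSEQ_subseq_LIMSEQ[OF xy(4) r]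
    by (simp_all add: X_def[abs_def] Y_def[abs_def] o_def)
  have E: "(\<lambda>k. e (r k)) \<longlonglongrightarrow> d" using ed by (simp add: o_def)
  have \<epsilon>r: "(\<lambda>k. \<epsilon> (r k)) \<longlonglongrightarrow> 0" using LIMSEQ_subseq_LIMSEQ[OF \<epsilon> r] by (simp add: o_def)
  have PX: "(\<lambda>k. P (X k)) \<longlonglongrightarrow> P q" by (rule isCont_tendsto_compose[OF contP X])
  obtain R where R: "0 < R" "cball q R \<subseteq> U" using \<open>open U\<close> qU open_contains_cball by blast
  have "\<forall>\<^sub>F k in sequentially. dist (X k) q < R \<and> dist (Y k) q < R"
    using tendstoD[OF X R(1)] tendstoD[OF Y R(1)] by (rule eventually_conj)
  then have "\<forall>\<^sub>F k in sequentially. \<exists>z. dist z q \<le> max (dist (X k) q) (dist (Y k) q) \<and>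
     P (X k) \<bullet> e (r k) = - (H z (e (r k)) \<bullet> e (r k)) / 2 * norm (Y k - X k) \<and>
     H z (e (r k)) \<bullet> e (r k) \<le> 2 * norm (P (X k)) * \<epsilon> (r k)"
  proof (rule eventually_mono)
    fix k assume k: "dist (X k) q < R \<and> dist (Y k) q < R"
    define n where "n = norm (Y k - X k)"
    have n: "0 < n" "Y k - X k = n *\<^sub>R e (r k)" using nz[of "r k"]
      by (auto simp: n_def X_def Y_def e_def)
    have near: "dist q z \<le> max (dist (X k) q) (dist (Y k) q)"
      if "z \<in> closed_segment (X k) (X k + n *\<^sub>R e (r k))" for z
      by (rule segment_dist_le[OF that]) (auto simp: dist_commute n(2)[symmetric])
    then have "closed_segment (X k) (X k + n *\<^sub>R e (r k)) \<subseteq> U" using k R(2) by force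
    from C2_on_taylor[OF C this] obtain z where z: "z \<in> closed_segment (X k) (X k + n *\<^sub>R e (r k))"
      "g (X k + n *\<^sub>R e (r k)) = g (X k) + P (X k) \<bullet> (n *\<^sub>R e (r k)) + H z (n *\<^sub>R e (r k)) \<bullet> (n *\<^sub>R e (r k)) / 2"
      by blast
    have zU: "z \<in> U" using near[OF z(1)] k R(2) by force
    have XU: "X k \<in> U" "Y k \<in> U" using k R(2) by (force simp: dist_commute)+
    have Xf: "X k \<in> frontier L" "Y k \<in> frontier L" using xy(1,2) by (auto simp: X_def Y_def)
    have "g (X k) = 0" "g (Y k) = 0" using XU Xf fr by auto
    moreover have "X k + n *\<^sub>R e (r k) = Y k" unfolding n(2)[symmetric] by simp
    ultimately have "P (X k) \<bullet> (n *\<^sub>R e (r k)) + H z (n *\<^sub>R e (r k)) \<bullet> (n *\<^sub>R e (r k)) / 2 = 0"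
      using z(2) by simp
    then have "n * (P (X k) \<bullet> e (r k) + n * (H z (e (r k)) \<bullet> e (r k)) / 2) = 0"
      by (simp add: linear_scale[OF linH[OF zU]] distrib_left)
    then have eq: "P (X k) \<bullet> e (r k) = - (H z (e (r k)) \<bullet> e (r k)) / 2 * n"
      using n(1) by (simp add: eq_neg_iff_add_eq_0 mult.commute)
    have "outer_unit_normal L (X k) = sgn (P (X k))"
      by (rule boundary_chart_normal(1)[OF ch L Xf(1) XU(1)])
    moreover have "P (X k) \<noteq> 0" using ch XU(1) by (auto simp: boundary_chart_def)
    ultimately have Pn: "P (X k) = norm (P (X k)) *\<^sub>R outer_unit_normal L (X k)" by (simp add: sgn_div_norm)
    have "outer_unit_normal L (X k) \<bullet> (X k - Y k) \<le> \<epsilon> (r k) * n\<^sup>2"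
      using less[of "r k"] by (simp add: X_def Y_def n_def norm_minus_commute)
    moreover have "X k - Y k = - (n *\<^sub>R e (r k))" using n(2) by (metis minus_diff_eq)
    ultimately have "- n * (outer_unit_normal L (X k) \<bullet> e (r k)) \<le> n * (\<epsilon> (r k) * n)"
      by (simp add: power2_eq_square mult.left_commute)
    then have "- (outer_unit_normal L (X k) \<bullet> e (r k)) \<le> \<epsilon> (r k) * n"
      using n(1) by (metis mult_le_cancel_left_pos mult_minus_left mult_minus_right)
    then have "norm (P (X k)) * - (outer_unit_normal L (X k) \<bullet> e (r k)) \<le> norm (P (X k)) * (\<epsilon> (r k) * n)"
      by (intro mult_left_mono) auto
    moreover have "norm (P (X k)) * - (outer_unit_normal L (X k) \<bullet> e (r k)) = - (P (X k) \<bullet> e (r k))"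
      using arg_cong[OF Pn, of "\<lambda>v. v \<bullet> e (r k)"] by simp
    ultimately have "n * (H z (e (r k)) \<bullet> e (r k)) \<le> n * (2 * norm (P (X k)) * \<epsilon> (r k))"
      unfolding eq by (simp add: mult_ac)
    then have "H z (e (r k)) \<bullet> e (r k) \<le> 2 * norm (P (X k)) * \<epsilon> (r k)"
      using n(1) by (simp only: mult_le_cancel_left_pos)
    with eq near[OF z(1)] show "\<exists>z. dist z q \<le> max (dist (X k) q) (dist (Y k) q) \<and>
     P (X k) \<bullet> e (r k) = - (H z (e (r k)) \<bullet> e (r k)) / 2 * norm (Y k - X k) \<and>
     H z (e (r k)) \<bullet> e (r k) \<le> 2 * norm (P (X k)) * \<epsilon> (r k)"
      unfolding n_def by (intro exI[of _ z]) (simp add: dist_commute)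
  qed
  then obtain z where z: "\<forall>\<^sub>F k in sequentially. dist (z k) q \<le> max (dist (X k) q) (dist (Y k) q) \<and>
     P (X k) \<bullet> e (r k) = - (H (z k) (e (r k)) \<bullet> e (r k)) / 2 * norm (Y k - X k) \<and>
     H (z k) (e (r k)) \<bullet> e (r k) \<le> 2 * norm (P (X k)) * \<epsilon> (r k)"
    unfolding eventually_ex by blast
  have "(\<lambda>k. dist (z k) q) \<longlonglongrightarrow> 0"
  proof (rule tendsto_sandwich[OF _ _ tendsto_const])
    have "(\<lambda>k. max (dist (X k) q) (dist (Y k) q)) \<longlonglongrightarrow> max 0 0"
      by (intro tendsto_max tendsto_dist_iff[THEN iffD1] X Y)
    then show "(\<lambda>k. max (dist (X k) q) (dist (Y k) q)) \<longlonglongrightarrow> 0" by simp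
    show "\<forall>\<^sub>F k in sequentially. dist (z k) q \<le> max (dist (X k) q) (dist (Y k) q)"
      using z by (rule eventually_mono) blast
  qed auto
  then have zq: "z \<longlonglongrightarrow> q" by (rule tendsto_dist_iff[THEN iffD2])
  have He: "(\<lambda>k. H (z k) (e (r k)) \<bullet> e (r k)) \<longlonglongrightarrow> H q d \<bullet> d"
    by (intro tendsto_inner C2_on_tendsto[OF C qU zq] E)
  have lim0: "(\<lambda>k. 2 * norm (P (X k)) * \<epsilon> (r k)) \<longlonglongrightarrow> 2 * norm (P q) * 0"
    by (intro tendsto_intros PX \<epsilon>r)
  have "H q d \<bullet> d \<le> 2 * norm (P q) * 0"
    by (rule tendsto_le[OF _ lim0 He]) (use z in \<open>auto elim: eventually_mono\<close>)
  then have Hd: "H q d \<bullet> d \<le> 0" by simp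
  have "(\<lambda>k. - (H (z k) (e (r k)) \<bullet> e (r k)) / 2 * norm (Y k - X k)) \<longlonglongrightarrow> - (H q d \<bullet> d) / 2 * norm (q - q)"
    by (intro tendsto_intros He X Y) auto
  moreover have "\<forall>\<^sub>F k in sequentially. - (H (z k) (e (r k)) \<bullet> e (r k)) / 2 * norm (Y k - X k) = P (X k) \<bullet> e (r k)"
    using z by (rule eventually_mono) simp
  ultimately have "(\<lambda>k. P (X k) \<bullet> e (r k)) \<longlonglongrightarrow> 0"
    by (simp add: tendsto_cong)
  moreover have "(\<lambda>k. P (X k) \<bullet> e (r k)) \<longlonglongrightarrow> P q \<bullet> d" by (intro tendsto_intros PX E)
  ultimately have "P q \<bullet> d = 0" using LIMSEQ_unique by blast
  then have "d = 0" by (rule boundary_chart_form_pos[OF ch L q curv _ Hd])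
  with d show False by simp
qed

text \<open>If no constant works, compactness provides boundary pairs violating ever smaller
  constants and converging to \<open>q\<close> and \<open>p\<close>. The case
  \<open>p \<noteq> q\<close> would give a flat piece of boundary, the case \<open>p = q\<close>
  degenerate secants.\<close>

lemma uniformly_convex_boundary:
  fixes L :: "(real^'n) set"
  assumes body: "convex_body L" and L0: "0 \<in> interior L" and sm: "smooth_positively_curved L"
  obtains u c where "0 < c" "\<And>x. x \<in> frontier L \<Longrightarrow> u x \<bullet> x = 1"
    "\<And>x y. x \<in> frontier L \<Longrightarrow> y \<in> frontier L \<Longrightarrow> c * (norm (x - y))\<^sup>2 \<le> u x \<bullet> (x - y)"
proof -
  have L: "convex L" "closed L" "interior L \<noteq> {}" and cp: "compact L"
    using body by (auto simp: convex_body_def compact_imp_closed)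
  define \<nu> where "\<nu> = outer_unit_normal L"
  have curv: "\<exists>\<kappa>>0. has_gaussian_curvature L q \<kappa>" if "q \<in> frontier L" for q
    using sm that by (auto simp: smooth_positively_curved_def)
  have chart: "\<exists>U g P H. boundary_chart L q U g P H" if "q \<in> frontier L" for q
    using ex_boundary_chart[OF L(1,2) L0 _ that] sm unfolding smooth_positively_curved_def by metis
  have nu: "norm (\<nu> q) = 1" "\<And>y. y \<in> L \<Longrightarrow> \<nu> q \<bullet> (y - q) \<le> 0"
    and uniq: "\<And>v. norm v = 1 \<Longrightarrow> (\<And>y. y \<in> L \<Longrightarrow> v \<bullet> (y - q) \<le> 0) \<Longrightarrow> v = \<nu> q"
    if q: "q \<in> frontier L" for q
  proof -
    obtain U g P H where ch: "boundary_chart L q U g P H" using chart[OF q] by blast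
    then have qU: "q \<in> U" "P q \<noteq> 0" by (auto simp: boundary_chart_def)
    note n = boundary_chart_normal[OF ch L q qU(1)]
    show "norm (\<nu> q) = 1" using n(1) qU(2) by (simp add: \<nu>_def norm_sgn)
    show "\<nu> q \<bullet> (y - q) \<le> 0" if "y \<in> L" for y using n(2)[OF that] n(1) by (simp add: \<nu>_def)
    show "v = \<nu> q" if "norm v = 1" "\<And>y. y \<in> L \<Longrightarrow> v \<bullet> (y - q) \<le> 0" for v
    proof -
      have "v = sgn (P q)" using ch q qU that unfolding boundary_chart_def by blast
      then show ?thesis using n(1) by (simp add: \<nu>_def)
    qed
  qed
  have "\<exists>c>0. \<forall>x\<in>frontier L. \<forall>y\<in>frontier L. c * (norm (x - y))\<^sup>2 \<le> \<nu> x \<bullet> (x - y)"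
  proof (rule ccontr)
    assume "\<not> ?thesis"
    then have "\<exists>x y. x \<in> frontier L \<and> y \<in> frontier L \<and> \<nu> x \<bullet> (x - y) < inverse (real (Suc k)) * (norm (x - y))\<^sup>2" for k
      by (metis inverse_positive_iff_positive not_less of_nat_0_less_iff zero_less_Suc)
    then obtain x y where xy: "\<And>k. x k \<in> frontier L" "\<And>k. y k \<in> frontier L"
      "\<And>k. \<nu> (x k) \<bullet> (x k - y k) < inverse (real (Suc k)) * (norm (x k - y k))\<^sup>2"
      by metis
    have "compact (frontier L \<times> frontier L)" using cp by (intro compact_Times compact_frontier)
    then obtain l r where l: "l \<in> frontier L \<times> frontier L" and r: "strict_mono r"
       and lim: "((\<lambda>k. (x k, y k)) \<circ> r) \<longlonglongrightarrow> l"
      using xy(1,2) unfolding compact_def by (metis (no_types, lifting) mem_Sigma_iff)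
    obtain q p where lqp: "l = (q, p)" by (cases l)
    define X where "X k = x (r k)" for k
    define Y where "Y k = y (r k)" for k
    define \<epsilon> where "\<epsilon> k = inverse (real (Suc (r k)))" for k
    have qp: "q \<in> frontier L" "p \<in> frontier L" using l lqp by auto
    have X: "X \<longlonglongrightarrow> q" and Y: "Y \<longlonglongrightarrow> p"
      using tendsto_fst[OF lim] tendsto_snd[OF lim] lqp
      by (simp_all add: X_def[abs_def] Y_def[abs_def] o_def)
    have Xf: "X k \<in> frontier L" "Y k \<in> frontier L" for k using xy by (auto simp: X_def Y_def)
    have \<epsilon>: "\<epsilon> \<longlonglongrightarrow> 0"
      using LIMSEQ_subseq_LIMSEQ[OF LIMSEQ_inverse_real_of_nat r] by (simp add: \<epsilon>_def[abs_def] o_def)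
    have less: "\<nu> (X k) \<bullet> (X k - Y k) < \<epsilon> k * (norm (X k - Y k))\<^sup>2" for k
      using xy(3)[of "r k"] by (simp add: X_def Y_def \<epsilon>_def)
    obtain U g P H where ch: "boundary_chart L q U g P H" using chart[OF qp(1)] by blast
    have C: "C2_on U g P H" and qU: "q \<in> U" and P0: "P q \<noteq> 0" using ch by (auto simp: boundary_chart_def)
    \<comment> \<open>If \<open>p \<noteq> q\<close>, the limit of the violated inequalities puts
      \<open>p\<close> on the supporting hyperplane at \<open>q\<close>. The segment from
      \<open>q\<close> to \<open>p\<close> then lies in the boundary with constant normal
      \<open>\<nu> q\<close>, and \<open>gauss_map_nondegenerate\<close> applied along it gives
      \<open>p - q = 0\<close>.\<close>
    have "p = q"
    proof (rule ccontr)
      assume "p \<noteq> q"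
      have "open U" "(P has_derivative H q) (at q)" using C qU by (auto simp: C2_on_def)
      then have contP: "isCont P q" by (auto dest: has_derivative_continuous)
      have "(\<lambda>k. sgn (P (X k))) \<longlonglongrightarrow> sgn (P q)"
        by (intro tendsto_sgn isCont_tendsto_compose[OF contP X] P0)
      moreover have "\<forall>\<^sub>F k in sequentially. X k \<in> U" using X \<open>open U\<close> qU by (rule topological_tendstoD)
      then have "\<forall>\<^sub>F k in sequentially. sgn (P (X k)) = \<nu> (X k)"
        by (rule eventually_mono) (use boundary_chart_normal(1)[OF ch L Xf(1)] \<nu>_def in simp)
      ultimately have "(\<lambda>k. \<nu> (X k)) \<longlonglongrightarrow> sgn (P q)" using tendsto_cong by fastforce
      then have nX: "(\<lambda>k. \<nu> (X k)) \<longlonglongrightarrow> \<nu> q"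
        using boundary_chart_normal(1)[OF ch L qp(1) qU] by (simp add: \<nu>_def)
      have l1: "(\<lambda>k. \<nu> (X k) \<bullet> (X k - Y k)) \<longlonglongrightarrow> \<nu> q \<bullet> (q - p)" by (intro tendsto_intros nX X Y)
      have l2: "(\<lambda>k. \<epsilon> k * (norm (X k - Y k))\<^sup>2) \<longlonglongrightarrow> 0 * (norm (q - p))\<^sup>2" by (intro tendsto_intros \<epsilon> X Y)
      have "\<nu> q \<bullet> (q - p) \<le> 0 * (norm (q - p))\<^sup>2"
        by (rule tendsto_le[OF _ l2 l1]) (use less in \<open>auto intro!: always_eventually less_imp_le\<close>)
      moreover have pL: "p \<in> L" "q \<in> L" using qp frontier_subset_closed[OF L(2)] by auto
      ultimately have flat: "\<nu> q \<bullet> (p - q) = 0" using nu(2)[OF qp(1) pL(1)] by (simp add: inner_diff_right)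
      define s where "s k = inverse (real (Suc k))" for k
      define z where "z k = q + s k *\<^sub>R (p - q)" for k
      have s: "0 < s k" "s k \<le> 1" for k by (auto simp: s_def inverse_le_1_iff)
      have zL: "z k \<in> L" for k
      proof -
        have "z k = (1 - s k) *\<^sub>R q + s k *\<^sub>R p" by (simp add: z_def algebra_simps)
        then show ?thesis using convexD[OF L(1) pL(2,1), of "1 - s k" "s k"] s[of k] by simp
      qed
      have zn: "\<nu> q \<bullet> (w - z k) \<le> 0" if "w \<in> L" for w k
      proof -
        have "\<nu> q \<bullet> (w - z k) = \<nu> q \<bullet> (w - q) - s k * (\<nu> q \<bullet> (p - q))"
          by (simp add: z_def inner_simps algebra_simps)
        then show ?thesis using nu(2)[OF qp(1) that] flat by simp
      qed
      have zf: "z k \<in> frontier L" for k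
      proof -
        have "z k \<notin> interior L"
        proof
          assume "z k \<in> interior L"
          then obtain \<rho> where \<rho>: "0 < \<rho>" "cball (z k) \<rho> \<subseteq> L" using mem_interior_cball by blast
          have "z k + \<rho> *\<^sub>R \<nu> q \<in> L" using \<rho> nu(1)[OF qp(1)] by (auto simp: subset_eq dist_norm)
          from zn[OF this, of k] have "\<rho> * (\<nu> q \<bullet> \<nu> q) \<le> 0" by simp
          moreover have "\<nu> q \<bullet> \<nu> q = 1" using nu(1)[OF qp(1)] by (simp add: dot_square_norm)
          ultimately show False using \<rho>(1) by simp
        qed
        then show ?thesis using zL[of k] closure_subset by (auto simp: frontier_def)
      qed
      have zq: "\<nu> (z k) = \<nu> q" for k using uniq[OF zf nu(1)[OF qp(1)] zn] by simp
      have "p - q = 0"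
      proof (rule gauss_map_nondegenerate[OF curv[OF qp(1)] zf s(1)])
        show "s \<longlonglongrightarrow> 0" unfolding s_def by (rule LIMSEQ_inverse_real_of_nat)
        have "(z k - q) /\<^sub>R s k = p - q" for k using s(1)[of k] by (simp add: z_def)
        then show "(\<lambda>k. (z k - q) /\<^sub>R s k) \<longlonglongrightarrow> p - q" by simp
        show "(\<lambda>k. (outer_unit_normal L (z k) - outer_unit_normal L q) /\<^sub>R s k) \<longlonglongrightarrow> 0"
          using zq by (simp add: \<nu>_def)
      qed
      with \<open>p \<noteq> q\<close> show False by simp
    qed
    moreover have "X k \<noteq> Y k" for k using less[of k] by auto
    ultimately show False
      using boundary_no_degenerate_secants[OF ch L qp(1) curv[OF qp(1)] Xf X _ _ \<epsilon>] Y less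
      unfolding \<nu>_def by (meson less_imp_le)
  qed
  then obtain c where c: "0 < c" "\<And>x y. x \<in> frontier L \<Longrightarrow> y \<in> frontier L \<Longrightarrow> c * (norm (x - y))\<^sup>2 \<le> \<nu> x \<bullet> (x - y)"
    by blast
  obtain R where R: "0 < R" "\<And>x. x \<in> L \<Longrightarrow> norm x \<le> R"
    using compact_imp_bounded[OF cp] unfolding bounded_pos by blast
  have pos: "0 < \<nu> x \<bullet> x" "\<nu> x \<bullet> x \<le> R" if x: "x \<in> frontier L" for x
  proof -
    show "0 < \<nu> x \<bullet> x"
      by (rule inner_support_pos[OF L0 _ nu(2)[OF x]]) (use nu(1)[OF x] in auto)
    have "\<nu> x \<bullet> x \<le> norm (\<nu> x) * norm x" by (rule norm_cauchy_schwarz)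
    also have "\<dots> \<le> R" using nu(1)[OF x] R(2)[of x] x frontier_subset_closed[OF L(2)] by auto
    finally show "\<nu> x \<bullet> x \<le> R" .
  qed
  \<comment> \<open>Dividing the normal by \<open>\<nu> x \<bullet> x\<close>, which is at most
    \<open>R\<close>, normalizes \<open>u x \<bullet> x\<close> to \<open>1\<close>, so that
    \<open>u x\<close> acts as a differential of the gauge at \<open>x\<close>; the price is the
    factor \<open>R\<close> in the constant.\<close>
  show thesis
  proof (rule that)
    show "0 < c / R" using c R by simp
    show "(\<nu> x /\<^sub>R (\<nu> x \<bullet> x)) \<bullet> x = 1" if "x \<in> frontier L" for x using pos[OF that] by simp
    show "c / R * (norm (x - y))\<^sup>2 \<le> (\<nu> x /\<^sub>R (\<nu> x \<bullet> x)) \<bullet> (x - y)"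
      if "x \<in> frontier L" "y \<in> frontier L" for x y
    proof -
      have "c / R * (norm (x - y))\<^sup>2 = c * (norm (x - y))\<^sup>2 / R" by simp
      also have "\<dots> \<le> c * (norm (x - y))\<^sup>2 / (\<nu> x \<bullet> x)"
        using pos[OF that(1)] c(1) R(1) by (intro divide_left_mono) auto
      also have "\<dots> \<le> \<nu> x \<bullet> (x - y) / (\<nu> x \<bullet> x)"
        using c(2)[OF that] pos[OF that(1)] by (intro divide_right_mono) auto
      finally show ?thesis by (simp add: divide_inverse mult.commute)
    qed
  qed
qed

section \<open>Gauge functions and perturbed bodies\<close>

locale symmetric_body =
  fixes L :: "(real^'n) set"
  assumes body: "convex_body L" and symm: "origin_symmetric L"
begin

abbreviation p where "p \<equiv> minkowski_functional L"

lemma body_basic: "compact L" "convex L" "closed L" "bounded L"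
  using body by (auto simp: convex_body_def compact_imp_closed compact_imp_bounded)

lemma zero_interior: "0 \<in> interior L"
proof -
  have neg: "uminus ` L = L" using symm by (force simp: origin_symmetric_def image_iff)
  obtain z where z: "z \<in> interior L" using body by (auto simp: convex_body_def)
  then have "- z \<in> uminus ` interior L" by blast
  also have "uminus ` interior L = interior L" using interior_negations[of L] neg by simp
  finally have "(1/2) *\<^sub>R z + (1/2) *\<^sub>R (- z) \<in> interior L"
    using z convex_interior[OF body_basic(2)] by (intro convexD) auto
  then show ?thesis by simp
qed

lemma inner_ball: obtains r where "0 < r" "cball 0 r \<subseteq> L"
  using zero_interior mem_interior_cball by blast

lemma outer_ball: obtains R where "0 < R" "\<And>x. x \<in> L \<Longrightarrow> norm x \<le> R"
  using body_basic(4) unfolding bounded_pos by blast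

lemma scale_mem: "x \<in> L \<Longrightarrow> 0 \<le> t \<Longrightarrow> t \<le> 1 \<Longrightarrow> t *\<^sub>R x \<in> L"
  using convexD[OF body_basic(2), of x 0 t "1 - t"] zero_interior interior_subset by auto

lemma mem_scaled_iff: "0 < a \<Longrightarrow> x \<in> (*\<^sub>R) a ` L \<longleftrightarrow> x /\<^sub>R a \<in> L"
  by (force simp: image_iff)

text \<open>The admissible scalings form an up-set because \<open>L\<close> is star-shaped about the
  origin, and the infimum is attained because \<open>L\<close> is closed: the points scaled by
  \<open>t + 1 / (k + 1)\<close> lie in \<open>L\<close> and converge.\<close>

lemma gauge_le_iff:
  assumes t: "0 < t"
  shows "p x \<le> t \<longleftrightarrow> x /\<^sub>R t \<in> L"
proof -
  define A where "A = {a. 0 < a \<and> x \<in> (*\<^sub>R) a ` L}"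
  have A: "a \<in> A \<longleftrightarrow> 0 < a \<and> x /\<^sub>R a \<in> L" for a using mem_scaled_iff by (auto simp: A_def)
  have pA: "p x = Inf A" by (simp add: minkowski_functional_def A_def)
  have bdd: "bdd_below A" by (rule bdd_belowI[of _ 0]) (auto simp: A_def)
  have up: "b \<in> A" if "a \<in> A" "a \<le> b" for a b
  proof -
    have ab: "0 < a" "x /\<^sub>R a \<in> L" "0 < b" using that A by auto
    have "x /\<^sub>R b = (a / b) *\<^sub>R (x /\<^sub>R a)" using ab by (simp add: divide_inverse mult.commute)
    also have "\<dots> \<in> L" using ab that(2) by (intro scale_mem[OF ab(2)]) auto
    finally show ?thesis using ab A by auto
  qed
  obtain r where r: "0 < r" "cball 0 r \<subseteq> L" by (rule inner_ball)
  have ne: "A \<noteq> {}"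
  proof -
    have n: "0 < norm x / r + 1" using r by (simp add: add_nonneg_pos)
    have "norm (x /\<^sub>R (norm x / r + 1)) = norm x / (norm x / r + 1)" using n by (simp add: divide_inverse mult.commute)
    also have "\<dots> \<le> r" using n r by (simp add: field_simps)
    finally have "x /\<^sub>R (norm x / r + 1) \<in> cball 0 r" by (simp add: mem_cball_0)
    then have "norm x / r + 1 \<in> A" using r n A by blast
    then show ?thesis by blast
  qed
  show ?thesis
  proof
    assume "x /\<^sub>R t \<in> L"
    then show "p x \<le> t" unfolding pA using t A bdd by (intro cInf_lower) auto
  next
    assume le: "p x \<le> t"
    have s: "s \<in> A" if "t < s" for s
    proof -
      have "Inf A < s" using le that pA by simp
      then obtain a where "a \<in> A" "a < s" using ne bdd cInf_less_iff by blast
      then show ?thesis using up[of a s] by simp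
    qed
    have lim: "(\<lambda>k. x /\<^sub>R (t + inverse (real (Suc k)))) \<longlonglongrightarrow> x /\<^sub>R (t + 0)"
      using t by (intro tendsto_intros LIMSEQ_inverse_real_of_nat) auto
    have "x /\<^sub>R (t + 0) \<in> L"
      by (rule closed_sequentially[OF body_basic(3) _ lim]) (use s A in auto)
    then show "x /\<^sub>R t \<in> L" by simp
  qed
qed

lemma gauge_nonneg: "0 \<le> p x"
proof (rule ccontr)
  assume "\<not> 0 \<le> p x"
  then have lt: "p x < 0" by simp
  have ne: "{a. 0 < a \<and> x \<in> (*\<^sub>R) a ` L} \<noteq> {}"
  proof -
    have "x /\<^sub>R 1 \<in> L" using gauge_le_iff[of 1 x] lt by simp
    then show ?thesis using mem_scaled_iff[of 1 x] by (metis (mono_tags, lifting) empty_iff mem_Collect_eq zero_less_one)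
  qed
  have "0 \<le> p x" unfolding minkowski_functional_def by (rule cInf_greatest[OF ne]) auto
  with lt show False by simp
qed

text \<open>\<open>gauge_le_iff\<close> concerns positive \<open>t\<close> only, while
  \<open>b\<close> and the gauge may be \<open>0\<close>; hence the comparison up to an arbitrary
  \<open>e\<close>.\<close>

lemma gauge_eqI:
  assumes "0 \<le> b" "\<And>t. 0 < t \<Longrightarrow> x /\<^sub>R t \<in> L \<longleftrightarrow> b \<le> t"
  shows "p x = b"
proof (rule antisym)
  show "p x \<le> b"
  proof (rule field_le_epsilon)
    fix e :: real assume "0 < e"
    then show "p x \<le> b + e" using assms gauge_le_iff[of "b + e" x] by simp
  qed
  show "b \<le> p x"
  proof (rule field_le_epsilon)
    fix e :: real assume "0 < e"
    then have "0 < p x + e" using gauge_nonneg[of x] by simp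
    then show "b \<le> p x + e" using assms(2)[of "p x + e"] gauge_le_iff[of "p x + e" x] \<open>0 < e\<close> by simp
  qed
qed

lemma gauge_zero [simp]: "p 0 = 0"
proof (rule gauge_eqI)
  have "0 \<in> L" using zero_interior interior_subset by blast
  then show "\<And>t. 0 < t \<Longrightarrow> 0 /\<^sub>R t \<in> L \<longleftrightarrow> 0 \<le> t" by auto
qed simp

lemma gauge_scale: "0 \<le> t \<Longrightarrow> p (t *\<^sub>R x) = t * p x"
proof (cases "t = 0")
  case False
  assume "0 \<le> t"
  with False have t: "0 < t" by simp
  show ?thesis
  proof (rule gauge_eqI)
    show "0 \<le> t * p x" using t gauge_nonneg by simp
    fix s :: real assume s: "0 < s"
    have "(t *\<^sub>R x) /\<^sub>R s = x /\<^sub>R (s / t)" using t s by (simp add: divide_inverse mult.commute)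
    then have "(t *\<^sub>R x) /\<^sub>R s \<in> L \<longleftrightarrow> p x \<le> s / t" using gauge_le_iff[of "s / t" x] s t by (simp only: divide_pos_pos)
    then show "(t *\<^sub>R x) /\<^sub>R s \<in> L \<longleftrightarrow> t * p x \<le> s" using t by (simp add: pos_le_divide_eq mult.commute)
  qed
qed simp

lemma gauge_minus: "p (- x) = p x"
proof (rule gauge_eqI[OF gauge_nonneg])
  fix t :: real assume t: "0 < t"
  have "- x /\<^sub>R t \<in> L \<longleftrightarrow> x /\<^sub>R t \<in> L" using symm unfolding origin_symmetric_def
    by (metis minus_minus scaleR_minus_right)
  then show "- x /\<^sub>R t \<in> L \<longleftrightarrow> p x \<le> t" using gauge_le_iff[OF t] by simp
qed

lemma gauge_bounds:
  obtains r R where "0 < r" "0 < R" "\<forall>x. norm x / R \<le> p x" "\<forall>x. p x \<le> norm x / r"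
proof -
  obtain r where r: "0 < r" "cball 0 r \<subseteq> L" by (rule inner_ball)
  obtain R where R: "0 < R" "\<And>x. x \<in> L \<Longrightarrow> norm x \<le> R" using outer_ball by blast
  have lo: "norm x / R \<le> p x" for x
  proof (rule field_le_epsilon)
    fix e :: real assume "0 < e"
    then have t: "0 < p x + e" using gauge_nonneg[of x] by simp
    then have "x /\<^sub>R (p x + e) \<in> L" using gauge_le_iff[of "p x + e" x] \<open>0 < e\<close> by simp
    then have "norm (x /\<^sub>R (p x + e)) \<le> R" by (rule R(2))
    then have "norm x / (p x + e) \<le> R" using t by (simp add: divide_inverse mult.commute)
    then show "norm x / R \<le> p x + e" using t R(1) by (simp add: field_simps)
  qed
  have hi: "p x \<le> norm x / r" for x
  proof (cases "x = 0")
    case False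
    then have t: "0 < norm x / r" using r by simp
    have "norm (x /\<^sub>R (norm x / r)) = r" using False r by simp
    then have "x /\<^sub>R (norm x / r) \<in> L" using r by (auto simp: subset_eq mem_cball_0 simp del: mem_cball)
    then show ?thesis using gauge_le_iff[OF t] by simp
  qed simp
  show thesis by (rule that[OF r(1) R(1)]) (use lo hi in auto)
qed

lemma gauge_pos: "x \<noteq> 0 \<Longrightarrow> 0 < p x"
proof -
  assume "x \<noteq> 0"
  obtain r R where R: "0 < r" "0 < R" "\<forall>x. norm x / R \<le> p x" "\<forall>x. p x \<le> norm x / r" by (rule gauge_bounds)
  have "0 < norm x / R" using R(2) \<open>x \<noteq> 0\<close> by simp
  with R(3) show ?thesis by (meson less_le_trans)
qed

lemma gauge_triangle: "p (x + y) \<le> p x + p y"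
proof (cases "x = 0 \<or> y = 0")
  case False
  then have pos: "0 < p x" "0 < p y" using gauge_pos by auto
  have m: "x /\<^sub>R p x \<in> L" "y /\<^sub>R p y \<in> L" using gauge_le_iff pos by auto
  have "(x + y) /\<^sub>R (p x + p y) = (p x / (p x + p y)) *\<^sub>R (x /\<^sub>R p x) + (p y / (p x + p y)) *\<^sub>R (y /\<^sub>R p y)"
    using pos by (simp add: scaleR_add_right inverse_eq_divide)
  also have "\<dots> \<in> L"
    using pos by (intro convexD[OF body_basic(2) m]) (auto simp flip: add_divide_distrib)
  finally show ?thesis using pos gauge_le_iff[of "p x + p y" "x + y"] by simp
qed auto

lemma gauge_continuous: "continuous_on UNIV p"
proof -
  obtain r R where r: "0 < r" "0 < R" "\<forall>x. norm x / R \<le> p x" "\<forall>x. p x \<le> norm x / r" by (rule gauge_bounds)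
  have "\<bar>p x - p y\<bar> \<le> norm (x - y) / r" for x y
  proof -
    have "p x \<le> p y + p (x - y)" using gauge_triangle[of y "x - y"] by simp
    moreover have "p y \<le> p x + p (x - y)" using gauge_triangle[of x "y - x"] gauge_minus[of "x - y"] by simp
    ultimately show ?thesis using spec[OF r(4), of "x - y"] by linarith
  qed
  then have "(1 / r)-lipschitz_on UNIV p"
    using r(1) by (intro lipschitz_onI) (auto simp: dist_real_def dist_norm)
  then show ?thesis by (rule lipschitz_on_continuous_on)
qed

lemma mem_iff_gauge: "x \<in> L \<longleftrightarrow> p x \<le> 1"
  using gauge_le_iff[of 1 x] by simp

lemma frontier_gauge: "frontier L = {x. p x = 1}"
proof -
  have "open {x. p x < 1}"
    using gauge_continuous by (intro open_Collect_less continuous_intros) auto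
  then have "{x. p x < 1} \<subseteq> interior L" by (rule interior_maximal[rotated]) (auto simp: mem_iff_gauge)
  moreover have "p x < 1" if x: "x \<in> interior L" for x
  proof (rule ccontr)
    assume "\<not> p x < 1"
    moreover have "x \<in> L" using x interior_subset by blast
    then have "p x \<le> 1" by (simp add: mem_iff_gauge)
    ultimately have p1: "p x = 1" by simp
    then have x0: "x \<noteq> 0" by auto
    obtain e where e: "0 < e" "cball x e \<subseteq> L" using x mem_interior_cball by blast
    have "(1 + e / norm x) *\<^sub>R x = x + (e / norm x) *\<^sub>R x" by (simp add: algebra_simps)
    then have "dist x ((1 + e / norm x) *\<^sub>R x) = e" using e x0 by (simp add: dist_norm)
    then have "(1 + e / norm x) *\<^sub>R x \<in> L" using e by (auto simp: subset_eq)
    then have "p ((1 + e / norm x) *\<^sub>R x) \<le> 1" by (simp only: mem_iff_gauge)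
    moreover have "0 \<le> 1 + e / norm x" using e by simp
    ultimately have "(1 + e / norm x) * p x \<le> 1" by (simp only: gauge_scale)
    moreover have "0 < e / norm x" using e x0 by simp
    ultimately show False using p1 by simp
  qed
  ultimately have "interior L = {x. p x < 1}" by blast
  then have "frontier L = L - {x. p x < 1}"
    unfolding frontier_def closure_closed[OF body_basic(3)] by (rule arg_cong)
  also have "\<dots> = {x. p x = 1}"
  proof (rule set_eqI)
    fix x
    show "x \<in> L - {x. p x < 1} \<longleftrightarrow> x \<in> {x. p x = 1}"
      unfolding Diff_iff mem_Collect_eq mem_iff_gauge by linarith
  qed
  finally show ?thesis .
qed

lemma normalized_frontier: "x \<noteq> 0 \<Longrightarrow> x /\<^sub>R p x \<in> frontier L"
proof -
  assume "x \<noteq> 0"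
  then have px: "0 < p x" by (rule gauge_pos)
  then have "p (x /\<^sub>R p x) = inverse (p x) * p x" by (intro gauge_scale) simp
  also have "\<dots> = 1" using px by simp
  finally show ?thesis unfolding frontier_gauge by (rule CollectI)
qed

end

text \<open>\<open>\<kappa>\<close> plays the gradient of \<open>k\<close>. The bounds hold for all
  pairs of points of \<open>S\<close>, not only for pairs joined by a segment in \<open>S\<close>,
  as needed for a boundary. One constant controls values, gradients, increments and remainders at
  once, which makes the induction close under products: the product remainder splits into three
  terms, each at most \<open>C * C'\<close> times the squared distance.\<close>

lemma real_polynomial_function_second_order:
  fixes k :: "'a::euclidean_space \<Rightarrow> real"
  assumes "real_polynomial_function k" "bounded S"
  shows "\<exists>\<kappa> C. 0 \<le> C \<and> (\<forall>x\<in>S. \<bar>k x\<bar> \<le> C \<and> norm (\<kappa> x) \<le> C) \<and>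
     (\<forall>x\<in>S. \<forall>y\<in>S. \<bar>k y - k x\<bar> \<le> C * norm (y - x) \<and> \<bar>k y - k x - \<kappa> x \<bullet> (y - x)\<bar> \<le> C * (norm (y - x))\<^sup>2)"
  using assms(1)
proof (induction rule: real_polynomial_function.induct)
  case (linear f)
  define v where "v = adjoint f 1"
  have f: "f x = v \<bullet> x" for x
    using adjoint_works[OF bounded_linear.linear[OF linear], of x 1] by (simp add: v_def inner_commute)
  obtain B where B: "0 < B" "\<And>x. x \<in> S \<Longrightarrow> norm x \<le> B" using assms(2) by (auto simp: bounded_pos)
  have a: "\<bar>v \<bullet> x\<bar> \<le> norm v * (B + 1)" if "x \<in> S" for x
    using B(2)[OF that] Cauchy_Schwarz_ineq2[of v x] by (smt (verit) mult_left_mono norm_ge_zero)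
  have b: "norm v \<le> norm v * (B + 1)" using B(1) by (simp add: distrib_left)
  have c: "\<bar>v \<bullet> z\<bar> \<le> norm v * (B + 1) * norm z" for z
    using Cauchy_Schwarz_ineq2[of v z] mult_right_mono[OF b norm_ge_zero[of z]] by linarith
  show ?case
    by (intro exI[of _ "\<lambda>_. v"] exI[of _ "norm v * (B + 1)"])
       (use a b c B(1) in \<open>auto simp: f simp flip: inner_diff_right\<close>)
next
  case (const c)
  show ?case by (intro exI[of _ "\<lambda>_. 0"] exI[of _ "\<bar>c\<bar>"]) auto
next
  case (add f g)
  then obtain \<kappa> C \<kappa>' C' where
    1: "0 \<le> C" "\<forall>x\<in>S. \<bar>f x\<bar> \<le> C \<and> norm (\<kappa> x) \<le> C"
     "\<forall>x\<in>S. \<forall>y\<in>S. \<bar>f y - f x\<bar> \<le> C * norm (y - x) \<and> \<bar>f y - f x - \<kappa> x \<bullet> (y - x)\<bar> \<le> C * (norm (y - x))\<^sup>2"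
    and 2: "0 \<le> C'" "\<forall>x\<in>S. \<bar>g x\<bar> \<le> C' \<and> norm (\<kappa>' x) \<le> C'"
     "\<forall>x\<in>S. \<forall>y\<in>S. \<bar>g y - g x\<bar> \<le> C' * norm (y - x) \<and> \<bar>g y - g x - \<kappa>' x \<bullet> (y - x)\<bar> \<le> C' * (norm (y - x))\<^sup>2"
    by (elim exE conjE) blast
  show ?case
  proof (intro exI[of _ "\<lambda>x. \<kappa> x + \<kappa>' x"] exI[of _ "C + C'"] conjI ballI)
    show "0 \<le> C + C'" using 1 2 by simp
    fix x assume x: "x \<in> S"
    show "\<bar>f x + g x\<bar> \<le> C + C'" using 1(2) 2(2) x by (smt (verit))
    show "norm (\<kappa> x + \<kappa>' x) \<le> C + C'" using 1(2) 2(2) x norm_triangle_ineq[of "\<kappa> x" "\<kappa>' x"] by (smt (verit))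
    fix y assume y: "y \<in> S"
    have "\<bar>f y - f x\<bar> \<le> C * norm (y - x)" "\<bar>g y - g x\<bar> \<le> C' * norm (y - x)"
      "\<bar>f y - f x - \<kappa> x \<bullet> (y - x)\<bar> \<le> C * (norm (y - x))\<^sup>2" "\<bar>g y - g x - \<kappa>' x \<bullet> (y - x)\<bar> \<le> C' * (norm (y - x))\<^sup>2"
      using 1(3) 2(3) x y by blast+
    then show "\<bar>f y + g y - (f x + g x)\<bar> \<le> (C + C') * norm (y - x)"
      "\<bar>f y + g y - (f x + g x) - (\<kappa> x + \<kappa>' x) \<bullet> (y - x)\<bar> \<le> (C + C') * (norm (y - x))\<^sup>2"
      unfolding distrib_right inner_add_left by linarith+
  qed
next
  case (mult f g)
  then obtain \<kappa> C \<kappa>' C' where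
    1: "0 \<le> C" "\<forall>x\<in>S. \<bar>f x\<bar> \<le> C \<and> norm (\<kappa> x) \<le> C"
     "\<forall>x\<in>S. \<forall>y\<in>S. \<bar>f y - f x\<bar> \<le> C * norm (y - x) \<and> \<bar>f y - f x - \<kappa> x \<bullet> (y - x)\<bar> \<le> C * (norm (y - x))\<^sup>2"
    and 2: "0 \<le> C'" "\<forall>x\<in>S. \<bar>g x\<bar> \<le> C' \<and> norm (\<kappa>' x) \<le> C'"
     "\<forall>x\<in>S. \<forall>y\<in>S. \<bar>g y - g x\<bar> \<le> C' * norm (y - x) \<and> \<bar>g y - g x - \<kappa>' x \<bullet> (y - x)\<bar> \<le> C' * (norm (y - x))\<^sup>2"
    by (elim exE conjE) blast
  have C0: "0 \<le> C * C'" using 1 2 by simp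
  show ?case
  proof (intro exI[of _ "\<lambda>x. f x *\<^sub>R \<kappa>' x + g x *\<^sub>R \<kappa> x"] exI[of _ "3 * (C * C')"] conjI ballI)
    show "0 \<le> 3 * (C * C')" using C0 by simp
    fix x assume x: "x \<in> S"
    have b: "\<bar>f x\<bar> \<le> C" "\<bar>g x\<bar> \<le> C'" "norm (\<kappa> x) \<le> C" "norm (\<kappa>' x) \<le> C'" using 1(2) 2(2) x by auto
    have "\<bar>f x * g x\<bar> \<le> C * C'" unfolding abs_mult using b 1(1) by (intro mult_mono) auto
    then show "\<bar>f x * g x\<bar> \<le> 3 * (C * C')" using C0 by linarith
    have "norm (f x *\<^sub>R \<kappa>' x) \<le> C * C'" "norm (g x *\<^sub>R \<kappa> x) \<le> C' * C"
      unfolding norm_scaleR using b 1(1) 2(1) by (auto intro!: mult_mono)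
    then show "norm (f x *\<^sub>R \<kappa>' x + g x *\<^sub>R \<kappa> x) \<le> 3 * (C * C')"
      using C0 norm_triangle_ineq[of "f x *\<^sub>R \<kappa>' x" "g x *\<^sub>R \<kappa> x"] by (simp add: mult.commute[of C'])
    fix y assume y: "y \<in> S"
    define d where "d = norm (y - x)"
    have d: "0 \<le> d" by (simp add: d_def)
    have B: "\<bar>f y - f x\<bar> \<le> C * d" "\<bar>g y - g x\<bar> \<le> C' * d"
      "\<bar>f y - f x - \<kappa> x \<bullet> (y - x)\<bar> \<le> C * d\<^sup>2" "\<bar>g y - g x - \<kappa>' x \<bullet> (y - x)\<bar> \<le> C' * d\<^sup>2"
      using 1(3) 2(3) x y unfolding d_def by blast+
    have by': "\<bar>g y\<bar> \<le> C'" using 2(2) y by auto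
    have "\<bar>f y * g y - f x * g x\<bar> = \<bar>(f y - f x) * g y + f x * (g y - g x)\<bar>" by (simp add: algebra_simps)
    also have "\<dots> \<le> \<bar>f y - f x\<bar> * \<bar>g y\<bar> + \<bar>f x\<bar> * \<bar>g y - g x\<bar>" by (metis abs_mult abs_triangle_ineq)
    also have "\<dots> \<le> (C * d) * C' + C * (C' * d)"
      by (rule add_mono[OF mult_mono[OF B(1) by' mult_nonneg_nonneg[OF 1(1) d] abs_ge_zero]
            mult_mono[OF b(1) B(2) 1(1) abs_ge_zero]])
    also have "\<dots> = 2 * (C * C') * d" by simp
    also have "\<dots> \<le> 3 * (C * C') * d" using C0 d by (intro mult_right_mono) auto
    finally show "\<bar>f y * g y - f x * g x\<bar> \<le> 3 * (C * C') * norm (y - x)" by (simp add: d_def)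
    have "f y * g y - f x * g x - (f x *\<^sub>R \<kappa>' x + g x *\<^sub>R \<kappa> x) \<bullet> (y - x) =
       f x * (g y - g x - \<kappa>' x \<bullet> (y - x)) + g x * (f y - f x - \<kappa> x \<bullet> (y - x)) + (f y - f x) * (g y - g x)"
      by (simp add: inner_add_left algebra_simps)
    also have "\<bar>\<dots>\<bar> \<le> \<bar>f x\<bar> * \<bar>g y - g x - \<kappa>' x \<bullet> (y - x)\<bar> + \<bar>g x\<bar> * \<bar>f y - f x - \<kappa> x \<bullet> (y - x)\<bar>
        + \<bar>f y - f x\<bar> * \<bar>g y - g x\<bar>"
      unfolding abs_mult[symmetric] by linarith
    also have "\<dots> \<le> C * (C' * d\<^sup>2) + C' * (C * d\<^sup>2) + (C * d) * (C' * d)"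
    proof -
      have "\<bar>f x\<bar> * \<bar>g y - g x - \<kappa>' x \<bullet> (y - x)\<bar> \<le> C * (C' * d\<^sup>2)"
        by (rule mult_mono[OF b(1) B(4) 1(1) abs_ge_zero])
      moreover have "\<bar>g x\<bar> * \<bar>f y - f x - \<kappa> x \<bullet> (y - x)\<bar> \<le> C' * (C * d\<^sup>2)"
        by (rule mult_mono[OF b(2) B(3) 2(1) abs_ge_zero])
      moreover have "\<bar>f y - f x\<bar> * \<bar>g y - g x\<bar> \<le> (C * d) * (C' * d)"
        by (rule mult_mono[OF B(1,2) mult_nonneg_nonneg[OF 1(1) d] abs_ge_zero])
      ultimately show ?thesis by linarith
    qed
    also have "\<dots> = 3 * (C * C') * d\<^sup>2" by (simp add: power2_eq_square)
    finally show "\<bar>f y * g y - f x * g x - (f x *\<^sub>R \<kappa>' x + g x *\<^sub>R \<kappa> x) \<bullet> (y - x)\<bar> \<le> 3 * (C * C') * (norm (y - x))\<^sup>2"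
      by (simp add: d_def)
  qed
qed

context symmetric_body
begin

text \<open>The gauge perturbed by \<open>k\<close> is a supremum of linear functionals: uniform convexity of \<open>L\<close> gives
  every supporting functional a quadratic gap, which absorbs the second-order error of \<open>k\<close>.\<close>

lemma perturbed_body:
  assumes c: "0 < c" and u1: "\<And>x. x \<in> frontier L \<Longrightarrow> u x \<bullet> x = 1"
    and uc: "\<And>x y. x \<in> frontier L \<Longrightarrow> y \<in> frontier L \<Longrightarrow> c * (norm (x - y))\<^sup>2 \<le> u x \<bullet> (x - y)"
    and k: "real_polynomial_function k" and ev: "\<And>x. k (- x) = k x"
  obtains e0 where "0 < e0" "\<And>e. 0 < e \<Longrightarrow> e \<le> e0 \<Longrightarrow>
    \<exists>D. convex_body D \<and> origin_symmetric D \<and>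
      (\<forall>x\<in>frontier L. 1/2 \<le> 1 + e * k x \<and> (\<forall>t>0. t *\<^sub>R x \<in> D \<longleftrightarrow> t * (1 + e * k x) \<le> 1))"
proof -
  let ?S = "frontier L"
  have SL: "?S \<subseteq> L" using frontier_subset_closed[OF body_basic(3)] .
  then have bS: "bounded ?S" using body_basic(4) bounded_subset by blast
  obtain \<kappa> C where C': "0 \<le> C \<and> (\<forall>x\<in>?S. \<bar>k x\<bar> \<le> C \<and> norm (\<kappa> x) \<le> C) \<and>
     (\<forall>x\<in>?S. \<forall>y\<in>?S. \<bar>k y - k x\<bar> \<le> C * norm (y - x) \<and> \<bar>k y - k x - \<kappa> x \<bullet> (y - x)\<bar> \<le> C * (norm (y - x))\<^sup>2)"
    using real_polynomial_function_second_order[OF k bS] by (elim exE)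
  have C: "0 \<le> C" "\<And>x. x \<in> ?S \<Longrightarrow> \<bar>k x\<bar> \<le> C" "\<And>x. x \<in> ?S \<Longrightarrow> norm (\<kappa> x) \<le> C"
    "\<And>x y. x \<in> ?S \<Longrightarrow> y \<in> ?S \<Longrightarrow> \<bar>k y - k x - \<kappa> x \<bullet> (y - x)\<bar> \<le> C * (norm (y - x))\<^sup>2"
    using C' by blast+
  obtain r R where rR: "0 < r" "0 < R" "\<forall>x. norm x / R \<le> p x" "\<forall>x. p x \<le> norm x / r" by (rule gauge_bounds)
  then have r: "0 < r" "\<And>x. p x \<le> norm x / r" and R: "0 < R" "\<And>x. norm x / R \<le> p x" by auto
  have nR: "norm x \<le> R" if "x \<in> ?S" for x
    using R(2)[of x] that R(1) by (simp add: frontier_gauge pos_divide_le_eq)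
  \<comment> \<open>\<open>M\<close> bounds \<open>k x - \<kappa> x \<bullet> x\<close> on the
    boundary. The choice of \<open>e0\<close> keeps \<open>1 + e * k x\<close> above
    \<open>1/2\<close> and lets a gap of size \<open>\<tau>\<close> absorb the errors
    \<open>e * (C / c) * \<tau>\<close> and \<open>e * M * \<tau>\<close>.\<close>
  define M where "M = C + C * R"
  define e0 where "e0 = 1 / (2 * C + C / c + M + 1)"
  have den: "0 < 2 * C + C / c + M + 1" using C(1) c R(1) by (simp add: M_def add_nonneg_pos)
  have e0: "0 < e0" using den by (simp add: e0_def)
  have eb: "e * C \<le> 1/2" "e * (C / c + M) \<le> 1" if e: "0 < e" "e \<le> e0" for e
  proof -
    have "e * (2 * C + C / c + M + 1) \<le> e0 * (2 * C + C / c + M + 1)" using e den by (intro mult_right_mono) auto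
    then have le: "e * (2 * C + C / c + M + 1) \<le> 1" using den by (simp add: e0_def)
    have "0 \<le> e * C" "0 \<le> e * (C / c)" "0 \<le> e * M" using e C(1) c R(1) by (auto simp: M_def)
    moreover have "e * (2 * C + C / c + M + 1) = 2 * (e * C) + e * (C / c) + e * M + e" by (simp add: algebra_simps)
    ultimately show "e * C \<le> 1/2" "e * (C / c + M) \<le> 1" using le e unfolding distrib_left by linarith+
  qed
  have "\<exists>D. convex_body D \<and> origin_symmetric D \<and>
      (\<forall>x\<in>?S. 1/2 \<le> 1 + e * k x \<and> (\<forall>t>0. t *\<^sub>R x \<in> D \<longleftrightarrow> t * (1 + e * k x) \<le> 1))" if e: "0 < e" "e \<le> e0" for e
  proof -
    \<comment> \<open>The formal differential at \<open>x\<close> of the perturbed gauge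
      \<open>p w * (1 + e * k (w / p w))\<close>, with \<open>u x\<close> and
      \<open>\<kappa> x\<close> in the roles of the differentials of \<open>p\<close> and
      \<open>k\<close>.\<close>
    define v where "v x = (1 + e * (k x - \<kappa> x \<bullet> x)) *\<^sub>R u x + e *\<^sub>R \<kappa> x" for x
    have half: "1/2 \<le> 1 + e * k x" "1 + e * k x \<le> 3/2" if "x \<in> ?S" for x
    proof -
      have "\<bar>e * k x\<bar> \<le> e * C" using C(2)[OF that] e by (simp add: abs_mult)
      then show "1/2 \<le> 1 + e * k x" "1 + e * k x \<le> 3/2" using eb(1)[OF e] by linarith+
    qed
    have vx: "v x \<bullet> x = 1 + e * k x" if "x \<in> ?S" for x
      using u1[OF that] by (simp add: v_def inner_add_left algebra_simps)
    have vy: "v x \<bullet> y \<le> 1 + e * k y" if x: "x \<in> ?S" and y: "y \<in> ?S" for x y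
    proof -
      define \<tau> where "\<tau> = u x \<bullet> (x - y)"
      define d2 where "d2 = (norm (x - y))\<^sup>2"
      have \<tau>: "c * d2 \<le> \<tau>" "0 \<le> d2" using uc[OF x y] by (auto simp: \<tau>_def d2_def)
      then have \<tau>0: "0 \<le> \<tau>" using c by (smt (verit) mult_nonneg_nonneg)
      have q: "\<bar>k y - k x - \<kappa> x \<bullet> (y - x)\<bar> \<le> C * d2"
        using C(4)[OF x y] by (simp add: d2_def norm_minus_commute)
      have "d2 \<le> \<tau> / c" using \<tau>(1) c by (simp add: pos_le_divide_eq mult.commute)
      then have Cd: "C * d2 \<le> C / c * \<tau>" using mult_left_mono[OF _ C(1), of d2 "\<tau> / c"] by simp
      have "\<bar>\<kappa> x \<bullet> x\<bar> \<le> C * R"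
        using Cauchy_Schwarz_ineq2[of "\<kappa> x" x] mult_mono[OF C(3)[OF x] nR[OF x] C(1) norm_ge_zero] by linarith
      then have "\<bar>k x - \<kappa> x \<bullet> x\<bar> \<le> M" using C(2)[OF x] by (simp add: M_def)
      then have Mt: "- (M * \<tau>) \<le> (k x - \<kappa> x \<bullet> x) * \<tau>"
        using mult_right_mono[of "- M" "k x - \<kappa> x \<bullet> x" \<tau>] \<tau>0 by (simp add: abs_le_iff)
      \<comment> \<open>The remainder of \<open>k\<close> is at most \<open>C * d2\<close>, and
        uniform convexity bounds this by \<open>(C / c) * \<tau>\<close>; so both error terms are
        controlled by multiples of the gap \<open>\<tau>\<close>.\<close>
      have "(1 + e * k y) - v x \<bullet> y = e * (k y - k x - \<kappa> x \<bullet> (y - x)) + \<tau> + e * ((k x - \<kappa> x \<bullet> x) * \<tau>)"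
        using u1[OF x] by (simp add: v_def \<tau>_def inner_add_left inner_diff_right algebra_simps)
      moreover have "- (e * (C / c * \<tau>)) \<le> e * (k y - k x - \<kappa> x \<bullet> (y - x))"
      proof -
        have "- (C / c * \<tau>) \<le> k y - k x - \<kappa> x \<bullet> (y - x)" using q Cd by linarith
        from mult_left_mono[OF this, of e] e show ?thesis by simp
      qed
      moreover have "- (e * (M * \<tau>)) \<le> e * ((k x - \<kappa> x \<bullet> x) * \<tau>)"
        using mult_left_mono[OF Mt, of e] e by simp
      moreover have "e * (C / c * \<tau>) + e * (M * \<tau>) \<le> \<tau>"
        using mult_right_mono[OF eb(2)[OF e] \<tau>0] by (simp add: algebra_simps)
      ultimately show ?thesis by linarith
    qed
    \<comment> \<open>An intersection of closed half-spaces is closed and convex at once;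
      \<open>vx\<close> and \<open>vy\<close> then show that it reaches exactly to
      \<open>1 / (1 + e * k x)\<close> along \<open>x\<close>.\<close>
    define D where "D = (\<Inter>x\<in>?S. {w. v x \<bullet> w \<le> 1})"
    have D_iff: "t *\<^sub>R x \<in> D \<longleftrightarrow> t * (1 + e * k x) \<le> 1" if x: "x \<in> ?S" and t: "0 < t" for x t
    proof
      assume "t *\<^sub>R x \<in> D"
      then have "v x \<bullet> (t *\<^sub>R x) \<le> 1" using x by (auto simp: D_def)
      then show "t * (1 + e * k x) \<le> 1" using vx[OF x] by simp
    next
      assume le: "t * (1 + e * k x) \<le> 1"
      have "v z \<bullet> (t *\<^sub>R x) \<le> 1" if z: "z \<in> ?S" for z
      proof -
        have "t * (v z \<bullet> x) \<le> t * (1 + e * k x)" using vy[OF z x] t by (intro mult_left_mono) auto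
        then show ?thesis using le by simp
      qed
      then show "t *\<^sub>R x \<in> D" by (auto simp: D_def)
    qed
    have D_iff': "w \<in> D \<longleftrightarrow> p w * (1 + e * k (w /\<^sub>R p w)) \<le> 1" if "w \<noteq> 0" for w
      using D_iff[OF normalized_frontier[OF that] gauge_pos[OF that]] gauge_pos[OF that] by simp
    have D0: "0 \<in> D" by (simp add: D_def)
    have "convex D" unfolding D_def by (intro convex_INT ballI convex_halfspace_le)
    moreover have "closed D" unfolding D_def by (intro closed_INT ballI closed_halfspace_le)
    moreover have "bounded D"
    proof (rule boundedI)
      fix w assume w: "w \<in> D"
      show "norm w \<le> 2 * R"
      proof (cases "w = 0")
        case False
        have "p w * (1/2) \<le> p w * (1 + e * k (w /\<^sub>R p w))"
          by (rule mult_left_mono[OF half(1)[OF normalized_frontier[OF False]] gauge_nonneg])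
        then have "p w \<le> 2" using w D_iff'[OF False] by linarith
        with R(2)[of w] have "norm w / R \<le> 2" by linarith
        then show ?thesis using R(1) by (simp add: pos_divide_le_eq)
      qed (use R in simp)
    qed
    moreover have "cball 0 (2 * r / 3) \<subseteq> D"
    proof
      fix w :: "real^'n" assume "w \<in> cball 0 (2 * r / 3)"
      then have nw: "norm w \<le> 2 * r / 3" by (simp add: mem_cball_0)
      show "w \<in> D"
      proof (cases "w = 0")
        case False
        have "norm w / r \<le> 2/3" using nw r(1) by (simp add: pos_divide_le_eq)
        then have "p w \<le> 2/3" using r(2)[of w] by linarith
        then have "p w * (1 + e * k (w /\<^sub>R p w)) \<le> 2/3 * (3/2)"
          using half[OF normalized_frontier[OF False]] gauge_nonneg[of w] by (intro mult_mono) auto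
        then show ?thesis using D_iff'[OF False] by simp
      qed (use D0 in simp)
    qed
    then have "0 \<in> interior D"
      unfolding mem_interior_cball using r(1) by (intro exI[of _ "2 * r / 3"]) auto
    ultimately have "convex_body D" by (auto simp: convex_body_def compact_eq_bounded_closed)
    moreover have "origin_symmetric D"
      unfolding origin_symmetric_def
    proof
      fix w assume w: "w \<in> D"
      show "- w \<in> D"
      proof (cases "w = 0")
        case False
        then have "k ((- w) /\<^sub>R p (- w)) = k (w /\<^sub>R p w)" using ev[of "w /\<^sub>R p w"] by (simp add: gauge_minus)
        then show ?thesis using w D_iff'[OF False] D_iff'[of "- w"] False by (simp add: gauge_minus)
      qed (use w in simp)
    qed
    ultimately show ?thesis
      using half(1) D_iff by (intro exI[of _ D] conjI ballI allI impI) auto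
  qed
  then show thesis by (rule that[OF e0])
qed

end

section \<open>Homogeneous measures and radial integrals\<close>

text \<open>Common to Lebesgue measure on the whole space and on a hyperplane, so that both
  comparisons run through the same polar decomposition. Finiteness on the unit ball spreads to
  bounded sets by scaling and yields sigma-finiteness.\<close>

definition homogeneous_measure :: "'a::euclidean_space measure \<Rightarrow> nat \<Rightarrow> bool" where
  "homogeneous_measure M m \<longleftrightarrow> sets M = sets borel \<and> 1 \<le> m \<and> emeasure M (cball 0 1) < \<infinity> \<and>
     (\<forall>F r. F \<in> borel_measurable borel \<longrightarrow> 0 < r \<longrightarrow>
        (\<integral>\<^sup>+x. F x \<partial>M) = ennreal (r ^ m) * (\<integral>\<^sup>+x. F (r *\<^sub>R x) \<partial>M))"

text \<open>The inner integral of polar coordinates, along the open ray through \<open>x\<close>.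
  The point \<open>x\<close> is not normalized, so the value depends on its position on the
  ray.\<close>

definition radial :: "nat \<Rightarrow> ('a::real_vector \<Rightarrow> ennreal) \<Rightarrow> 'a \<Rightarrow> ennreal" where
  "radial m F x = (\<integral>\<^sup>+r. ennreal (r ^ (m - 1)) * F (r *\<^sub>R x) * indicator {0<..} r \<partial>lborel)"

lemma homogeneous_measure_scale:
  assumes "homogeneous_measure M m" "F \<in> borel_measurable borel" "0 < r"
  shows "(\<integral>\<^sup>+x. F x \<partial>M) = ennreal (r ^ m) * (\<integral>\<^sup>+x. F (r *\<^sub>R x) \<partial>M)"
  using assms unfolding homogeneous_measure_def by blast

lemma homogeneous_measureD:
  assumes "homogeneous_measure M m"
  shows "sets M = sets borel" "1 \<le> m" "emeasure M (cball 0 1) < \<infinity>"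
  using assms unfolding homogeneous_measure_def by blast+

lemma homogeneous_measure_cball:
  fixes M :: "'a::euclidean_space measure"
  assumes M: "homogeneous_measure M m" and "0 < r"
  shows "emeasure M (cball 0 r) = ennreal (r ^ m) * emeasure M (cball 0 1)"
proof -
  have s: "sets M = sets borel" by (rule homogeneous_measureD(1)[OF M])
  have "emeasure M (cball 0 r) = (\<integral>\<^sup>+x. indicator (cball 0 r) x \<partial>M)"
    using s by (intro nn_integral_indicator[symmetric]) auto
  also have "\<dots> = ennreal (r ^ m) * (\<integral>\<^sup>+x. indicator (cball 0 r) (r *\<^sub>R x) \<partial>M)"
    by (rule homogeneous_measure_scale[OF M _ \<open>0 < r\<close>]) (intro borel_measurable_indicator borel_closed closed_cball)
  also have "(\<lambda>x::'a. indicator (cball 0 r) (r *\<^sub>R x) :: ennreal) = indicator (cball 0 1)"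
    using \<open>0 < r\<close> by (auto simp: indicator_def fun_eq_iff mem_cball_0 simp del: mem_cball)
  also have "(\<integral>\<^sup>+x. indicator (cball 0 1) x \<partial>M) = emeasure M (cball 0 1)"
    using s by (intro nn_integral_indicator) auto
  finally show ?thesis .
qed

lemma homogeneous_measure_bounded_finite:
  assumes M: "homogeneous_measure M m" and "bounded A"
  shows "emeasure M A < \<infinity>"
proof -
  obtain r where r: "0 < r" "\<And>x. x \<in> A \<Longrightarrow> norm x \<le> r" using \<open>bounded A\<close> by (auto simp: bounded_pos)
  have "emeasure M A \<le> emeasure M (cball 0 r)"
    using homogeneous_measureD(1)[OF M] r by (intro emeasure_mono) auto
  also have "\<dots> < \<infinity>"
    using homogeneous_measureD(3)[OF M] unfolding homogeneous_measure_cball[OF M r(1)]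
    by (auto simp: ennreal_mult_less_top)
  finally show ?thesis .
qed

lemma homogeneous_measure_sigma_finite:
  fixes M :: "'a::euclidean_space measure"
  assumes M: "homogeneous_measure M m"
  shows "sigma_finite_measure M"
proof
  have s: "sets M = sets borel" by (rule homogeneous_measureD(1)[OF M])
  let ?A = "range (\<lambda>k. cball (0::'a) (real k))"
  have "\<Union>?A = space M"
  proof -
    have "x \<in> \<Union>?A" for x :: 'a
      using real_arch_simple[of "norm x"] by auto
    then show ?thesis using sets_eq_imp_space_eq[OF s] by auto
  qed
  moreover have "\<forall>a\<in>?A. emeasure M a \<noteq> \<infinity>"
    using homogeneous_measure_bounded_finite[OF M] by (auto simp: less_top)
  ultimately show "\<exists>A. countable A \<and> A \<subseteq> sets M \<and> \<Union>A = space M \<and> (\<forall>a\<in>A. emeasure M a \<noteq> \<infinity>)"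
    using s by (intro exI[of _ ?A]) auto
qed

text \<open>The origin is fixed by scaling, so its finite mass equals \<open>2 ^ m\<close> times
  itself.\<close>

lemma homogeneous_measure_origin:
  fixes M :: "'a::euclidean_space measure"
  assumes M: "homogeneous_measure M m"
  shows "emeasure M {0} = 0"
proof -
  have s: "sets M = sets borel" and m: "1 \<le> m" using homogeneous_measureD[OF M] by auto
  have i: "(\<integral>\<^sup>+x. indicator {0} x \<partial>M) = emeasure M {0}"
    using s by (intro nn_integral_indicator) auto
  have "emeasure M {0} = ennreal (2 ^ m) * (\<integral>\<^sup>+x. indicator {0} (2 *\<^sub>R x) \<partial>M)"
    unfolding i[symmetric]
    by (rule homogeneous_measure_scale[OF M]) (auto intro!: borel_measurable_indicator borel_closed)
  also have "(\<lambda>x::'a. indicator {0} (2 *\<^sub>R x) :: ennreal) = indicator {0}"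
    by (auto simp: indicator_def fun_eq_iff)
  finally have e: "emeasure M {0} = ennreal (2 ^ m) * emeasure M {0}" unfolding i .
  have "emeasure M {0} < \<infinity>" by (rule homogeneous_measure_bounded_finite[OF M]) auto
  then obtain a where a: "emeasure M {0} = ennreal a" "0 \<le> a" by (cases "emeasure M {0}") auto
  have "ennreal a = ennreal (2 ^ m * a)" using e unfolding a(1) using a(2) by (simp add: ennreal_mult)
  then have "a = 2 ^ m * a" using a(2) by (subst (asm) ennreal_inj) auto
  moreover have "(1::real) < 2 ^ m" using m by (intro one_less_power) auto
  ultimately have "a = 0" by (simp add: mult_eq_self_implies_10)
  then show ?thesis using a by simp
qed

section \<open>Polar decomposition of homogeneous measures\<close>

lemma radial_measurable [measurable]:
  fixes F :: "'a::euclidean_space \<Rightarrow> ennreal"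
  assumes [measurable]: "F \<in> borel_measurable borel"
  shows "radial m F \<in> borel_measurable borel"
  unfolding radial_def by measurable

lemma nn_integral_lborel_scale:
  fixes f :: "real \<Rightarrow> ennreal"
  assumes [measurable]: "f \<in> borel_measurable borel" and "0 < s"
  shows "(\<integral>\<^sup>+r. f r \<partial>lborel) = ennreal s * (\<integral>\<^sup>+r. f (s * r) \<partial>lborel)"
  using nn_integral_real_affine[of f s 0] assms by simp

text \<open>The substitution \<open>r \<mapsto> s * r\<close>. Since the scaling factor is the same
  for every \<open>F\<close>, two radial integrals along a ray may be compared at any one of its
  points.\<close>

lemma radial_scale:
  fixes F :: "'a::euclidean_space \<Rightarrow> ennreal"
  assumes F[measurable]: "F \<in> borel_measurable borel" and s: "0 < s" and m: "1 \<le> m"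
  shows "radial m F x = ennreal (s ^ m) * radial m F (s *\<^sub>R x)"
proof -
  have "radial m F x = ennreal s *
      (\<integral>\<^sup>+r. ennreal ((s * r) ^ (m - 1)) * F ((s * r) *\<^sub>R x) * indicator {0<..} (s * r) \<partial>lborel)"
    unfolding radial_def using s by (subst nn_integral_lborel_scale[where s=s]) auto
  also have "(\<lambda>r. ennreal ((s * r) ^ (m - 1)) * F ((s * r) *\<^sub>R x) * indicator {0<..} (s * r))
     = (\<lambda>r. ennreal (s ^ (m - 1)) * (ennreal (r ^ (m - 1)) * F (r *\<^sub>R (s *\<^sub>R x)) * indicator {0<..} r))"
    using s by (auto simp: fun_eq_iff indicator_def zero_less_mult_iff power_mult_distrib ennreal_mult
        mult.assoc mult.left_commute mult.commute[of s])
  also have "(\<integral>\<^sup>+r. ennreal (s ^ (m - 1)) * (ennreal (r ^ (m - 1)) * F (r *\<^sub>R (s *\<^sub>R x)) * indicator {0<..} r) \<partial>lborel)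
     = ennreal (s ^ (m - 1)) * radial m F (s *\<^sub>R x)"
    unfolding radial_def by (subst nn_integral_cmult) auto
  also have "ennreal s * (ennreal (s ^ (m - 1)) * radial m F (s *\<^sub>R x)) = ennreal (s * s ^ (m - 1)) * radial m F (s *\<^sub>R x)"
    using s by (simp add: ennreal_mult mult.assoc)
  also have "s * s ^ (m - 1) = s ^ m" using m by (metis One_nat_def Suc_pred' power_Suc less_eq_Suc_le)
  finally show ?thesis .
qed

text \<open>The weight \<open>1 / r\<close> is invariant under scaling, so the mass does not depend
  on \<open>a\<close>.\<close>

lemma nn_integral_log_annulus:
  assumes "0 < (a::real)"
  shows "(\<integral>\<^sup>+r. ennreal (1 / r) * indicator {a/2..a} r \<partial>lborel) = ennreal (ln 2)"
proof -
  have "(\<integral>\<^sup>+r. ennreal (1 / r) * indicator {a/2..a} r \<partial>lborel) = ennreal (ln a - ln (a / 2))"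
    using assms by (intro nn_integral_FTC_Icc) (auto intro!: derivative_eq_intros)
  also have "ln a - ln (a / 2) = ln 2" using assms by (simp add: ln_div)
  finally show ?thesis .
qed

text \<open>Polar coordinates without a measure on the sphere: \<open>F x\<close> is averaged over the scales \<open>r\<close> with
  \<open>|x| / r\<close> in \<open>[1, 2]\<close>, and then \<open>x\<close> is rescaled by \<open>r\<close>.\<close>

lemma nn_integral_radial:
  fixes F :: "'a::euclidean_space \<Rightarrow> ennreal"
  assumes M: "homogeneous_measure M m" and F[measurable]: "F \<in> borel_measurable borel"
  shows "ennreal (ln 2) * (\<integral>\<^sup>+x. F x \<partial>M) = (\<integral>\<^sup>+x. indicator {x. 1 \<le> norm x \<and> norm x \<le> 2} x * radial m F x \<partial>M)"
proof -
  have s[measurable_cong]: "sets M = sets borel" and m: "1 \<le> m" using homogeneous_measureD[OF M] by auto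
  interpret M: sigma_finite_measure M by (rule homogeneous_measure_sigma_finite[OF M])
  interpret P: pair_sigma_finite lborel M ..
  let ?A = "{x::'a. 1 \<le> norm x \<and> norm x \<le> 2}"
  have Am[measurable]: "?A \<in> sets borel" by measurable
  let ?k = "\<lambda>(r::real) x. ennreal (1 / r) * indicator {0<..} r * (F x * indicator ?A ((1 / r) *\<^sub>R x))"
  \<comment> \<open>The average over scales vanishes at \<open>x = 0\<close>, so the origin has to
    be a null set.\<close>
  have "AE x in M. x \<noteq> 0"
    by (rule AE_I[OF _ homogeneous_measure_origin[OF M]]) (use s in auto)
  then have "ennreal (ln 2) * (\<integral>\<^sup>+x. F x \<partial>M) = (\<integral>\<^sup>+x. \<integral>\<^sup>+r. ?k r x \<partial>lborel \<partial>M)"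
  proof (subst nn_integral_cmult[symmetric])
    show "(\<integral>\<^sup>+x. ennreal (ln 2) * F x \<partial>M) = (\<integral>\<^sup>+x. \<integral>\<^sup>+r. ?k r x \<partial>lborel \<partial>M)"
    proof (rule nn_integral_cong_AE, rule AE_mp[OF \<open>AE x in M. x \<noteq> 0\<close>], rule AE_I2, intro impI)
      fix x :: 'a assume "x \<noteq> 0"
      then have n: "0 < norm x" by simp
      have "?k r x = F x * (ennreal (1 / r) * indicator {norm x / 2..norm x} r)" for r
      proof (cases "0 < r")
        case True
        then have "(1 / r) *\<^sub>R x \<in> ?A \<longleftrightarrow> r \<in> {norm x / 2..norm x}"
          by (auto simp: field_simps)
        with True show ?thesis by (simp add: indicator_def mult_ac)
      next
        case False
        then have "r \<notin> {norm x / 2..norm x}" using n unfolding atLeastAtMost_iff by linarith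
        with False show ?thesis by simp
      qed
      then have "(\<integral>\<^sup>+r. ?k r x \<partial>lborel) = F x * ennreal (ln 2)"
        using nn_integral_log_annulus[OF n] by (simp add: nn_integral_cmult)
      then show "ennreal (ln 2) * F x = (\<integral>\<^sup>+r. ?k r x \<partial>lborel)" by (simp add: mult.commute)
    qed
  qed simp
  also have "\<dots> = (\<integral>\<^sup>+r. \<integral>\<^sup>+x. ?k r x \<partial>M \<partial>lborel)"
    by (rule P.Fubini') measurable
  also have "\<dots> = (\<integral>\<^sup>+r. \<integral>\<^sup>+x. indicator ?A x * (ennreal (r ^ (m - 1)) * F (r *\<^sub>R x) * indicator {0<..} r) \<partial>M \<partial>lborel)"
  proof (rule nn_integral_cong)
    fix r :: real
    show "(\<integral>\<^sup>+x. ?k r x \<partial>M) = (\<integral>\<^sup>+x. indicator ?A x * (ennreal (r ^ (m - 1)) * F (r *\<^sub>R x) * indicator {0<..} r) \<partial>M)"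
    proof (cases "0 < r")
      case True
      have "(\<integral>\<^sup>+x. ?k r x \<partial>M) = ennreal (r ^ m) * (\<integral>\<^sup>+x. ?k r (r *\<^sub>R x) \<partial>M)"
        by (rule homogeneous_measure_scale[OF M _ True]) measurable
      also have "\<dots> = (\<integral>\<^sup>+x. ennreal (r ^ m) * ?k r (r *\<^sub>R x) \<partial>M)"
        by (rule nn_integral_cmult[symmetric]) measurable
      also have "\<dots> = (\<integral>\<^sup>+x. indicator ?A x * (ennreal (r ^ (m - 1)) * F (r *\<^sub>R x) * indicator {0<..} r) \<partial>M)"
      proof (rule nn_integral_cong)
        fix x
        \<comment> \<open>The Jacobian \<open>r ^ m\<close> and the weight \<open>1 / r\<close> of
          the average combine into the polar weight.\<close>
        have "r ^ m * (1 / r) = r ^ (m - 1)" using True m by (cases m) auto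
        then have "ennreal (r ^ m) * ennreal (1 / r) = ennreal (r ^ (m - 1))"
          using True by (simp flip: ennreal_mult)
        then show "ennreal (r ^ m) * ?k r (r *\<^sub>R x) = indicator ?A x * (ennreal (r ^ (m - 1)) * F (r *\<^sub>R x) * indicator {0<..} r)"
          using True by (simp add: mult.assoc[symmetric]) (simp add: mult_ac)
      qed
      finally show ?thesis .
    qed simp
  qed
  also have "\<dots> = (\<integral>\<^sup>+x. \<integral>\<^sup>+r. indicator ?A x * (ennreal (r ^ (m - 1)) * F (r *\<^sub>R x) * indicator {0<..} r) \<partial>lborel \<partial>M)"
    by (rule P.Fubini'[symmetric]) measurable
  also have "\<dots> = (\<integral>\<^sup>+x. indicator ?A x * radial m F x \<partial>M)"
    unfolding radial_def by (intro nn_integral_cong nn_integral_cmult) measurable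
  finally show ?thesis .
qed

text \<open>The reduction to rays: by homogeneity of \<open>radial\<close> one point per ray
  decides, and the constant \<open>ln 2\<close> of the polar decomposition cancels.\<close>

lemma nn_integral_radial_mono:
  fixes F G :: "'a::euclidean_space \<Rightarrow> ennreal"
  assumes M: "homogeneous_measure M m" and F: "F \<in> borel_measurable borel" and G: "G \<in> borel_measurable borel"
    and le: "\<And>x. x \<noteq> 0 \<Longrightarrow> \<exists>s>0. radial m F (s *\<^sub>R x) \<le> radial m G (s *\<^sub>R x)"
  shows "(\<integral>\<^sup>+x. F x \<partial>M) \<le> (\<integral>\<^sup>+x. G x \<partial>M)"
proof -
  have m: "1 \<le> m" using homogeneous_measureD[OF M] by auto
  have *: "radial m F x \<le> radial m G x" if x: "x \<noteq> 0" for x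
  proof -
    obtain s where s: "0 < s" "radial m F (s *\<^sub>R x) \<le> radial m G (s *\<^sub>R x)" using le[OF x] by blast
    show ?thesis
      unfolding radial_scale[OF F s(1) m, of x] radial_scale[OF G s(1) m, of x]
      using s(2) by (rule mult_left_mono) simp
  qed
  have "ennreal (ln 2) * (\<integral>\<^sup>+x. F x \<partial>M) \<le> ennreal (ln 2) * (\<integral>\<^sup>+x. G x \<partial>M)"
    unfolding nn_integral_radial[OF M F] nn_integral_radial[OF M G]
    by (intro nn_integral_mono) (auto simp: indicator_def intro!: *)
  then show ?thesis by (subst (asm) ennreal_mult_le_mult_iff) auto
qed

lemma homogeneous_measure_lborel: "homogeneous_measure (lborel :: 'a::euclidean_space measure) DIM('a)"
proof -
  have "(\<integral>\<^sup>+x. F x \<partial>lborel) = ennreal (r ^ DIM('a)) * (\<integral>\<^sup>+x. F (r *\<^sub>R x) \<partial>lborel)"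
    if [measurable]: "F \<in> borel_measurable borel" and r: "0 < r" for F :: "'a \<Rightarrow> ennreal" and r
  proof -
    have "(\<integral>\<^sup>+x. F x \<partial>lborel) = (\<integral>\<^sup>+x. F x \<partial>(density (distr lborel borel (\<lambda>x. 0 + r *\<^sub>R x)) (\<lambda>_. \<bar>r\<bar> ^ DIM('a))))"
      using r lborel_affine[of r "0::'a"] by simp
    also have "\<dots> = (\<integral>\<^sup>+x. ennreal (r ^ DIM('a)) * F x \<partial>(distr lborel borel (\<lambda>x. 0 + r *\<^sub>R x)))"
      using r by (subst nn_integral_density) (auto simp: ennreal_power)
    also have "\<dots> = ennreal (r ^ DIM('a)) * (\<integral>\<^sup>+x. F (r *\<^sub>R x) \<partial>lborel)"
      by (subst nn_integral_distr) (auto simp: nn_integral_cmult)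
    finally show ?thesis .
  qed
  moreover have "1 \<le> DIM('a)" using DIM_positive[where 'a='a] by linarith
  ultimately show ?thesis
    unfolding homogeneous_measure_def
    by (intro conjI allI impI sets_lborel emeasure_lborel_cball_finite)
qed

section \<open>Lebesgue measure on subspaces\<close>

interpretation lborel_product: product_sigma_finite "\<lambda>_. lborel :: real measure"
  by standard

lemma emeasure_lborel_scale:
  assumes A: "A \<in> sets borel" and r: "0 < (r::real)"
  shows "emeasure lborel A = ennreal r * emeasure lborel {t. r * t \<in> A}"
proof -
  have m: "{t. r * t \<in> A} \<in> sets borel"
    using measurable_sets[of "\<lambda>t. r * t" borel borel A] A by (simp add: vimage_def)
  have "emeasure lborel A = (\<integral>\<^sup>+t. indicator A t \<partial>lborel)" using A by simp
  also have "\<dots> = ennreal r * (\<integral>\<^sup>+t. indicator A (r * t) \<partial>lborel)"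
    using A by (intro nn_integral_lborel_scale[OF _ r]) auto
  also have "(\<lambda>t. indicator A (r * t) :: ennreal) = indicator {t. r * t \<in> A}"
    by (auto simp: indicator_def)
  finally show ?thesis using m by simp
qed

text \<open>Boxes determine the product measure, and on a box every factor scales by
  \<open>r\<close>.\<close>

lemma nn_integral_PiM_scale:
  assumes B: "finite B" and r: "0 < (r::real)"
    and G[measurable]: "G \<in> borel_measurable (\<Pi>\<^sub>M b\<in>B. (lborel :: real measure))"
  shows "(\<integral>\<^sup>+c. G c \<partial>(\<Pi>\<^sub>M b\<in>B. lborel)) = ennreal (r ^ card B) * (\<integral>\<^sup>+c. G (\<lambda>b\<in>B. r * c b) \<partial>(\<Pi>\<^sub>M b\<in>B. lborel))"
proof -
  let ?P = "\<Pi>\<^sub>M b\<in>B. (lborel :: real measure)"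
  define S where "S c = (\<lambda>b\<in>B. r * c b)" for c :: "'a \<Rightarrow> real"
  have S[measurable]: "S \<in> ?P \<rightarrow>\<^sub>M ?P" unfolding S_def by measurable
  have "density (distr ?P ?P S) (\<lambda>_. ennreal (r ^ card B)) = ?P"
  proof (rule lborel_product.PiM_eqI[OF B])
    show "sets (density (distr ?P ?P S) (\<lambda>_. ennreal (r ^ card B))) = sets ?P" by simp
    fix A :: "'a \<Rightarrow> real set" assume A: "\<And>i. i \<in> B \<Longrightarrow> A i \<in> sets lborel"
    have Am: "Pi\<^sub>E B A \<in> sets ?P" using A B by (intro sets_PiM_I_finite) auto
    have A': "{t. r * t \<in> A i} \<in> sets lborel" if "i \<in> B" for i
      using measurable_sets[of "\<lambda>t. r * t" borel borel "A i"] A[OF that] by (simp add: vimage_def)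
    have "S -` Pi\<^sub>E B A \<inter> space ?P = Pi\<^sub>E B (\<lambda>i. {t. r * t \<in> A i})"
      by (auto simp: S_def space_PiM PiE_iff extensional_def)
    then have "emeasure (density (distr ?P ?P S) (\<lambda>_. ennreal (r ^ card B))) (Pi\<^sub>E B A)
       = ennreal (r ^ card B) * emeasure ?P (Pi\<^sub>E B (\<lambda>i. {t. r * t \<in> A i}))"
      using Am by (simp add: emeasure_density nn_integral_cmult_indicator emeasure_distr)
    also have "\<dots> = (\<Prod>i\<in>B. ennreal r) * (\<Prod>i\<in>B. emeasure lborel {t. r * t \<in> A i})"
      using A' B r by (subst lborel_product.emeasure_PiM) (auto simp: ennreal_power)
    also have "\<dots> = (\<Prod>i\<in>B. ennreal r * emeasure lborel {t. r * t \<in> A i})" by (rule prod.distrib[symmetric])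
    also have "\<dots> = (\<Prod>i\<in>B. emeasure lborel (A i))"
      using A by (intro prod.cong refl emeasure_lborel_scale[OF _ r, symmetric]) auto
    finally show "emeasure (density (distr ?P ?P S) (\<lambda>_. ennreal (r ^ card B))) (Pi\<^sub>E B A)
      = (\<Prod>i\<in>B. emeasure lborel (A i))" .
  qed
  then have "(\<integral>\<^sup>+c. G c \<partial>?P) = (\<integral>\<^sup>+c. G c \<partial>(density (distr ?P ?P S) (\<lambda>_. ennreal (r ^ card B))))" by simp
  also have "\<dots> = ennreal (r ^ card B) * (\<integral>\<^sup>+c. G (S c) \<partial>?P)"
    by (simp add: nn_integral_density nn_integral_distr nn_integral_cmult)
  finally show ?thesis by (simp add: S_def)
qed

lemma lborel_subspace_basis:
  fixes V :: "'a::euclidean_space set"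
  assumes "subspace V"
  obtains B where "finite B" "card B = dim V" "orthonormal_basis_of V B"
    "lborel_subspace V = distr (\<Pi>\<^sub>M b\<in>B. (lborel :: real measure)) borel (\<lambda>c. \<Sum>b\<in>B. c b *\<^sub>R b)"
proof -
  define B where "B = (SOME B. orthonormal_basis_of V B)"
  have "\<exists>B. orthonormal_basis_of V B"
    using orthonormal_basis_subspace[OF assms] unfolding orthonormal_basis_of_def by metis
  then have B: "orthonormal_basis_of V B" unfolding B_def by (rule someI_ex)
  have "0 \<notin> B" using B by (auto simp: orthonormal_basis_of_def)
  then have ind: "independent B"
    using B pairwise_orthogonal_independent by (auto simp: orthonormal_basis_of_def)
  show thesis
  proof (rule that)
    show "finite B" using ind by (rule independent_imp_finite)
    show "card B = dim V" using B dim_span_eq_card_independent[OF ind] by (auto simp: orthonormal_basis_of_def)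
  qed (use B in \<open>simp_all add: lborel_subspace_def B_def Let_def\<close>)
qed

lemma orthonormal_inner_sum:
  assumes "orthonormal_basis_of V B" "finite B" "b \<in> B"
  shows "(\<Sum>a\<in>B. c a *\<^sub>R a) \<bullet> b = c b"
proof -
  have "(\<Sum>a\<in>B. c a *\<^sub>R a) \<bullet> b = (\<Sum>a\<in>B. if a = b then c a else 0)"
    unfolding inner_sum_left
  proof (intro sum.cong refl)
    fix a assume "a \<in> B"
    then show "(c a *\<^sub>R a) \<bullet> b = (if a = b then c a else 0)"
      using assms unfolding orthonormal_basis_of_def pairwise_def orthogonal_def
      by (auto simp: norm_eq_1)
  qed
  also have "\<dots> = c b" using assms by simp
  finally show ?thesis .
qed

lemma orthonormal_norm_sum:
  assumes "orthonormal_basis_of V B" "finite B"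
  shows "(norm (\<Sum>a\<in>B. c a *\<^sub>R a))\<^sup>2 = (\<Sum>a\<in>B. (c a)\<^sup>2)"
proof -
  have "(norm (\<Sum>a\<in>B. c a *\<^sub>R a))\<^sup>2 = (\<Sum>b\<in>B. (\<Sum>a\<in>B. c a *\<^sub>R a) \<bullet> (c b *\<^sub>R b))"
    unfolding power2_norm_eq_inner by (rule inner_sum_right)
  also have "\<dots> = (\<Sum>a\<in>B. (c a)\<^sup>2)"
    using orthonormal_inner_sum[OF assms] by (intro sum.cong) (auto simp: power2_eq_square)
  finally show ?thesis .
qed

lemma homogeneous_measure_lborel_subspace:
  fixes V :: "'a::euclidean_space set"
  assumes V: "subspace V" and d: "1 \<le> dim V"
  shows "homogeneous_measure (lborel_subspace V) (dim V)"
proof -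
  obtain B where B: "finite B" "card B = dim V" "orthonormal_basis_of V B"
    and eq: "lborel_subspace V = distr (\<Pi>\<^sub>M b\<in>B. (lborel :: real measure)) borel (\<lambda>c. \<Sum>b\<in>B. c b *\<^sub>R b)"
    using lborel_subspace_basis[OF V] .
  let ?P = "\<Pi>\<^sub>M b\<in>B. (lborel :: real measure)"
  let ?T = "\<lambda>c. \<Sum>b\<in>B. c b *\<^sub>R b"
  have T[measurable]: "?T \<in> ?P \<rightarrow>\<^sub>M borel" by measurable
  show ?thesis
    unfolding homogeneous_measure_def
  proof (intro conjI allI impI)
    show "sets (lborel_subspace V) = sets borel" by (simp add: eq)
    show "1 \<le> dim V" by fact
    have "emeasure (lborel_subspace V) (cball 0 1) = emeasure ?P (?T -` cball 0 1 \<inter> space ?P)"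
      unfolding eq by (rule emeasure_distr) auto
    \<comment> \<open>A vector of norm at most \<open>1\<close> has coordinates between
      \<open>-1\<close> and \<open>1\<close> in an orthonormal basis, by Cauchy-Schwarz.\<close>
    also have "\<dots> \<le> emeasure ?P (Pi\<^sub>E B (\<lambda>_. {-1..1}))"
    proof (rule emeasure_mono)
      show "Pi\<^sub>E B (\<lambda>_. {-1..1}) \<in> sets ?P" using B by (intro sets_PiM_I_finite) auto
      show "?T -` cball 0 1 \<inter> space ?P \<subseteq> Pi\<^sub>E B (\<lambda>_. {-1..1})"
      proof
        fix c assume c: "c \<in> ?T -` cball 0 1 \<inter> space ?P"
        have "\<bar>c b\<bar> \<le> 1" if b: "b \<in> B" for b
        proof -
          have "\<bar>c b\<bar> = \<bar>?T c \<bullet> b\<bar>" using orthonormal_inner_sum[OF B(3,1) b] by simp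
          also have "\<dots> \<le> norm (?T c) * norm b" by (rule Cauchy_Schwarz_ineq2)
          also have "\<dots> \<le> 1" using c b B(3) by (auto simp: orthonormal_basis_of_def)
          finally show ?thesis .
        qed
        then show "c \<in> Pi\<^sub>E B (\<lambda>_. {-1..1})"
          using c by (auto simp: PiE_iff space_PiM abs_le_iff minus_le_iff)
      qed
    qed
    also have "\<dots> = (\<Prod>b\<in>B. emeasure lborel {-1..1::real})"
      using B by (intro lborel_product.emeasure_PiM) auto
    also have "\<dots> < \<infinity>" by (simp add: power_less_top_ennreal)
    finally show "emeasure (lborel_subspace V) (cball 0 1) < \<infinity>" .
  next
    fix F :: "'a \<Rightarrow> ennreal" and r :: real
    assume F[measurable]: "F \<in> borel_measurable borel" and r: "0 < r"
    have "(\<integral>\<^sup>+x. F x \<partial>lborel_subspace V) = (\<integral>\<^sup>+c. F (?T c) \<partial>?P)"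
      unfolding eq by (rule nn_integral_distr) auto
    also have "\<dots> = ennreal (r ^ dim V) * (\<integral>\<^sup>+c. F (?T (\<lambda>b\<in>B. r * c b)) \<partial>?P)"
      unfolding B(2)[symmetric] by (rule nn_integral_PiM_scale[OF B(1) r]) measurable
    also have "(\<lambda>c. F (?T (\<lambda>b\<in>B. r * c b))) = (\<lambda>c. F (r *\<^sub>R ?T c))"
      by (simp add: scaleR_sum_right)
    also have "(\<integral>\<^sup>+c. F (r *\<^sub>R ?T c) \<partial>?P) = (\<integral>\<^sup>+x. F (r *\<^sub>R x) \<partial>lborel_subspace V)"
      unfolding eq by (rule nn_integral_distr[symmetric]) auto
    finally show "(\<integral>\<^sup>+x. F x \<partial>lborel_subspace V) = ennreal (r ^ dim V) * (\<integral>\<^sup>+x. F (r *\<^sub>R x) \<partial>lborel_subspace V)" .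
  qed
qed

lemma AE_lborel_subspace:
  fixes V :: "'a::euclidean_space set"
  assumes V: "subspace V"
  shows "AE x in lborel_subspace V. x \<in> V"
proof -
  obtain B where B: "finite B" "card B = dim V" "orthonormal_basis_of V B"
    and eq: "lborel_subspace V = distr (\<Pi>\<^sub>M b\<in>B. (lborel :: real measure)) borel (\<lambda>c. \<Sum>b\<in>B. c b *\<^sub>R b)"
    using lborel_subspace_basis[OF V] .
  have "(\<Sum>b\<in>B. c b *\<^sub>R b) \<in> V" for c
  proof -
    have "(\<Sum>b\<in>B. c b *\<^sub>R b) \<in> span B" by (auto intro: span_sum span_scale span_base)
    then show ?thesis using B(3) by (simp add: orthonormal_basis_of_def)
  qed
  moreover have "V \<in> sets borel" using closed_subspace[OF V] by (rule borel_closed)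
  ultimately show ?thesis
    unfolding eq by (subst AE_distr_iff) auto
qed

section \<open>Gaussian integrals on subspaces\<close>

lemma gaussian_fourier:
  assumes s: "0 < (s::real)"
  shows "integrable lborel (\<lambda>t::real. exp (\<i> * complex_of_real (t * w)) * complex_of_real (exp (- (s\<^sup>2 * t\<^sup>2 / 2))))" (is "integrable _ ?f")
    and "\<exists>a\<ge>0. (LBINT t. exp (\<i> * complex_of_real (t * w)) * complex_of_real (exp (- (s\<^sup>2 * t\<^sup>2 / 2)))) = complex_of_real a"
proof -
  let ?g = "\<lambda>x::real. exp (\<i> * complex_of_real (w / s * x)) * complex_of_real (exp (- x\<^sup>2 / 2))"
  let ?h = "\<lambda>x::real. complex_of_real (std_normal_density x) * exp (\<i> * complex_of_real (w / s * x))"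
  have gh: "?g x = complex_of_real (sqrt (2 * pi)) * ?h x" for x
    by (simp add: std_normal_density_def)
  have ih: "integrable lborel ?h"
  proof (rule Bochner_Integration.integrable_bound)
    show "integrable lborel std_normal_density" by simp
    show "?h \<in> borel_measurable lborel" by measurable
    show "AE x in lborel. norm (?h x) \<le> norm (std_normal_density x)"
      by (simp add: norm_mult norm_exp_i_times)
  qed
  have "char std_normal_distribution (w / s) = (LBINT x. ?h x)"
    unfolding char_def by (subst integral_density) (auto simp: scaleR_conv_of_real)
  then have h: "(LBINT x. ?h x) = complex_of_real (exp (- ((w / s)\<^sup>2) / 2))"
    by (simp add: char_std_normal_distribution)
  have ig: "integrable lborel ?g" unfolding gh using ih by (rule integrable_mult_right)
  have g: "(LBINT x. ?g x) = complex_of_real (sqrt (2 * pi) * exp (- ((w / s)\<^sup>2) / 2))"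
    unfolding gh using h by simp
  \<comment> \<open>The substitution \<open>x = s * t\<close> reduces the integral to the
    characteristic function of the standard normal distribution at \<open>w / s\<close>, which is
    real and positive.\<close>
  have fg: "?f t = ?g (0 + s * t)" for t using s by (simp add: power_mult_distrib mult.commute)
  show "integrable lborel ?f"
    unfolding fg using s by (intro lborel_integrable_real_affine[OF ig]) auto
  have "(LBINT x. ?g x) = \<bar>s\<bar> *\<^sub>R (LBINT t. ?g (0 + s * t))"
    using s by (intro lborel_integral_real_affine) auto
  then have "(LBINT t. ?f t) = complex_of_real ((sqrt (2 * pi) * exp (- ((w / s)\<^sup>2) / 2)) / s)"
    unfolding fg g using s by (simp add: scaleR_conv_of_real field_simps)
  then show "\<exists>a\<ge>0. (LBINT t. ?f t) = complex_of_real a" using s by (intro exI[of _ "(sqrt (2 * pi) * exp (- ((w / s)\<^sup>2) / 2)) / s"]) auto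
qed

text \<open>In coordinates of an orthonormal basis of \<open>V\<close> both the exponential and the
  Gaussian factorize, so the integral is a product of one-dimensional ones. The frequency
  \<open>y\<close> ranges over the whole space; only its inner products with the basis
  matter.\<close>

lemma gaussian_fourier_subspace:
  fixes V :: "'a::euclidean_space set"
  assumes V: "subspace V" and s: "0 < s"
  shows "integrable (lborel_subspace V) (\<lambda>x. exp (\<i> * complex_of_real (x \<bullet> y)) * complex_of_real (exp (- (s\<^sup>2 * (norm x)\<^sup>2 / 2))))"
    and "\<exists>a\<ge>0. (LINT x|lborel_subspace V. exp (\<i> * complex_of_real (x \<bullet> y)) * complex_of_real (exp (- (s\<^sup>2 * (norm x)\<^sup>2 / 2)))) = complex_of_real a"
proof -
  obtain B where B: "finite B" "card B = dim V" "orthonormal_basis_of V B"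
    and eq: "lborel_subspace V = distr (\<Pi>\<^sub>M b\<in>B. (lborel :: real measure)) borel (\<lambda>c. \<Sum>b\<in>B. c b *\<^sub>R b)"
    using lborel_subspace_basis[OF V] .
  let ?P = "\<Pi>\<^sub>M b\<in>B. (lborel :: real measure)"
  let ?T = "\<lambda>c. \<Sum>b\<in>B. c b *\<^sub>R b"
  let ?f = "\<lambda>x. exp (\<i> * complex_of_real (x \<bullet> y)) * complex_of_real (exp (- (s\<^sup>2 * (norm x)\<^sup>2 / 2)))"
  let ?g = "\<lambda>b t. exp (\<i> * complex_of_real (t * (b \<bullet> y))) * complex_of_real (exp (- (s\<^sup>2 * t\<^sup>2 / 2)))"
  have T[measurable]: "?T \<in> ?P \<rightarrow>\<^sub>M borel" by measurable
  have f[measurable]: "?f \<in> borel_measurable borel" by measurable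
  have fT: "?f (?T c) = (\<Prod>b\<in>B. ?g b (c b))" for c
  proof -
    have "\<i> * complex_of_real (?T c \<bullet> y) = (\<Sum>b\<in>B. \<i> * complex_of_real (c b * (b \<bullet> y)))"
      by (simp add: inner_sum_left sum_distrib_left)
    moreover have "- (s\<^sup>2 * (norm (?T c))\<^sup>2 / 2) = (\<Sum>b\<in>B. - (s\<^sup>2 * (c b)\<^sup>2 / 2))"
      unfolding orthonormal_norm_sum[OF B(3,1)]
      by (simp add: sum_distrib_left sum_divide_distrib sum_negf)
    ultimately show ?thesis using B(1) by (simp add: exp_sum prod.distrib)
  qed
  have "integrable ?P (\<lambda>c. \<Prod>b\<in>B. ?g b (c b))"
    by (rule lborel_product.product_integrable_prod[OF B(1)]) (rule gaussian_fourier(1)[OF s])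
  then show "integrable (lborel_subspace V) ?f"
    unfolding eq by (subst integrable_distr_eq) (auto simp: fT)
  have "(LINT x|lborel_subspace V. ?f x) = (LINT c|?P. (\<Prod>b\<in>B. ?g b (c b)))"
    unfolding eq by (subst integral_distr) (auto simp: fT)
  also have "\<dots> = (\<Prod>b\<in>B. (LBINT t. ?g b t))"
    by (rule lborel_product.product_integral_prod[OF B(1)]) (rule gaussian_fourier(1)[OF s])
  finally have I: "(LINT x|lborel_subspace V. ?f x) = (\<Prod>b\<in>B. (LBINT t. ?g b t))" .
  have "\<forall>b. \<exists>a\<ge>0. (LBINT t. ?g b t) = complex_of_real a" using gaussian_fourier(2)[OF s] by blast
  then obtain a where a: "\<And>b. 0 \<le> a b" "\<And>b. (LBINT t. ?g b t) = complex_of_real (a b)" by metis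
  show "\<exists>a\<ge>0. (LINT x|lborel_subspace V. ?f x) = complex_of_real a"
    unfolding I a(2) using a(1) by (intro exI[of _ "prod a B"]) (auto intro: prod_nonneg)
qed

section \<open>Fourier transforms of Schwartz functions\<close>

lemma nn_integral_radial_power_unit:
  assumes "1 \<le> m"
  shows "(\<integral>\<^sup>+r. ennreal (r ^ (m - 1)) * indicator {0..1} r \<partial>lborel) = ennreal (1 / real m)"
proof -
  have "(\<integral>\<^sup>+r. ennreal (r ^ (m - 1)) * indicator {0..1} r \<partial>lborel) = ennreal (1 ^ m / real m - 0 ^ m / real m)"
    using assms by (intro nn_integral_FTC_Icc) (auto intro!: derivative_eq_intros)
  then show ?thesis using assms by (simp add: power_0_left)
qed

lemma nn_integral_inverse_square: "(\<integral>\<^sup>+r. ennreal (1 / (1 + r)\<^sup>2) * indicator {0..} r \<partial>lborel) = 1"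
proof -
  have "((\<lambda>r::real. - (1 / (1 + r))) \<longlongrightarrow> - 0) at_top"
    by (intro tendsto_minus tendsto_divide_0[OF tendsto_const] filterlim_at_top_imp_at_infinity
        filterlim_tendsto_add_at_top[OF tendsto_const] filterlim_ident)
  then have "(\<integral>\<^sup>+r. ennreal (1 / (1 + r)\<^sup>2) * indicator {0..} r \<partial>lborel) = ennreal (0 - (- (1 / (1 + 0))))"
    by (intro nn_integral_FTC_atLeast)
       (auto intro!: derivative_eq_intros simp: power2_eq_square field_simps)
  then show ?thesis by simp
qed

text \<open>A comparison ray by ray with \<open>m\<close> times the indicator of the unit ball. At a
  unit vector the latter has radial integral exactly \<open>1\<close>, while that of the decaying
  weight is at most the integral of \<open>1 / (1 + r)\<^sup>2\<close> over
  \<open>r \<ge> 0\<close>, which is \<open>1\<close> too.\<close>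

lemma nn_integral_decay:
  fixes M :: "'a::euclidean_space measure"
  assumes M: "homogeneous_measure M m"
  shows "(\<integral>\<^sup>+x. ennreal (1 / (1 + norm x) ^ (m + 1)) \<partial>M) < \<infinity>"
proof -
  have m: "1 \<le> m" by (rule homogeneous_measureD(2)[OF M])
  let ?g = "\<lambda>x::'a. ennreal (1 / (1 + norm x) ^ (m + 1))"
  let ?b = "\<lambda>x::'a. ennreal (real m) * indicator (cball 0 1) x"
  have "(\<integral>\<^sup>+x. ?g x \<partial>M) \<le> (\<integral>\<^sup>+x. ?b x \<partial>M)"
  proof (rule nn_integral_radial_mono[OF M])
    show "?g \<in> borel_measurable borel" by measurable
    show "?b \<in> borel_measurable borel"
      by (intro borel_measurable_times_ennreal borel_measurable_const borel_measurable_indicator borel_closed closed_cball)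
    fix x :: 'a assume "x \<noteq> 0"
    define e where "e = (1 / norm x) *\<^sub>R x"
    have e: "norm e = 1" using \<open>x \<noteq> 0\<close> by (simp add: e_def)
    have "radial m ?g e \<le> (\<integral>\<^sup>+r. ennreal (1 / (1 + r)\<^sup>2) * indicator {0..} r \<partial>lborel)"
      unfolding radial_def
    proof (rule nn_integral_mono)
      fix r :: real
      show "ennreal (r ^ (m - 1)) * ?g (r *\<^sub>R e) * indicator {0<..} r \<le> ennreal (1 / (1 + r)\<^sup>2) * indicator {0..} r"
      proof (cases "0 < r")
        case True
        have "r ^ (m - 1) * (1 / (1 + r) ^ (m + 1)) \<le> (1 + r) ^ (m - 1) * (1 / (1 + r) ^ (m + 1))"
          using True by (intro mult_right_mono power_mono) auto
        also have "\<dots> = 1 / (1 + r)\<^sup>2"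
        proof -
          have "(1 + r) ^ (m + 1) = (1 + r) ^ (m - 1) * (1 + r)\<^sup>2"
            using m by (simp flip: power_add)
          then show ?thesis using True by simp
        qed
        finally have "ennreal (r ^ (m - 1) * (1 / (1 + r) ^ (m + 1))) \<le> ennreal (1 / (1 + r)\<^sup>2)" by (rule ennreal_leI)
        moreover have "ennreal (r ^ (m - 1) * (1 / (1 + r) ^ (m + 1))) = ennreal (r ^ (m - 1)) * ?g (r *\<^sub>R e)"
          using True e by (subst ennreal_mult) auto
        ultimately have le: "ennreal (r ^ (m - 1)) * ?g (r *\<^sub>R e) \<le> ennreal (1 / (1 + r)\<^sup>2)" by metis
        have i: "indicator {0<..} r = (1::ennreal)" "indicator {0..} r = (1::ennreal)" using True by auto
        show ?thesis unfolding i mult_1_right by (rule le)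
      qed simp
    qed
    also have "\<dots> = 1" by (rule nn_integral_inverse_square)
    also have "1 = ennreal (real m) * (\<integral>\<^sup>+r. ennreal (r ^ (m - 1)) * indicator {0..1} r \<partial>lborel)"
      unfolding nn_integral_radial_power_unit[OF m] using m by (simp flip: ennreal_mult)
    also have "\<dots> = (\<integral>\<^sup>+r. ennreal (real m) * (ennreal (r ^ (m - 1)) * indicator {0..1} r) \<partial>lborel)"
      by (rule nn_integral_cmult[symmetric]) measurable
    also have "\<dots> = radial m ?b e"
      unfolding radial_def
    proof (rule nn_integral_cong_AE, rule AE_mp[OF AE_lborel_singleton[of 0]], rule AE_I2, rule impI)
      fix r :: real assume "r \<noteq> 0"
      then show "ennreal (real m) * (ennreal (r ^ (m - 1)) * indicator {0..1} r)
          = ennreal (r ^ (m - 1)) * ?b (r *\<^sub>R e) * indicator {0<..} r"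
        using e by (auto simp: indicator_def mem_cball_0 mult.commute simp del: mem_cball)
    qed
    finally show "\<exists>s>0. radial m ?g (s *\<^sub>R x) \<le> radial m ?b (s *\<^sub>R x)"
      unfolding e_def using \<open>x \<noteq> 0\<close> by (intro exI[of _ "1 / norm x"]) auto
  qed
  also have "\<dots> = ennreal (real m) * emeasure M (cball 0 1)"
    using homogeneous_measureD(1)[OF M] by (intro nn_integral_cmult_indicator) auto
  also have "\<dots> < \<infinity>" using homogeneous_measureD(3)[OF M] by (simp add: ennreal_mult_less_top)
  finally show ?thesis .
qed

lemma integrable_decay_weight:
  fixes M :: "'a::euclidean_space measure"
  assumes M: "homogeneous_measure M m"
  shows "integrable M (\<lambda>x. C / (1 + norm x) ^ (m + 1))"
proof -
  have [measurable_cong]: "sets M = sets borel" by (rule homogeneous_measureD(1)[OF M])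
  have "integrable M (\<lambda>x. 1 / (1 + norm x) ^ (m + 1))"
    by (rule integrableI_nonneg) (use nn_integral_decay[OF M] in auto)
  then have "integrable M (\<lambda>x. C * (1 / (1 + norm x) ^ (m + 1)))" by (intro integrable_mult_right)
  then show ?thesis by simp
qed

lemma integrable_decay:
  fixes f :: "'a::euclidean_space \<Rightarrow> 'b::{banach, second_countable_topology}"
  assumes M: "homogeneous_measure M m" and f: "f \<in> borel_measurable borel"
    and C: "\<And>x. norm (f x) \<le> C / (1 + norm x) ^ (m + 1)"
  shows "integrable M f"
proof (rule Bochner_Integration.integrable_bound[OF integrable_decay_weight[OF M, of C]])
  have [measurable_cong]: "sets M = sets borel" by (rule homogeneous_measureD(1)[OF M])
  show "f \<in> borel_measurable M" using f by measurable
  show "AE x in M. norm (f x) \<le> norm (C / (1 + norm x) ^ (m + 1))"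
    unfolding real_norm_def by (intro AE_I2) (rule order_trans[OF C abs_ge_self])
qed

text \<open>\<open>1 + norm x\<close> is at most twice the larger of \<open>1\<close> and
  \<open>norm x\<close>, so the bounds on \<open>v\<close> and on \<open>norm x ^ k * v\<close>
  together control the weighted value.\<close>

lemma decay_boundI:
  fixes x :: "'a::real_normed_vector"
  assumes "0 \<le> v" "v \<le> a" "norm x ^ k * v \<le> b"
  shows "v \<le> 2 ^ k * (a + b) / (1 + norm x) ^ k"
proof -
  have "(1 + norm x) ^ k \<le> 2 ^ k * (1 + norm x ^ k)"
  proof (cases "norm x \<le> 1")
    case True
    then have "(1 + norm x) ^ k \<le> 2 ^ k" by (intro power_mono) auto
    also have "\<dots> \<le> 2 ^ k * (1 + norm x ^ k)" by (simp add: distrib_left)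
    finally show ?thesis .
  next
    case False
    then have "(1 + norm x) ^ k \<le> (2 * norm x) ^ k" by (intro power_mono) auto
    then show ?thesis unfolding power_mult_distrib distrib_left by (simp add: add_increasing)
  qed
  then have "(1 + norm x) ^ k * v \<le> 2 ^ k * (1 + norm x ^ k) * v"
    using assms(1) by (rule mult_right_mono)
  also have "\<dots> = 2 ^ k * (v + norm x ^ k * v)" by (simp add: algebra_simps)
  also have "\<dots> \<le> 2 ^ k * (a + b)" using assms by (intro mult_left_mono add_mono) auto
  finally show ?thesis by (simp add: pos_le_divide_eq mult.commute add_pos_nonneg)
qed

lemma schwartz_decay:
  assumes "schwartz \<phi>"
  shows "\<exists>C. \<forall>x. norm (iter_partial is \<phi> x) \<le> C / (1 + norm x) ^ k"
proof -
  have b: "bounded (range (\<lambda>x. norm x ^ j *\<^sub>R iter_partial is \<phi> x))" for j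
    using assms unfolding schwartz_def by blast
  obtain a where a: "\<And>x. norm (norm x ^ 0 *\<^sub>R iter_partial is \<phi> x) \<le> a"
    using b[of 0] unfolding bounded_iff by blast
  obtain c where c: "\<And>x. norm (norm x ^ k *\<^sub>R iter_partial is \<phi> x) \<le> c"
    using b[of k] unfolding bounded_iff by blast
  show ?thesis
    by (intro exI[of _ "2 ^ k * (a + c)"] allI decay_boundI) (use a c in auto)
qed

lemma schwartz_continuous:
  assumes "schwartz \<phi>"
  shows "continuous_on UNIV (iter_partial is \<phi>)"
proof (rule continuous_at_imp_continuous_on, rule ballI)
  fix x
  have "iter_partial is \<phi> differentiable (at x)"
    using assms by (simp add: schwartz_def smooth_on_def)
  then show "isCont (iter_partial is \<phi>) x" by (rule differentiable_imp_continuous_within)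
qed

lemma schwartz_integrable:
  fixes \<phi> :: "real^'n \<Rightarrow> complex"
  assumes "schwartz \<phi>"
  shows "integrable lborel (iter_partial is \<phi>)"
proof -
  obtain C where C: "\<And>x. norm (iter_partial is \<phi> x) \<le> C / (1 + norm x) ^ (DIM(real^'n) + 1)"
    using schwartz_decay[OF assms] by blast
  show ?thesis
    by (rule integrable_decay[OF homogeneous_measure_lborel _ C])
       (rule borel_measurable_continuous_onI[OF schwartz_continuous[OF assms]])
qed

section \<open>Decay and continuity of Fourier transforms\<close>

lemma norm_fourier_kernel [simp]: "norm (exp (- (\<i> * complex_of_real t))) = 1"
  by (simp add: norm_exp_eq_Re)

lemma fourier_integrable:
  fixes F :: "real^'n \<Rightarrow> complex"
  assumes "integrable lborel F"
  shows "integrable lborel (\<lambda>x. F x * exp (- (\<i> * complex_of_real (x \<bullet> \<xi>))))"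
  by (rule Bochner_Integration.integrable_bound[OF assms]) (use assms in \<open>auto simp: norm_mult\<close>)

lemma norm_fourier_le:
  fixes F :: "real^'n \<Rightarrow> complex"
  shows "norm (fourier F \<xi>) \<le> (LINT x|lborel. norm (F x))"
  unfolding fourier_def by (rule order_trans[OF integral_norm_bound]) (simp add: norm_mult)

lemma fourier_translate:
  fixes F :: "real^'n \<Rightarrow> complex"
  assumes "integrable lborel F"
  shows "integrable lborel (\<lambda>x. F (v + x))"
    and "fourier (\<lambda>x. F (v + x)) \<xi> = exp (\<i> * complex_of_real (v \<bullet> \<xi>)) * fourier F \<xi>"
proof -
  have [measurable]: "F \<in> borel_measurable borel" using assms by auto
  have d: "distr lborel borel ((+) v) = (lborel :: (real^'n) measure)" by (rule lborel_distr_plus)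
  have "integrable (distr lborel borel ((+) v)) F" unfolding d by fact
  then show "integrable lborel (\<lambda>x. F (v + x))" by (subst (asm) integrable_distr_eq) auto
  have "exp (\<i> * complex_of_real (v \<bullet> \<xi>)) * fourier F \<xi> =
     (LINT x|distr lborel borel ((+) v). exp (\<i> * complex_of_real (v \<bullet> \<xi>)) * (F x * exp (- (\<i> * complex_of_real (x \<bullet> \<xi>)))))"
    unfolding d fourier_def by simp
  also have "\<dots> = (LINT x|lborel. exp (\<i> * complex_of_real (v \<bullet> \<xi>)) * (F (v + x) * exp (- (\<i> * complex_of_real ((v + x) \<bullet> \<xi>)))))"
    by (rule integral_distr) auto
  also have "\<dots> = fourier (\<lambda>x. F (v + x)) \<xi>"
    unfolding fourier_def by (rule Bochner_Integration.integral_cong) (auto simp: inner_add_left algebra_simps exp_add exp_diff exp_minus)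
  finally show "fourier (\<lambda>x. F (v + x)) \<xi> = exp (\<i> * complex_of_real (v \<bullet> \<xi>)) * fourier F \<xi>" ..
qed

text \<open>Difference quotients take the place of integration by parts: a translation multiplies
  the transform by an exponential, and the decay of the derivative \<open>G\<close> permits
  dominated convergence as the step tends to \<open>0\<close>.\<close>

lemma fourier_partial:
  fixes F :: "real^'n \<Rightarrow> complex"
  assumes F: "\<And>x. F differentiable (at x)"
    and Fi: "integrable lborel F"
    and G: "G = (\<lambda>x. frechet_derivative F (at x) (axis i 1))" "continuous_on UNIV G"
    and C: "\<And>x. norm (G x) \<le> C / (1 + norm x) ^ (DIM(real^'n) + 1)"
  shows "fourier G \<xi> = \<i> * complex_of_real (\<xi> $ i) * fourier F \<xi>"
proof -
  define e where "e = (axis i 1 :: real^'n)"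
  have e: "norm e = 1" by (simp add: e_def norm_axis_1)
  have D: "(F has_derivative frechet_derivative F (at x)) (at x)" for x
    using F frechet_derivative_works by blast
  define s where "s k = inverse (real (Suc k))" for k
  have s: "0 < s k" "s k \<le> 1" for k by (auto simp: s_def inverse_le_1_iff)
  have s0: "s \<longlonglongrightarrow> 0" unfolding s_def by (rule LIMSEQ_inverse_real_of_nat)
  let ?E = "\<lambda>x. exp (- (\<i> * complex_of_real (x \<bullet> \<xi>)))"
  define Q where "Q k x = (F (s k *\<^sub>R e + x) - F x) /\<^sub>R s k" for k x
  have Fm[measurable]: "F \<in> borel_measurable borel" using Fi by auto
  have Gm[measurable]: "G \<in> borel_measurable borel" using G(2) by (rule borel_measurable_continuous_onI)
  have ptw: "(\<lambda>k. Q k x) \<longlonglongrightarrow> G x" for x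
  proof -
    have "(\<lambda>k. (F (s k *\<^sub>R e + x) - F x) /\<^sub>R s k) \<longlonglongrightarrow> frechet_derivative F (at x) e"
    proof (rule has_derivative_along_sequence[OF D _ s(1) s0])
      have "((s k *\<^sub>R e + x) - x) /\<^sub>R s k = e" for k using s(1)[of k] by simp
      then show "(\<lambda>k. ((s k *\<^sub>R e + x) - x) /\<^sub>R s k) \<longlonglongrightarrow> e" by simp
    qed simp
    then show ?thesis by (simp add: Q_def G(1) e_def)
  qed
  have C0: "0 \<le> C" using order_trans[OF norm_ge_zero C[of 0]] by simp
  \<comment> \<open>The mean value inequality bounds the quotient by \<open>G\<close> at a point at
    distance at most \<open>1\<close> from \<open>x\<close>. Such a shift at most halves
    \<open>1 + norm x\<close>, hence the power of \<open>2\<close>.\<close>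
  have bound: "norm (Q k x) \<le> (2 ^ (DIM(real^'n) + 1) * C) / (1 + norm x) ^ (DIM(real^'n) + 1)" for k x
  proof -
    let ?f = "\<lambda>t. F (t *\<^sub>R e + x)"
    have der: "(?f has_derivative (\<lambda>h. frechet_derivative F (at (t *\<^sub>R e + x)) (h *\<^sub>R e))) (at t)" for t
    proof -
      have a: "((\<lambda>t. t *\<^sub>R e + x) has_derivative (\<lambda>h. h *\<^sub>R e)) (at t)"
        by (auto intro!: derivative_eq_intros)
      show ?thesis by (rule has_derivative_compose[OF a D])
    qed
    have "continuous_on {0..s k} ?f"
      by (intro continuous_at_imp_continuous_on ballI has_derivative_continuous[OF der])
    from mvt_general[OF s(1) this der] obtain t where t: "t \<in> {0<..<s k}"
      "norm (?f (s k) - ?f 0) \<le> norm (frechet_derivative F (at (t *\<^sub>R e + x)) ((s k - 0) *\<^sub>R e))" by blast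
    have "frechet_derivative F (at (t *\<^sub>R e + x)) (s k *\<^sub>R e) = s k *\<^sub>R G (t *\<^sub>R e + x)"
      unfolding G(1) e_def by (rule linear_scale[OF has_derivative_linear[OF D]])
    then have "norm (F (s k *\<^sub>R e + x) - F x) \<le> s k * norm (G (t *\<^sub>R e + x))"
      using t(2) s(1)[of k] by simp
    then have "norm (Q k x) \<le> norm (G (t *\<^sub>R e + x))"
      using s(1)[of k] by (simp add: Q_def inverse_eq_divide pos_divide_le_eq mult.commute)
    also have "\<dots> \<le> C / (1 + norm (t *\<^sub>R e + x)) ^ (DIM(real^'n) + 1)" by (rule C)
    also have "\<dots> \<le> C / ((1 + norm x) / 2) ^ (DIM(real^'n) + 1)"
    proof -
      have alg: "(1 + a) / 2 \<le> 1 + b" if "a \<le> b + c" "c \<le> 1" "0 \<le> b" for a b c :: real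
        using that by simp
      have "norm x \<le> norm (t *\<^sub>R e + x) + norm (t *\<^sub>R e)"
        using norm_triangle_ineq4[of "t *\<^sub>R e + x" "t *\<^sub>R e"] by simp
      moreover have "norm (t *\<^sub>R e) \<le> 1" using t(1) s(2)[of k] e by simp
      ultimately have "(1 + norm x) / 2 \<le> 1 + norm (t *\<^sub>R e + x)"
        by (rule alg) simp
      moreover have "0 < (1 + norm x) / 2" by (simp add: add_pos_nonneg)
      ultimately show ?thesis using C0 by (intro divide_left_mono power_mono mult_pos_pos zero_less_power) auto
    qed
    also have "\<dots> = (2 ^ (DIM(real^'n) + 1) * C) / (1 + norm x) ^ (DIM(real^'n) + 1)"
      by (simp add: power_divide)
    finally show ?thesis .
  qed
  have "(\<lambda>k. (LINT x|lborel. Q k x * ?E x)) \<longlonglongrightarrow> (LINT x|lborel. G x * ?E x)"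
  proof (rule integral_dominated_convergence)
    show "integrable lborel (\<lambda>x::real^'n. (2 ^ (DIM(real^'n) + 1) * C) / (1 + norm x) ^ (DIM(real^'n) + 1))"
      by (rule integrable_decay_weight[OF homogeneous_measure_lborel])
    show "AE x in lborel. (\<lambda>k. Q k x * ?E x) \<longlonglongrightarrow> G x * ?E x"
      by (intro AE_I2 tendsto_mult_right ptw)
    show "AE x in lborel. norm (Q k x * ?E x) \<le> (2 ^ (DIM(real^'n) + 1) * C) / (1 + norm x) ^ (DIM(real^'n) + 1)" for k
      using bound[of k] by (intro AE_I2) (simp add: norm_mult)
  qed (auto simp: Q_def)
  then have l1: "(\<lambda>k. (LINT x|lborel. Q k x * ?E x)) \<longlonglongrightarrow> fourier G \<xi>" by (simp add: fourier_def)
  have eq: "(LINT x|lborel. Q k x * ?E x) = (exp (\<i> * complex_of_real (\<xi> $ i) * complex_of_real (s k)) - 1) / complex_of_real (s k) * fourier F \<xi>" for k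
  proof -
    have t1: "integrable lborel (\<lambda>x. F (s k *\<^sub>R e + x) * ?E x)"
      by (rule fourier_integrable[OF fourier_translate(1)[OF Fi]])
    have t2: "integrable lborel (\<lambda>x. F x * ?E x)" by (rule fourier_integrable[OF Fi])
    have "(LINT x|lborel. Q k x * ?E x) = (LINT x|lborel. (F (s k *\<^sub>R e + x) * ?E x - F x * ?E x) /\<^sub>R s k)"
      by (rule Bochner_Integration.integral_cong) (auto simp: Q_def algebra_simps)
    also have "\<dots> = (fourier (\<lambda>x. F (s k *\<^sub>R e + x)) \<xi> - fourier F \<xi>) /\<^sub>R s k"
      unfolding fourier_def using t1 t2 by simp
    also have "\<dots> = (exp (\<i> * complex_of_real (s k * (\<xi> $ i))) * fourier F \<xi> - fourier F \<xi>) /\<^sub>R s k"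
      unfolding fourier_translate(2)[OF Fi] by (simp add: e_def inner_axis' )
    also have "\<dots> = (exp (\<i> * complex_of_real (\<xi> $ i) * complex_of_real (s k)) - 1) / complex_of_real (s k) * fourier F \<xi>"
      using s(1)[of k] by (simp add: scaleR_conv_of_real field_simps)
    finally show ?thesis .
  qed
  have "((\<lambda>t. exp (\<i> * complex_of_real (\<xi> $ i) * t)) has_field_derivative \<i> * complex_of_real (\<xi> $ i)) (at 0)"
    by (auto intro!: derivative_eq_intros)
  then have "((\<lambda>h. (exp (\<i> * complex_of_real (\<xi> $ i) * h) - 1) / h) \<longlongrightarrow> \<i> * complex_of_real (\<xi> $ i)) (at 0)"
    by (simp add: DERIV_def)
  moreover have "filterlim (\<lambda>k. complex_of_real (s k)) (at 0) sequentially"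
  proof -
    have "s k \<noteq> 0" for k using s(1)[of k] by simp
    then show ?thesis unfolding filterlim_at using tendsto_of_real[OF s0, where 'a=complex] by simp
  qed
  ultimately have "(\<lambda>k. (exp (\<i> * complex_of_real (\<xi> $ i) * complex_of_real (s k)) - 1) / complex_of_real (s k)) \<longlonglongrightarrow> \<i> * complex_of_real (\<xi> $ i)"
    by (rule filterlim_compose)
  then have l2: "(\<lambda>k. (LINT x|lborel. Q k x * ?E x)) \<longlonglongrightarrow> \<i> * complex_of_real (\<xi> $ i) * fourier F \<xi>"
    unfolding eq by (rule tendsto_mult_right)
  show ?thesis by (rule LIMSEQ_unique[OF l1 l2])
qed

lemma schwartz_fourier_iter_partial:
  fixes \<phi> :: "real^'n \<Rightarrow> complex"
  assumes \<phi>: "schwartz \<phi>"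
  shows "fourier (iter_partial (replicate k i) \<phi>) \<xi> = (\<i> * complex_of_real (\<xi> $ i)) ^ k * fourier \<phi> \<xi>"
proof (induction k)
  case (Suc k)
  obtain C where C: "\<And>x. norm (iter_partial (i # replicate k i) \<phi> x) \<le> C / (1 + norm x) ^ (DIM(real^'n) + 1)"
    using schwartz_decay[OF \<phi>] by blast
  have "fourier (iter_partial (i # replicate k i) \<phi>) \<xi> = \<i> * complex_of_real (\<xi> $ i) * fourier (iter_partial (replicate k i) \<phi>) \<xi>"
  proof (rule fourier_partial[OF _ schwartz_integrable[OF \<phi>] _ schwartz_continuous[OF \<phi>] C])
    show "iter_partial (replicate k i) \<phi> differentiable at x" for x
      using \<phi> by (auto simp: schwartz_def smooth_on_def)
  qed simp
  then show ?case using Suc by (simp del: iter_partial.simps)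
qed simp

text \<open>Pure derivatives suffice: some coordinate satisfies
  \<open>norm \<xi> \<le> CARD('n) * \<bar>\<xi> $ i\<bar>\<close>, and \<open>k\<close> derivatives
  in that direction multiply the transform by a factor of modulus
  \<open>\<bar>\<xi> $ i\<bar> ^ k\<close>. Summing the constants \<open>A i\<close> removes the
  dependence of \<open>i\<close> on \<open>\<xi>\<close>.\<close>

lemma schwartz_fourier_decay:
  fixes \<phi> :: "real^'n \<Rightarrow> complex"
  assumes \<phi>: "schwartz \<phi>"
  shows "\<exists>C. \<forall>\<xi>. norm (fourier \<phi> \<xi>) \<le> C / (1 + norm \<xi>) ^ k"
proof -
  define A where "A i = (LINT x|lborel. norm (iter_partial (replicate k i) \<phi> x))" for i
  have A0: "0 \<le> A i" for i by (simp add: A_def)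
  define b where "b = real CARD('n) ^ k * (\<Sum>i\<in>UNIV. A i)"
  have "norm \<xi> ^ k * norm (fourier \<phi> \<xi>) \<le> b" for \<xi> :: "real^'n"
  proof -
    obtain i where i: "norm \<xi> \<le> real CARD('n) * \<bar>\<xi> $ i\<bar>"
    proof -
      have "\<exists>i. norm \<xi> \<le> real CARD('n) * \<bar>\<xi> $ i\<bar>"
      proof (rule ccontr)
        assume "\<not> ?thesis"
        then have "(\<Sum>i\<in>(UNIV::'n set). real CARD('n) * \<bar>\<xi> $ i\<bar>) < (\<Sum>i\<in>(UNIV::'n set). norm \<xi>)"
          by (intro sum_strict_mono) (auto simp: not_le)
        then have "real CARD('n) * (\<Sum>i\<in>UNIV. \<bar>\<xi> $ i\<bar>) < real CARD('n) * norm \<xi>"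
          by (simp add: sum_distrib_left)
        then have "(\<Sum>i\<in>UNIV. \<bar>\<xi> $ i\<bar>) < norm \<xi>" by (rule mult_left_less_imp_less) simp
        then show False using norm_le_l1_cart[of \<xi>] by linarith
      qed
      then show thesis using that by blast
    qed
    have "norm ((\<i> * complex_of_real (\<xi> $ i)) ^ k * fourier \<phi> \<xi>) \<le> A i"
      unfolding schwartz_fourier_iter_partial[OF \<phi>, symmetric] A_def by (rule norm_fourier_le)
    then have le: "\<bar>\<xi> $ i\<bar> ^ k * norm (fourier \<phi> \<xi>) \<le> A i"
      by (simp add: norm_mult norm_power)
    have "norm \<xi> ^ k * norm (fourier \<phi> \<xi>) \<le> (real CARD('n) * \<bar>\<xi> $ i\<bar>) ^ k * norm (fourier \<phi> \<xi>)"
      using i by (intro mult_right_mono power_mono) auto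
    also have "\<dots> = real CARD('n) ^ k * (\<bar>\<xi> $ i\<bar> ^ k * norm (fourier \<phi> \<xi>))" by (simp add: power_mult_distrib)
    also have "\<dots> \<le> real CARD('n) ^ k * A i" using le by (intro mult_left_mono) auto
    also have "\<dots> \<le> b" unfolding b_def using A0 by (intro mult_left_mono member_le_sum) auto
    finally show ?thesis .
  qed
  then show ?thesis
    by (intro exI[of _ "2 ^ k * ((LINT x|lborel. norm (\<phi> x)) + b)"] allI decay_boundI norm_fourier_le) auto
qed

lemma fourier_continuous:
  fixes F :: "real^'n \<Rightarrow> complex"
  assumes F: "integrable lborel F"
  shows "continuous_on UNIV (fourier F)"
proof (rule continuous_at_imp_continuous_on, rule ballI)
  fix \<xi> :: "real^'n"
  have [measurable]: "F \<in> borel_measurable borel" using F by auto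
  show "isCont (fourier F) \<xi>"
    unfolding continuous_at_sequentially
  proof (intro allI impI)
    fix z assume z: "z \<longlonglongrightarrow> \<xi>"
    have "(\<lambda>k. fourier F (z k)) \<longlonglongrightarrow> fourier F \<xi>"
      unfolding fourier_def
    proof (rule integral_dominated_convergence)
      show "integrable lborel (\<lambda>x. norm (F x))" using F by simp
      show "AE x in lborel. (\<lambda>k. F x * exp (- (\<i> * complex_of_real (x \<bullet> z k)))) \<longlonglongrightarrow> F x * exp (- (\<i> * complex_of_real (x \<bullet> \<xi>)))"
        by (intro AE_I2 tendsto_intros z)
    qed (auto simp: norm_mult)
    then show "(fourier F \<circ> z) \<longlonglongrightarrow> fourier F \<xi>" by (simp add: o_def)
  qed
qed

lemma integral_fourier_subspace_nonneg:
  fixes \<phi> :: "real^'n \<Rightarrow> complex"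
  assumes \<phi>: "schwartz \<phi>" and nn: "\<And>x. \<phi> x \<in> \<real>\<^sub>\<ge>\<^sub>0" and V: "subspace V" and d: "1 \<le> dim V"
  shows "integrable (lborel_subspace V) (fourier \<phi>)"
    and "0 \<le> (LINT x|lborel_subspace V. Re (fourier \<phi> x))"
proof -
  let ?M = "lborel_subspace V"
  have M: "homogeneous_measure ?M (dim V)" by (rule homogeneous_measure_lborel_subspace[OF V d])
  have [measurable_cong]: "sets ?M = sets borel" by (rule homogeneous_measureD(1)[OF M])
  have \<phi>i: "integrable lborel \<phi>" using schwartz_integrable[OF \<phi>, of "[]"] by simp
  have [measurable]: "\<phi> \<in> borel_measurable borel" using \<phi>i by auto
  have fm[measurable]: "fourier \<phi> \<in> borel_measurable borel"
    by (rule borel_measurable_continuous_onI[OF fourier_continuous[OF \<phi>i]])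
  obtain C where C: "\<And>\<xi>. norm (fourier \<phi> \<xi>) \<le> C / (1 + norm \<xi>) ^ (dim V + 1)"
    using schwartz_fourier_decay[OF \<phi>] by blast
  show int: "integrable ?M (fourier \<phi>)" by (rule integrable_decay[OF M fm C])
  interpret M: sigma_finite_measure ?M by (rule homogeneous_measure_sigma_finite[OF M])
  interpret P: pair_sigma_finite ?M "lborel :: (real^'n) measure" ..
  define g where "g s x = exp (- (s\<^sup>2 * (norm x)\<^sup>2 / 2))" for s and x :: "real^'n"
  have gm[measurable]: "g s \<in> borel_measurable borel" for s unfolding g_def by measurable
  have gi: "integrable ?M (g s)" if "0 < s" for s
  proof -
    have "integrable ?M (\<lambda>x. complex_of_real (g s x))"
      using gaussian_fourier_subspace(1)[OF V that, of 0] by (simp add: g_def)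
    then show ?thesis by (simp add: complex_of_real_integrable_eq)
  qed
  have pos: "0 \<le> Re (LINT x|?M. fourier \<phi> x * complex_of_real (g s x))" if s: "0 < s" for s
  proof -
    let ?k = "\<lambda>x y. \<phi> y * exp (- (\<i> * complex_of_real (y \<bullet> x))) * complex_of_real (g s x)"
    have nk: "norm (?k x y) = norm (\<phi> y) * g s x" for x y
      by (simp add: norm_mult) (simp add: g_def)
    have ki: "integrable (?M \<Otimes>\<^sub>M lborel) (case_prod ?k)"
    proof (rule P.Fubini_integrable)
      show "case_prod ?k \<in> borel_measurable (?M \<Otimes>\<^sub>M lborel)" by measurable
      have "(LINT y|lborel. norm (case_prod ?k (x, y))) = (LINT y|lborel. norm (\<phi> y)) * g s x" for x
        by (simp only: case_prod_conv nk) simp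
      then show "integrable ?M (\<lambda>x. LINT y|lborel. norm (case_prod ?k (x, y)))"
        using gi[OF s] by (simp only: integrable_mult_right)
      show "AE x in ?M. integrable lborel (\<lambda>y. case_prod ?k (x, y))"
        by (intro AE_I2) (simp add: integrable_mult_left fourier_integrable[OF \<phi>i])
    qed
    have "(LINT x|?M. fourier \<phi> x * complex_of_real (g s x)) = (LINT x|?M. (LINT y|lborel. ?k x y))"
      unfolding fourier_def by simp
    also have "\<dots> = (LINT y|lborel. (LINT x|?M. ?k x y))" by (rule P.Fubini_integral[OF ki, symmetric])
    finally have eq: "(LINT x|?M. fourier \<phi> x * complex_of_real (g s x)) = (LINT y|lborel. (LINT x|?M. ?k x y))" .
    have "0 \<le> Re (LINT x|?M. ?k x y)" for y
    proof -
      obtain a where a: "0 \<le> a" "(LINT x|?M. exp (\<i> * complex_of_real (x \<bullet> - y)) * complex_of_real (g s x)) = complex_of_real a"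
        using gaussian_fourier_subspace(2)[OF V s, of "- y"] unfolding g_def by blast
      have "(LINT x|?M. ?k x y) = (LINT x|?M. \<phi> y * (exp (\<i> * complex_of_real (x \<bullet> - y)) * complex_of_real (g s x)))"
        by (rule Bochner_Integration.integral_cong) (auto simp: inner_commute mult.assoc)
      also have "\<dots> = \<phi> y * complex_of_real a" using a(2) by simp
      finally show ?thesis using nn[of y] a(1) by (auto simp: complex_nonneg_Reals_iff)
    qed
    then have "0 \<le> (LINT y|lborel. Re (LINT x|?M. ?k x y))" by (intro integral_nonneg_AE AE_I2) auto
    also have "\<dots> = Re (LINT y|lborel. (LINT x|?M. ?k x y))"
      using P.integrable_snd[OF ki] by (rule integral_Re)
    finally show ?thesis unfolding eq .
  qed
  have "(\<lambda>j. (LINT x|?M. fourier \<phi> x * complex_of_real (g (inverse (real (Suc j))) x))) \<longlonglongrightarrow> (LINT x|?M. fourier \<phi> x)"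
  proof (rule integral_dominated_convergence)
    show "integrable ?M (\<lambda>x. norm (fourier \<phi> x))" using int by simp
    show "AE x in ?M. (\<lambda>j. fourier \<phi> x * complex_of_real (g (inverse (real (Suc j))) x)) \<longlonglongrightarrow> fourier \<phi> x"
    proof (rule AE_I2)
      fix x
      have "(\<lambda>j. fourier \<phi> x * complex_of_real (exp (- ((inverse (real (Suc j)))\<^sup>2 * (norm x)\<^sup>2 / 2)))) \<longlonglongrightarrow>
         fourier \<phi> x * complex_of_real (exp (- (0\<^sup>2 * (norm x)\<^sup>2 / 2)))"
        by (intro tendsto_intros LIMSEQ_inverse_real_of_nat) auto
      then show "(\<lambda>j. fourier \<phi> x * complex_of_real (g (inverse (real (Suc j))) x)) \<longlonglongrightarrow> fourier \<phi> x"
        by (simp add: g_def)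
    qed
    show "AE x in ?M. norm (fourier \<phi> x * complex_of_real (g (inverse (real (Suc j))) x)) \<le> norm (fourier \<phi> x)" for j
      by (intro AE_I2) (simp add: norm_mult g_def mult_left_le)
  qed measurable
  then have "(\<lambda>j. Re (LINT x|?M. fourier \<phi> x * complex_of_real (g (inverse (real (Suc j))) x))) \<longlonglongrightarrow> Re (LINT x|?M. fourier \<phi> x)"
    by (rule tendsto_Re)
  then have "0 \<le> Re (LINT x|?M. fourier \<phi> x)"
    by (rule LIMSEQ_le_const) (use pos in auto)
  also have "\<dots> = (LINT x|?M. Re (fourier \<phi> x))" using int by simp
  finally show "0 \<le> (LINT x|?M. Re (fourier \<phi> x))" .
qed

section \<open>A test function with negative pairing\<close>

lemma lborel_integral_uminus:
  fixes f :: "'a::euclidean_space \<Rightarrow> real"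
  assumes "f \<in> borel_measurable borel"
  shows "(LINT x|lborel. f (- x)) = (LINT x|lborel. f x)"
proof -
  have d: "distr lborel borel (\<lambda>x::'a. - x) = lborel"
    using lborel_affine[of "-1" "0::'a"] by (simp add: density_1)
  have "(LINT x|lborel. f x) = (LINT x|distr lborel borel (\<lambda>x::'a. - x). f x)" unfolding d ..
  also have "\<dots> = (LINT x|lborel. f (- x))" using assms by (intro integral_distr) auto
  finally show ?thesis ..
qed

lemma fourier_reflect:
  assumes "\<And>x. \<phi> x \<in> \<real>\<^sub>\<ge>\<^sub>0"
  shows "fourier \<phi> (- \<xi>) = cnj (fourier \<phi> \<xi>)"
proof -
  have "cnj (\<phi> x) = \<phi> x" for x
    using assms[of x] by (auto simp: complex_nonneg_Reals_iff complex_eq_iff)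
  then show ?thesis
    unfolding fourier_def Bochner_Integration.integral_cnj[symmetric]
    by (intro Bochner_Integration.integral_cong) (auto simp: exp_cnj)
qed

lemma ex_negative_test_function:
  fixes h :: "real^'n \<Rightarrow> real"
  assumes npd: "\<not> positive_definite (distribution_of h)" and ev: "\<And>x. h (- x) = h x"
    and n: "2 \<le> CARD('n)"
  obtains \<psi> C where "continuous_on UNIV \<psi>" "\<forall>x. \<psi> (- x) = \<psi> x"
    "\<forall>x. \<bar>\<psi> x\<bar> \<le> C / (1 + norm x) ^ (CARD('n) + 1)"
    "integrable lborel (\<lambda>x. h x * \<psi> x)" "(LINT x|lborel. h x * \<psi> x) < 0"
    "\<forall>\<xi>\<in>sphere 0 1. 0 \<le> (LINT x|lborel_subspace ({\<xi>}\<^sup>\<bottom>). \<psi> x)"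
proof -
  obtain \<phi> where \<phi>: "schwartz \<phi>" and nn: "\<forall>x. \<phi> x \<in> \<real>\<^sub>\<ge>\<^sub>0"
    and neg: "distribution_of h (fourier \<phi>) \<notin> \<real>\<^sub>\<ge>\<^sub>0"
    using npd by (auto simp: positive_definite_def fourier_distribution_def)
  have nn': "\<phi> x \<in> \<real>\<^sub>\<ge>\<^sub>0" for x using nn by blast
  define I where "I = (LINT x|lborel. complex_of_real (h x) * fourier \<phi> x)"
  have I: "I \<notin> \<real>\<^sub>\<ge>\<^sub>0" using neg by (simp add: I_def distribution_of_def)
  \<comment> \<open>A Bochner integral that does not exist has the default value \<open>0\<close>,
    which is a nonnegative real; since \<open>I\<close> is not, the integral exists.\<close>
  have int: "integrable lborel (\<lambda>x. complex_of_real (h x) * fourier \<phi> x)"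
  proof (rule ccontr)
    assume "\<not> ?thesis"
    then have "I = 0" unfolding I_def by (rule not_integrable_integral_eq)
    with I show False by simp
  qed
  have re: "integrable lborel (\<lambda>x. h x * Re (fourier \<phi> x))" using integrable_Re[OF int] by simp
  have im: "integrable lborel (\<lambda>x. h x * Im (fourier \<phi> x))" using integrable_Im[OF int] by simp
  have ReI: "Re I = (LINT x|lborel. h x * Re (fourier \<phi> x))"
    unfolding I_def integral_Re[OF int, symmetric] by simp
  have ImI: "Im I = (LINT x|lborel. h x * Im (fourier \<phi> x))"
    unfolding I_def integral_Im[OF int, symmetric] by simp
  have refl: "fourier \<phi> (- x) = cnj (fourier \<phi> x)" for x by (rule fourier_reflect[OF nn'])
  \<comment> \<open>The imaginary part of the transform of a real function is odd and
    \<open>h\<close> is even. Hence the pairing is real, and not being a nonnegative real means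
    being negative.\<close>
  have "(LINT x|lborel. h x * Im (fourier \<phi> x)) = (LINT x|lborel. h (- x) * Im (fourier \<phi> (- x)))"
    using im by (intro lborel_integral_uminus[symmetric]) auto
  also have "\<dots> = - (LINT x|lborel. h x * Im (fourier \<phi> x))" by (simp add: ev refl)
  finally have Im0: "Im I = 0" using ImI by simp
  have Re0: "Re I < 0"
  proof (rule ccontr)
    assume "\<not> Re I < 0"
    then have "I \<in> \<real>\<^sub>\<ge>\<^sub>0" using Im0 by (simp add: complex_nonneg_Reals_iff)
    with I show False by simp
  qed
  have \<phi>i: "integrable lborel \<phi>" using schwartz_integrable[OF \<phi>, of "[]"] by simp
  obtain C where C: "\<And>\<xi>. norm (fourier \<phi> \<xi>) \<le> C / (1 + norm \<xi>) ^ (CARD('n) + 1)"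
    using schwartz_fourier_decay[OF \<phi>] by blast
  show thesis
  proof (rule that[of "\<lambda>x. Re (fourier \<phi> x)" C])
    show "continuous_on UNIV (\<lambda>x. Re (fourier \<phi> x))"
      by (intro continuous_intros fourier_continuous[OF \<phi>i])
    show "\<forall>x. Re (fourier \<phi> (- x)) = Re (fourier \<phi> x)" by (simp add: refl)
    show "\<forall>x. \<bar>Re (fourier \<phi> x)\<bar> \<le> C / (1 + norm x) ^ (CARD('n) + 1)"
      by (intro allI order_trans[OF abs_Re_le_cmod C])
    show "integrable lborel (\<lambda>x. h x * Re (fourier \<phi> x))" by (rule re)
    show "(LINT x|lborel. h x * Re (fourier \<phi> x)) < 0" using Re0 ReI by simp
    show "\<forall>\<xi>\<in>sphere 0 1. 0 \<le> (LINT x|lborel_subspace ({\<xi>}\<^sup>\<bottom>). Re (fourier \<phi> x))"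
    proof
      fix \<xi> :: "real^'n" assume "\<xi> \<in> sphere 0 1"
      then have "\<xi> \<noteq> 0" by auto
      then have "dim ({\<xi>}\<^sup>\<bottom>) = CARD('n) - 1"
        using dim_hyperplane[of \<xi>] by (simp add: orthogonal_comp_def orthogonal_def)
      then have "1 \<le> dim ({\<xi>}\<^sup>\<bottom>)" using n by simp
      then show "0 \<le> (LINT x|lborel_subspace ({\<xi>}\<^sup>\<bottom>). Re (fourier \<phi> x))"
        by (rule integral_fourier_subspace_nonneg(2)[OF \<phi> nn' subspace_orthogonal_comp])
    qed
  qed
qed

section \<open>Integrals along rays\<close>

lemma integrable_interval_indicator:
  fixes w :: "real \<Rightarrow> real"
  assumes "continuous_on UNIV w"
  shows "integrable lborel (\<lambda>r. indicator {a<..b} r * w r)"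
proof -
  have "set_integrable lborel {a..b} w"
    by (rule borel_integrable_atLeastAtMost'[OF continuous_on_subset[OF assms]]) simp
  then have "set_integrable lborel {a<..b} w" by (rule set_integrable_subset) auto
  then show ?thesis by (simp add: set_integrable_def)
qed

lemma interval_integral_split:
  fixes w :: "real \<Rightarrow> real"
  assumes w: "continuous_on UNIV w" and ab: "0 \<le> a" "a \<le> b"
  shows "(LINT r|lborel. indicator {0<..b} r * w r) - (LINT r|lborel. indicator {0<..a} r * w r)
    = (LINT r|lborel. indicator {a<..b} r * w r)"
proof -
  have "(LINT r|lborel. indicator {0<..b} r * w r) - (LINT r|lborel. indicator {0<..a} r * w r)
    = (LINT r|lborel. indicator {0<..b} r * w r - indicator {0<..a} r * w r)"
    by (rule Bochner_Integration.integral_diff[symmetric]) (intro integrable_interval_indicator[OF w])+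
  also have "\<dots> = (LINT r|lborel. indicator {a<..b} r * w r)"
    using ab by (intro Bochner_Integration.integral_cong) (auto simp: indicator_def)
  finally show ?thesis .
qed

lemma interval_integral_approx:
  fixes w :: "real \<Rightarrow> real"
  assumes w: "continuous_on UNIV w" and ab: "a \<le> b" and le: "\<And>r. a < r \<Longrightarrow> r \<le> b \<Longrightarrow> \<bar>w r - c\<bar> \<le> \<eta>"
  shows "\<bar>(LINT r|lborel. indicator {a<..b} r * w r) - (b - a) * c\<bar> \<le> (b - a) * \<eta>"
proof -
  have const: "(LINT r|lborel. indicator {a<..b} r * d) = (b - a) * d" for d :: real using ab by simp
  have i1: "integrable lborel (\<lambda>r. indicator {a<..b} r * (w r - c))"
    by (rule integrable_interval_indicator) (intro continuous_intros w)
  have i2: "integrable lborel (\<lambda>r. indicator {a<..b} r * \<eta>)"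
    by (rule integrable_interval_indicator) (intro continuous_intros)
  have i3: "integrable lborel (\<lambda>r. indicator {a<..b} r * c)"
    by (rule integrable_interval_indicator) (intro continuous_intros)
  have "(LINT r|lborel. indicator {a<..b} r * w r) - (b - a) * c
      = (LINT r|lborel. indicator {a<..b} r * w r) - (LINT r|lborel. indicator {a<..b} r * c)"
    by (simp only: const)
  also have "\<dots> = (LINT r|lborel. indicator {a<..b} r * w r - indicator {a<..b} r * c)"
    by (rule Bochner_Integration.integral_diff[OF integrable_interval_indicator[OF w] i3, symmetric])
  also have "\<dots> = (LINT r|lborel. indicator {a<..b} r * (w r - c))"
    by (simp only: right_diff_distrib)
  finally have eq: "(LINT r|lborel. indicator {a<..b} r * w r) - (b - a) * c = \<dots>" .
  have "\<bar>LINT r|lborel. indicator {a<..b} r * (w r - c)\<bar> \<le> (LINT r|lborel. indicator {a<..b} r * \<eta>)"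
    using Bochner_Integration.integral_norm_bound_integral[OF i1 i2] le by (auto simp: indicator_def)
  then show ?thesis unfolding eq const .
qed

lemma ray_approx:
  fixes w :: "real \<Rightarrow> real"
  assumes w: "continuous_on UNIV w" and T: "0 < T"
    and le: "\<And>r. min 1 T \<le> r \<Longrightarrow> r \<le> max 1 T \<Longrightarrow> \<bar>w r - c\<bar> \<le> \<eta>"
  shows "\<bar>(LINT r|lborel. indicator {0<..T} r * w r) - (LINT r|lborel. indicator {0<..1} r * w r) - (T - 1) * c\<bar> \<le> \<bar>T - 1\<bar> * \<eta>"
proof (cases "1 \<le> T")
  case True
  then show ?thesis
    using interval_integral_split[OF w, of 1 T] interval_integral_approx[OF w True, of c \<eta>] le by simp
next
  case False
  then have T1: "T \<le> 1" by simp
  have "\<bar>(LINT r|lborel. indicator {T<..1} r * w r) - (1 - T) * c\<bar> \<le> (1 - T) * \<eta>"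
    by (rule interval_integral_approx[OF w T1]) (use le T1 in auto)
  moreover have "(LINT r|lborel. indicator {0<..1} r * w r) - (LINT r|lborel. indicator {0<..T} r * w r)
     = (LINT r|lborel. indicator {T<..1} r * w r)"
    using T T1 by (intro interval_integral_split[OF w]) auto
  moreover have "(T - 1) * c = - ((1 - T) * c)" by (simp add: algebra_simps)
  moreover have "\<bar>T - 1\<bar> = 1 - T" using T1 by simp
  ultimately show ?thesis by (simp only:)
qed

text \<open>For \<open>T \<ge> 1\<close> the added piece has \<open>q r \<ge> q 1\<close>, for
  \<open>T < 1\<close> the removed piece has \<open>q r \<le> q 1\<close>; both favour the same
  inequality. It converts the change of a section integral along a ray into a lower bound for the
  change of the volume integral.\<close>

lemma ray_mono:
  fixes w v q :: "real \<Rightarrow> real"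
  assumes w: "continuous_on UNIV w" and v: "continuous_on UNIV v" and T: "0 < T"
    and w0: "\<And>r. 0 < r \<Longrightarrow> 0 \<le> w r" and vq: "\<And>r. 0 < r \<Longrightarrow> v r = w r * q r" and q: "mono_on {0<..} q"
  shows "q 1 * ((LINT r|lborel. indicator {0<..T} r * w r) - (LINT r|lborel. indicator {0<..1} r * w r))
    \<le> (LINT r|lborel. indicator {0<..T} r * v r) - (LINT r|lborel. indicator {0<..1} r * v r)"
proof (cases "1 \<le> T")
  case True
  have "q 1 * (LINT r|lborel. indicator {1<..T} r * w r) = (LINT r|lborel. indicator {1<..T} r * (q 1 * w r))"
    by (simp flip: integral_mult_right_zero add: mult.left_commute)
  also have "\<dots> \<le> (LINT r|lborel. indicator {1<..T} r * v r)"
  proof (rule integral_mono)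
    show "integrable lborel (\<lambda>r. indicator {1<..T} r * (q 1 * w r))"
      by (rule integrable_interval_indicator) (intro continuous_intros w)
    show "integrable lborel (\<lambda>r. indicator {1<..T} r * v r)" by (rule integrable_interval_indicator[OF v])
    fix r
    show "indicator {1<..T} r * (q 1 * w r) \<le> indicator {1<..T} r * v r"
    proof (cases "r \<in> {1<..T}")
      case True
      then have "q 1 \<le> q r" using q by (intro mono_onD[OF q]) auto
      then show ?thesis using True w0[of r] vq[of r] by (simp add: mult.commute[of "w r"] mult_right_mono)
    qed simp
  qed
  finally show ?thesis using interval_integral_split[OF w, of 1 T] interval_integral_split[OF v, of 1 T] True by simp
next
  case False
  then have T1: "T \<le> 1" by simp
  have "(LINT r|lborel. indicator {T<..1} r * v r) \<le> (LINT r|lborel. indicator {T<..1} r * (q 1 * w r))"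
  proof (rule integral_mono)
    show "integrable lborel (\<lambda>r. indicator {T<..1} r * (q 1 * w r))"
      by (rule integrable_interval_indicator) (intro continuous_intros w)
    show "integrable lborel (\<lambda>r. indicator {T<..1} r * v r)" by (rule integrable_interval_indicator[OF v])
    fix r
    show "indicator {T<..1} r * v r \<le> indicator {T<..1} r * (q 1 * w r)"
    proof (cases "r \<in> {T<..1}")
      case True
      then have "q r \<le> q 1" using q T by (intro mono_onD[OF q]) auto
      then show ?thesis using True T w0[of r] vq[of r] by (simp add: mult.commute[of "w r"] mult_right_mono)
    qed simp
  qed
  also have "\<dots> = q 1 * (LINT r|lborel. indicator {T<..1} r * w r)"
    by (simp flip: integral_mult_right_zero add: mult.left_commute)
  finally have "- (q 1 * (LINT r|lborel. indicator {T<..1} r * w r)) \<le> - (LINT r|lborel. indicator {T<..1} r * v r)" by simp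
  moreover have "(LINT r|lborel. indicator {0<..T} r * w r) - (LINT r|lborel. indicator {0<..1} r * w r) = - (LINT r|lborel. indicator {T<..1} r * w r)"
    "(LINT r|lborel. indicator {0<..T} r * v r) - (LINT r|lborel. indicator {0<..1} r * v r) = - (LINT r|lborel. indicator {T<..1} r * v r)"
    using interval_integral_split[OF w _ T1] interval_integral_split[OF v _ T1] T by auto
  ultimately show ?thesis by simp
qed

section \<open>Radial functions as real integrals\<close>

lemma radial_eq_integral:
  fixes g :: "'a::euclidean_space \<Rightarrow> real"
  assumes "\<And>y. 0 \<le> g y" "integrable lborel (\<lambda>r. indicator {0<..} r * (r ^ (m - 1) * g (r *\<^sub>R x)))"
  shows "radial m (\<lambda>y. ennreal (g y)) x = ennreal (LINT r|lborel. indicator {0<..} r * (r ^ (m - 1) * g (r *\<^sub>R x)))"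
proof -
  have "radial m (\<lambda>y. ennreal (g y)) x = (\<integral>\<^sup>+r. ennreal (indicator {0<..} r * (r ^ (m - 1) * g (r *\<^sub>R x))) \<partial>lborel)"
    unfolding radial_def using assms(1)
    by (intro nn_integral_cong) (auto simp: indicator_def ennreal_mult)
  also have "\<dots> = ennreal (LINT r|lborel. indicator {0<..} r * (r ^ (m - 1) * g (r *\<^sub>R x)))"
    using assms by (intro nn_integral_eq_integral) (auto simp: indicator_def)
  finally show ?thesis .
qed

lemma radial_indicator:
  fixes g :: "'a::euclidean_space \<Rightarrow> real"
  assumes g0: "\<And>y. 0 \<le> g y" and g: "continuous_on UNIV g" and D: "\<And>r. 0 < r \<Longrightarrow> r *\<^sub>R x \<in> D \<longleftrightarrow> r \<le> T"
  shows "radial m (\<lambda>y. ennreal (g y) * indicator D y) x = ennreal (LINT r|lborel. indicator {0<..T} r * (r ^ (m - 1) * g (r *\<^sub>R x)))"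
proof -
  have eq: "indicator {0<..} r * (r ^ (m - 1) * (g (r *\<^sub>R x) * indicator D (r *\<^sub>R x))) = indicator {0<..T} r * (r ^ (m - 1) * g (r *\<^sub>R x))" for r
    using D[of r] by (auto simp: indicator_def)
  have "continuous_on UNIV (\<lambda>r. r ^ (m - 1) * g (r *\<^sub>R x))"
    by (intro continuous_intros continuous_on_compose2[OF g]) auto
  then have "integrable lborel (\<lambda>r. indicator {0<..T} r * (r ^ (m - 1) * g (r *\<^sub>R x)))"
    by (rule integrable_interval_indicator)
  then have "radial m (\<lambda>y. ennreal (g y * indicator D y)) x = ennreal (LINT r|lborel. indicator {0<..T} r * (r ^ (m - 1) * g (r *\<^sub>R x)))"
    using radial_eq_integral[of "\<lambda>y. g y * indicator D y" m x] g0 unfolding eq by simp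
  moreover have "(\<lambda>y. ennreal (g y * indicator D y)) = (\<lambda>y. ennreal (g y) * indicator D y)"
    by (auto simp: indicator_def)
  ultimately show ?thesis by simp
qed

lemma radial_add:
  fixes F G :: "'a::euclidean_space \<Rightarrow> ennreal"
  assumes [measurable]: "F \<in> borel_measurable borel" "G \<in> borel_measurable borel"
  shows "radial m (\<lambda>y. F y + G y) x = radial m F x + radial m G x"
  unfolding radial_def by (subst nn_integral_add[symmetric]) (auto simp: distrib_left distrib_right)

text \<open>From \<open>a * (1 + r) \<le> 1 + r * norm x\<close> one gets a majorant that depends on
  \<open>x\<close> only through the lower bound \<open>a\<close>, so it serves for dominated
  convergence in \<open>x\<close> away from the origin.\<close>

lemma ray_decay_bound:
  fixes \<psi> :: "'a::euclidean_space \<Rightarrow> real"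
  assumes C: "\<And>x. \<bar>\<psi> x\<bar> \<le> C / (1 + norm x) ^ (N + 3)" and a: "0 < a" "a \<le> 1" "a \<le> norm x"
  shows "norm (indicator {0<..} r * (r ^ N * \<psi> (r *\<^sub>R x))) \<le> C / a ^ (N + 3) * (1 / (1 + r)\<^sup>2 * indicator {0..} r)"
proof (cases "0 < r")
  case True
  have C0: "0 \<le> C" using order_trans[OF abs_ge_zero C[of 0]] by simp
  have "r * a \<le> r * norm x" using a True by (intro mult_left_mono) auto
  moreover have "a * (1 + r) = a + r * a" by (simp add: algebra_simps)
  ultimately have "a * (1 + r) \<le> 1 + r * norm x" using a by linarith
  then have "(a * (1 + r)) ^ (N + 3) \<le> (1 + norm (r *\<^sub>R x)) ^ (N + 3)"
    using True a by (intro power_mono) auto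
  moreover have "0 < (a * (1 + r)) ^ (N + 3)" using True a by simp
  ultimately have "\<bar>\<psi> (r *\<^sub>R x)\<bar> \<le> C / (a * (1 + r)) ^ (N + 3)"
    using C[of "r *\<^sub>R x"] C0 by (smt (verit) frac_le)
  also have "\<dots> = C / a ^ (N + 3) / (1 + r) ^ (N + 3)" by (simp add: power_mult_distrib)
  finally have "r ^ N * \<bar>\<psi> (r *\<^sub>R x)\<bar> \<le> (1 + r) ^ (N + 1) * (C / a ^ (N + 3) / (1 + r) ^ (N + 3))"
  proof (intro mult_mono)
    have "r ^ N \<le> (1 + r) ^ N" using True by (intro power_mono) auto
    also have "\<dots> \<le> (1 + r) ^ (N + 1)" using True by (intro power_increasing) auto
    finally show "r ^ N \<le> (1 + r) ^ (N + 1)" .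
  qed (use True in auto)
  also have "(1 + r) ^ (N + 1) * (C / a ^ (N + 3) / (1 + r) ^ (N + 3)) = C / a ^ (N + 3) * (1 / (1 + r)\<^sup>2)"
  proof -
    have "(1 + r) ^ (N + 3) = (1 + r) ^ (N + 1) * (1 + r)\<^sup>2"
      unfolding power_add[symmetric] by (rule arg_cong[where f="\<lambda>k. (1 + r) ^ k"]) simp
    then show ?thesis using True by simp
  qed
  finally show ?thesis using True by (simp add: abs_mult)
next
  case False
  have C0: "0 \<le> C" using order_trans[OF abs_ge_zero C[of 0]] by simp
  then show ?thesis using False a by simp
qed

lemma integrable_inverse_square: "integrable lborel (\<lambda>r::real. c * (1 / (1 + r)\<^sup>2 * indicator {0..} r))"
proof (rule integrable_mult_right)
  show "integrable lborel (\<lambda>r::real. 1 / (1 + r)\<^sup>2 * indicator {0..} r)"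
  proof (rule integrableI_nonneg)
    have "(\<integral>\<^sup>+r. ennreal (1 / (1 + r)\<^sup>2 * indicator {0..} r) \<partial>lborel) = (\<integral>\<^sup>+r. ennreal (1 / (1 + r)\<^sup>2) * indicator {0..} r \<partial>lborel)"
      by (intro nn_integral_cong) (auto simp: indicator_def)
    then show "(\<integral>\<^sup>+r. ennreal (1 / (1 + r)\<^sup>2 * indicator {0..} r) \<partial>lborel) < \<infinity>"
      unfolding nn_integral_inverse_square by simp
  qed auto
qed

lemma ray_integrable:
  fixes \<psi> :: "'a::euclidean_space \<Rightarrow> real"
  assumes C: "\<And>x. \<bar>\<psi> x\<bar> \<le> C / (1 + norm x) ^ (N + 3)" and \<psi>: "continuous_on UNIV \<psi>" and x: "x \<noteq> 0"
  shows "integrable lborel (\<lambda>r. indicator {0<..} r * (r ^ N * \<psi> (r *\<^sub>R x)))"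
proof (rule Bochner_Integration.integrable_bound[OF integrable_inverse_square])
  have [measurable]: "\<psi> \<in> borel_measurable borel" using \<psi> by (rule borel_measurable_continuous_onI)
  show "(\<lambda>r. indicator {0<..} r * (r ^ N * \<psi> (r *\<^sub>R x))) \<in> borel_measurable lborel" by measurable
  define a where "a = min 1 (norm x)"
  have a: "0 < a" "a \<le> 1" "a \<le> norm x" using x by (auto simp: a_def)
  show "AE r in lborel. norm (indicator {0<..} r * (r ^ N * \<psi> (r *\<^sub>R x))) \<le> norm (C / a ^ (N + 3) * (1 / (1 + r)\<^sup>2 * indicator {0..} r))"
    unfolding real_norm_def[of "C / _ * _"]
    by (intro AE_I2) (rule order_trans[OF ray_decay_bound[OF C a] abs_ge_self])
qed

lemma ray_integral_continuous:
  fixes \<psi> :: "'a::euclidean_space \<Rightarrow> real"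
  assumes C: "\<And>x. \<bar>\<psi> x\<bar> \<le> C / (1 + norm x) ^ (N + 3)" and \<psi>: "continuous_on UNIV \<psi>"
    and a: "0 < a" and S: "\<And>x. x \<in> S \<Longrightarrow> a \<le> norm x"
  shows "continuous_on S (\<lambda>x. LINT r|lborel. indicator {0<..} r * (r ^ N * \<psi> (r *\<^sub>R x)))"
  unfolding continuous_on_sequentially o_def
proof (intro allI ballI impI)
  fix z x assume x: "x \<in> S" and z: "(\<forall>n. z n \<in> S) \<and> z \<longlonglongrightarrow> x"
  have [measurable]: "\<psi> \<in> borel_measurable borel" using \<psi> by (rule borel_measurable_continuous_onI)
  define b where "b = min 1 a"
  have b: "0 < b" "b \<le> 1" "\<And>x. x \<in> S \<Longrightarrow> b \<le> norm x" using a S by (force simp: b_def)+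
  show "(\<lambda>n. LINT r|lborel. indicator {0<..} r * (r ^ N * \<psi> (r *\<^sub>R z n))) \<longlonglongrightarrow> (LINT r|lborel. indicator {0<..} r * (r ^ N * \<psi> (r *\<^sub>R x)))"
  proof (rule integral_dominated_convergence[OF _ _ integrable_inverse_square])
    show "AE r in lborel. (\<lambda>n. indicator {0<..} r * (r ^ N * \<psi> (r *\<^sub>R z n))) \<longlonglongrightarrow> indicator {0<..} r * (r ^ N * \<psi> (r *\<^sub>R x))"
    proof (rule AE_I2)
      fix r :: real
      have "(\<lambda>n. r *\<^sub>R z n) \<longlonglongrightarrow> r *\<^sub>R x" using z by (intro tendsto_intros) auto
      moreover have "isCont \<psi> (r *\<^sub>R x)" using \<psi> by (simp add: continuous_on_eq_continuous_at)
      ultimately have "(\<lambda>n. \<psi> (r *\<^sub>R z n)) \<longlonglongrightarrow> \<psi> (r *\<^sub>R x)" by (rule isCont_tendsto_compose[rotated])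
      then show "(\<lambda>n. indicator {0<..} r * (r ^ N * \<psi> (r *\<^sub>R z n))) \<longlonglongrightarrow> indicator {0<..} r * (r ^ N * \<psi> (r *\<^sub>R x))"
        by (intro tendsto_intros)
    qed
    show "AE r in lborel. norm (indicator {0<..} r * (r ^ N * \<psi> (r *\<^sub>R z n))) \<le> C / b ^ (N + 3) * (1 / (1 + r)\<^sup>2 * indicator {0..} r)" for n
      using z by (intro AE_I2 ray_decay_bound[OF C b(1,2) b(3)]) auto
  qed measurable
qed

lemma radial_cmult:
  fixes F :: "'a::euclidean_space \<Rightarrow> ennreal"
  assumes [measurable]: "F \<in> borel_measurable borel"
  shows "radial m (\<lambda>y. c * F y) x = c * radial m F x"
  unfolding radial_def by (subst nn_integral_cmult[symmetric]) (auto simp: mult_ac)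

text \<open>The ray integral up to \<open>T\<close> has derivative \<open>f x\<close> at
  \<open>T = 1\<close>, and \<open>T - 1\<close> is \<open>- e * k x\<close> to first order. Two
  errors remain, the oscillation of the integrand and the quadratic part of \<open>T - 1\<close>;
  each gets half of \<open>e * \<sigma>\<close>, uniformly by compactness.\<close>

lemma uniform_ray_expansion:
  fixes f k :: "'a::euclidean_space \<Rightarrow> real"
  assumes f: "continuous_on UNIV f" and S: "compact S" and K: "0 < K" "\<And>x. x \<in> S \<Longrightarrow> \<bar>k x\<bar> \<le> K"
    and B: "0 < B" "\<And>x. x \<in> S \<Longrightarrow> \<bar>f x\<bar> \<le> B" and \<sigma>: "0 < \<sigma>"
  obtains e0 where "0 < e0" "\<And>e x. 0 < e \<Longrightarrow> e \<le> e0 \<Longrightarrow> x \<in> S \<Longrightarrow>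
     \<bar>(LINT r|lborel. indicator {0<..1 / (1 + e * k x)} r * (r ^ N * f (r *\<^sub>R x)))
       - (LINT r|lborel. indicator {0<..1} r * (r ^ N * f (r *\<^sub>R x))) + e * k x * f x\<bar> \<le> e * \<sigma>"
proof -
  \<comment> \<open>Since \<open>\<bar>T - 1\<bar> \<le> 2 * (e * K)\<close>, an oscillation of at
    most \<open>\<eta>\<close> costs \<open>e * \<sigma> / 2\<close>.\<close>
  define \<eta> where "\<eta> = \<sigma> / (4 * K)"
  have \<eta>: "0 < \<eta>" using K \<sigma> by (simp add: \<eta>_def)
  let ?W = "\<lambda>(r::real, x). r ^ N * f (r *\<^sub>R x)"
  have "continuous_on ({1/2..3/2} \<times> S) ?W"
    unfolding split_beta by (intro continuous_intros continuous_on_compose2[OF f]) auto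
  then have uc: "uniformly_continuous_on ({1/2..3/2} \<times> S) ?W"
    by (rule compact_uniformly_continuous) (intro compact_Times compact_Icc S)
  have "\<exists>d>0. \<forall>u\<in>{1/2..3/2} \<times> S. \<forall>u'\<in>{1/2..3/2} \<times> S. dist u' u < d \<longrightarrow> dist (?W u') (?W u) < \<eta>"
    by (rule mp[OF spec[OF uc[unfolded uniformly_continuous_on_def], of \<eta>] \<eta>])
  then obtain \<delta> where \<delta>_all: "0 < \<delta> \<and> (\<forall>u\<in>{1/2..3/2} \<times> S. \<forall>u'\<in>{1/2..3/2} \<times> S. dist u' u < \<delta> \<longrightarrow> dist (?W u') (?W u) < \<eta>)"
    by (elim exE)
  note \<delta> = \<delta>_all[THEN conjunct1] \<delta>_all[THEN conjunct2, rule_format]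
  have W: "\<bar>r ^ N * f (r *\<^sub>R x) - f x\<bar> \<le> \<eta>" if "x \<in> S" "\<bar>r - 1\<bar> < \<delta>" "\<bar>r - 1\<bar> \<le> 1/2" for r x
  proof -
    have "1/2 \<le> r" "r \<le> 3/2" using that(3) by linarith+
    then have "dist (?W (r, x)) (?W (1, x)) < \<eta>"
      using that by (intro \<delta>(2)) (auto simp: dist_Pair_Pair dist_real_def)
    then show ?thesis by (simp add: dist_real_def)
  qed
  \<comment> \<open>The first bound keeps all radii between \<open>1\<close> and \<open>T\<close> in
    the range of \<open>W\<close>; the second makes the quadratic error, at most
    \<open>2 * (e * K)\<^sup>2 * B\<close>, not larger than \<open>e * \<sigma> / 2\<close>.\<close>
  define e0 where "e0 = min (min \<delta> (1/2) / (4 * K)) (\<sigma> / (4 * K\<^sup>2 * B))"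
  have e0: "0 < e0" using \<delta>(1) K(1) B(1) \<sigma> by (simp add: e0_def)
  show thesis
  proof (rule that[OF e0])
    fix e x assume e: "0 < e" "e \<le> e0" and x: "x \<in> S"
    have "e \<le> min \<delta> (1/2) / (4 * K)" using e by (simp add: e0_def)
    then have "4 * (e * K) \<le> min \<delta> (1/2)" using K(1) by (simp add: pos_le_divide_eq mult_ac)
    then have eK: "4 * (e * K) \<le> \<delta>" "4 * (e * K) \<le> 1/2" by auto
    have "e \<le> \<sigma> / (4 * K\<^sup>2 * B)" using e by (simp add: e0_def)
    then have eB: "4 * (e * K\<^sup>2 * B) \<le> \<sigma>" using K(1) B(1) by (simp add: pos_le_divide_eq mult_ac)
    define z where "z = e * k x"
    have eK0: "0 < e * K" using e K by simp
    have z: "\<bar>z\<bar> \<le> e * K" using K(2)[OF x] e(1) by (simp add: z_def abs_mult)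
    have z1: "1/2 \<le> 1 + z" using z eK by linarith
    define T where "T = 1 / (1 + z)"
    have T0: "0 < T" using z1 by (simp add: T_def)
    have T1: "T - 1 = - (z / (1 + z))" using z1 by (simp add: T_def field_simps)
    have "\<bar>T - 1\<bar> = \<bar>z\<bar> / (1 + z)" unfolding T1 using z1 by simp
    also have "\<dots> \<le> \<bar>z\<bar> / (1/2)" using z1 by (intro divide_left_mono) auto
    also have "\<dots> \<le> 2 * (e * K)" using z by simp
    finally have TT: "\<bar>T - 1\<bar> \<le> 2 * (e * K)" .
    have near: "\<bar>r - 1\<bar> \<le> \<bar>T - 1\<bar>" if "min 1 T \<le> r" "r \<le> max 1 T" for r
      using that by (auto simp: min_def max_def split: if_splits)
    let ?A = "\<lambda>T. LINT r|lborel. indicator {0<..T} r * (r ^ N * f (r *\<^sub>R x))"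
    have "\<bar>?A T - ?A 1 - (T - 1) * f x\<bar> \<le> \<bar>T - 1\<bar> * \<eta>"
    proof (rule ray_approx[OF _ T0])
      show "continuous_on UNIV (\<lambda>r. r ^ N * f (r *\<^sub>R x))"
        by (intro continuous_intros continuous_on_compose2[OF f]) auto
      fix r assume "min 1 T \<le> r" "r \<le> max 1 T"
      then have "\<bar>r - 1\<bar> \<le> 2 * (e * K)" using near[of r] TT by linarith
      then show "\<bar>r ^ N * f (r *\<^sub>R x) - f x\<bar> \<le> \<eta>" using eK eK0 by (intro W[OF x]; linarith)
    qed
    also have "\<dots> \<le> 2 * (e * K) * \<eta>" using TT \<eta> by (intro mult_right_mono) auto
    also have "\<dots> = e * \<sigma> / 2" using K(1) by (simp add: \<eta>_def)
    finally have 1: "\<bar>?A T - ?A 1 - (T - 1) * f x\<bar> \<le> e * \<sigma> / 2" .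
    have eq: "(T - 1) * f x + z * f x = z\<^sup>2 / (1 + z) * f x"
    proof -
      have "z - z / (1 + z) = z\<^sup>2 / (1 + z)" using z1 by (simp add: field_simps power2_eq_square)
      moreover have "(T - 1) * f x + z * f x = (z - z / (1 + z)) * f x"
        unfolding T1 left_diff_distrib by simp
      ultimately show ?thesis by (simp only:)
    qed
    have "\<bar>z\<^sup>2 / (1 + z) * f x\<bar> = z\<^sup>2 / (1 + z) * \<bar>f x\<bar>" using z1 by (simp add: abs_mult)
    also have "\<dots> \<le> (2 * (e * K)\<^sup>2) * B"
    proof (intro mult_mono)
      have "z\<^sup>2 / (1 + z) \<le> z\<^sup>2 / (1/2)" using z1 by (intro divide_left_mono) auto
      also have "\<dots> \<le> 2 * (e * K)\<^sup>2" using abs_le_square_iff[of z "e * K"] z eK0 by simp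
      finally show "z\<^sup>2 / (1 + z) \<le> 2 * (e * K)\<^sup>2" .
    qed (use B(2)[OF x] in auto)
    also have "\<dots> = e * (4 * (e * K\<^sup>2 * B)) / 2" by (simp add: power2_eq_square)
    also have "\<dots> \<le> e * \<sigma> / 2" using e(1) by (intro divide_right_mono mult_left_mono[OF eB]) auto
    finally have 2: "\<bar>(T - 1) * f x + z * f x\<bar> \<le> e * \<sigma> / 2" unfolding eq .
    have "\<bar>?A T - ?A 1 + z * f x\<bar> \<le> e * \<sigma>" using 1 2 by linarith
    then show "\<bar>?A (1 / (1 + e * k x)) - ?A 1 + e * k x * f x\<bar> \<le> e * \<sigma>" by (simp add: T_def z_def)
  qed
qed

text \<open>On each ray the assumption says that passing from \<open>L\<close> to \<open>D\<close>
  changes the integral of \<open>f\<close> by at most \<open>- e\<close> times the ray integral of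
  \<open>\<psi>\<close>; splitting \<open>\<psi>\<close> into its parts keeps both sides in
  \<open>ennreal\<close>. After integration the correction has the favourable sign and, being
  finite, cancels.\<close>

lemma section_comparison:
  fixes f \<psi> :: "'a::euclidean_space \<Rightarrow> real"
  assumes M: "homogeneous_measure M m" and [measurable]: "f \<in> borel_measurable borel" "D \<in> sets borel" "L \<in> sets borel"
    and \<psi>: "\<psi> \<in> borel_measurable borel" "integrable M \<psi>" "0 \<le> (LINT x|M. \<psi> x)" and e: "0 < e"
    and le: "\<And>x. x \<noteq> 0 \<Longrightarrow> \<exists>s>0.
       radial m (\<lambda>y. ennreal (f y) * indicator D y) (s *\<^sub>R x) + ennreal e * radial m (\<lambda>y. ennreal (max 0 (\<psi> y))) (s *\<^sub>R x)
       \<le> radial m (\<lambda>y. ennreal (f y) * indicator L y) (s *\<^sub>R x) + ennreal e * radial m (\<lambda>y. ennreal (max 0 (- \<psi> y))) (s *\<^sub>R x)"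
  shows "(\<integral>\<^sup>+y. ennreal (f y) * indicator D y \<partial>M) \<le> (\<integral>\<^sup>+y. ennreal (f y) * indicator L y \<partial>M)"
proof -
  note \<psi>(1)[measurable]
  have [measurable_cong]: "sets M = sets borel" by (rule homogeneous_measureD(1)[OF M])
  define P where "P = (LINT y|M. max 0 (\<psi> y))"
  define Q where "Q = (LINT y|M. max 0 (- \<psi> y))"
  have ip: "integrable M (\<lambda>y. max 0 (\<psi> y))" and iq: "integrable M (\<lambda>y. max 0 (- \<psi> y))" using \<psi>(2) by auto
  have P: "(\<integral>\<^sup>+y. ennreal (max 0 (\<psi> y)) \<partial>M) = ennreal P" unfolding P_def using ip by (intro nn_integral_eq_integral) auto
  have Q: "(\<integral>\<^sup>+y. ennreal (max 0 (- \<psi> y)) \<partial>M) = ennreal Q" unfolding Q_def using iq by (intro nn_integral_eq_integral) auto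
  have "P - Q = (LINT y|M. max 0 (\<psi> y) - max 0 (- \<psi> y))"
    unfolding P_def Q_def by (rule Bochner_Integration.integral_diff[OF ip iq, symmetric])
  also have "\<dots> = (LINT y|M. \<psi> y)" by (intro Bochner_Integration.integral_cong) (auto simp: max_def)
  finally have QP: "Q \<le> P" using \<psi>(3) by simp
  have "(\<integral>\<^sup>+y. ennreal (f y) * indicator D y + ennreal e * ennreal (max 0 (\<psi> y)) \<partial>M)
     \<le> (\<integral>\<^sup>+y. ennreal (f y) * indicator L y + ennreal e * ennreal (max 0 (- \<psi> y)) \<partial>M)"
  proof (rule nn_integral_radial_mono[OF M])
    fix x :: 'a assume "x \<noteq> 0"
    from le[OF this] show "\<exists>s>0. radial m (\<lambda>y. ennreal (f y) * indicator D y + ennreal e * ennreal (max 0 (\<psi> y))) (s *\<^sub>R x)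
       \<le> radial m (\<lambda>y. ennreal (f y) * indicator L y + ennreal e * ennreal (max 0 (- \<psi> y))) (s *\<^sub>R x)"
      by (subst (1 2) radial_add) (auto simp: radial_cmult)
  qed measurable
  then have "(\<integral>\<^sup>+y. ennreal (f y) * indicator D y \<partial>M) + ennreal e * ennreal P
     \<le> (\<integral>\<^sup>+y. ennreal (f y) * indicator L y \<partial>M) + ennreal e * ennreal Q"
    by (subst (asm) (1 2) nn_integral_add) (auto simp: nn_integral_cmult P Q simp del: ennreal_max_0 ennreal_max_0')
  also have "\<dots> \<le> (\<integral>\<^sup>+y. ennreal (f y) * indicator L y \<partial>M) + ennreal e * ennreal P"
    using QP by (intro add_left_mono mult_left_mono ennreal_leI) auto
  finally have "ennreal e * ennreal P + (\<integral>\<^sup>+y. ennreal (f y) * indicator D y \<partial>M)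
     \<le> ennreal e * ennreal P + (\<integral>\<^sup>+y. ennreal (f y) * indicator L y \<partial>M)" by (simp add: add.commute)
  moreover have "ennreal e * ennreal P \<noteq> \<infinity>" by (simp add: ennreal_mult_eq_top_iff)
  ultimately show ?thesis by (simp add: ennreal_add_left_cancel_le)
qed

lemma volume_comparison:
  fixes f \<psi> h :: "'a::euclidean_space \<Rightarrow> real"
  assumes M: "homogeneous_measure M m" and [measurable]: "f \<in> borel_measurable borel" "D \<in> sets borel" "L \<in> sets borel"
    and \<psi>[measurable]: "\<psi> \<in> borel_measurable borel" "h \<in> borel_measurable borel" and h0: "\<And>x. 0 \<le> h x"
    and int: "integrable M (\<lambda>y. h y * \<psi> y)" and Lfin: "emeasure M L < \<infinity>"
    and neg: "(LINT y|M. h y * \<psi> y) + c * measure M L < 0" and c: "0 \<le> c" and e: "0 < e"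
    and fin: "(\<integral>\<^sup>+y. ennreal (f y) * indicator L y \<partial>M) < \<infinity>"
    and le: "\<And>x. x \<noteq> 0 \<Longrightarrow> \<exists>s>0.
       radial m (\<lambda>y. ennreal (f y) * indicator L y) (s *\<^sub>R x) + ennreal e * radial m (\<lambda>y. ennreal (h y * max 0 (- \<psi> y))) (s *\<^sub>R x)
       \<le> radial m (\<lambda>y. ennreal (f y) * indicator D y) (s *\<^sub>R x)
         + (ennreal e * radial m (\<lambda>y. ennreal (h y * max 0 (\<psi> y))) (s *\<^sub>R x) + ennreal e * radial m (\<lambda>y. ennreal c * indicator L y) (s *\<^sub>R x))"
  shows "(\<integral>\<^sup>+y. ennreal (f y) * indicator L y \<partial>M) < (\<integral>\<^sup>+y. ennreal (f y) * indicator D y \<partial>M)"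
proof -
  have [measurable_cong]: "sets M = sets borel" by (rule homogeneous_measureD(1)[OF M])
  define P where "P = (LINT y|M. h y * max 0 (\<psi> y))"
  define Q where "Q = (LINT y|M. h y * max 0 (- \<psi> y))"
  have hp: "h y * max 0 (\<psi> y) = max 0 (h y * \<psi> y)" "h y * max 0 (- \<psi> y) = max 0 (- (h y * \<psi> y))" for y
    using h0[of y] by (auto simp: max_def mult_le_0_iff zero_le_mult_iff)
  have ip: "integrable M (\<lambda>y. h y * max 0 (\<psi> y))" and iq: "integrable M (\<lambda>y. h y * max 0 (- \<psi> y))"
    unfolding hp using int by auto
  have P: "(\<integral>\<^sup>+y. ennreal (h y * max 0 (\<psi> y)) \<partial>M) = ennreal P" unfolding P_def using ip h0 by (intro nn_integral_eq_integral) auto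
  have Q: "(\<integral>\<^sup>+y. ennreal (h y * max 0 (- \<psi> y)) \<partial>M) = ennreal Q" unfolding Q_def using iq h0 by (intro nn_integral_eq_integral) auto
  have P0: "0 \<le> P" "0 \<le> Q" unfolding P_def Q_def using h0 by (auto intro!: integral_nonneg_AE AE_I2)
  have "P - Q = (LINT y|M. h y * max 0 (\<psi> y) - h y * max 0 (- \<psi> y))"
    unfolding P_def Q_def by (rule Bochner_Integration.integral_diff[OF ip iq, symmetric])
  also have "\<dots> = (LINT y|M. h y * \<psi> y)" by (intro Bochner_Integration.integral_cong) (auto simp: max_def)
  finally have QP: "P + c * measure M L < Q" using neg by simp
  have L: "(\<integral>\<^sup>+y. ennreal c * indicator L y \<partial>M) = ennreal (c * measure M L)"
    using c Lfin by (simp add: nn_integral_cmult_indicator emeasure_eq_ennreal_measure ennreal_mult)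
  have "(\<integral>\<^sup>+y. ennreal (f y) * indicator L y + ennreal e * ennreal (h y * max 0 (- \<psi> y)) \<partial>M)
     \<le> (\<integral>\<^sup>+y. ennreal (f y) * indicator D y + (ennreal e * ennreal (h y * max 0 (\<psi> y)) + ennreal e * (ennreal c * indicator L y)) \<partial>M)"
  proof (rule nn_integral_radial_mono[OF M])
    fix x :: 'a assume x: "x \<noteq> 0"
    have r1: "radial m (\<lambda>y. ennreal (f y) * indicator L y + ennreal e * ennreal (h y * max 0 (- \<psi> y))) z
      = radial m (\<lambda>y. ennreal (f y) * indicator L y) z + ennreal e * radial m (\<lambda>y. ennreal (h y * max 0 (- \<psi> y))) z" for z
      by (subst radial_add, measurable, subst radial_cmult) auto
    have r2: "radial m (\<lambda>y. ennreal (f y) * indicator D y + (ennreal e * ennreal (h y * max 0 (\<psi> y)) + ennreal e * (ennreal c * indicator L y))) z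
      = radial m (\<lambda>y. ennreal (f y) * indicator D y) z
         + (ennreal e * radial m (\<lambda>y. ennreal (h y * max 0 (\<psi> y))) z + ennreal e * radial m (\<lambda>y. ennreal c * indicator L y) z)" for z
    proof -
      have a: "radial m (\<lambda>y. ennreal e * ennreal (h y * max 0 (\<psi> y)) + ennreal e * (ennreal c * indicator L y)) z
        = radial m (\<lambda>y. ennreal e * ennreal (h y * max 0 (\<psi> y))) z + radial m (\<lambda>y. ennreal e * (ennreal c * indicator L y)) z"
        by (rule radial_add) measurable
      have b: "radial m (\<lambda>y. ennreal e * ennreal (h y * max 0 (\<psi> y))) z = ennreal e * radial m (\<lambda>y. ennreal (h y * max 0 (\<psi> y))) z"
        by (rule radial_cmult) measurable
      have c: "radial m (\<lambda>y. ennreal e * (ennreal c * indicator L y)) z = ennreal e * radial m (\<lambda>y. ennreal c * indicator L y) z"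
        by (rule radial_cmult) measurable
      show ?thesis unfolding a[symmetric] b[symmetric] c[symmetric] by (rule radial_add) measurable
    qed
    show "\<exists>s>0. radial m (\<lambda>y. ennreal (f y) * indicator L y + ennreal e * ennreal (h y * max 0 (- \<psi> y))) (s *\<^sub>R x)
       \<le> radial m (\<lambda>y. ennreal (f y) * indicator D y + (ennreal e * ennreal (h y * max 0 (\<psi> y)) + ennreal e * (ennreal c * indicator L y))) (s *\<^sub>R x)"
      unfolding r1 r2 by (rule le[OF x])
  qed measurable
  then have main: "(\<integral>\<^sup>+y. ennreal (f y) * indicator L y \<partial>M) + ennreal e * ennreal Q
     \<le> (\<integral>\<^sup>+y. ennreal (f y) * indicator D y \<partial>M) + (ennreal e * ennreal P + ennreal e * ennreal (c * measure M L))"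
    by (simp add: nn_integral_add nn_integral_cmult P Q L)
  \<comment> \<open>The strict inequality is extracted in the reals. Only the integral over
    \<open>D\<close> could be infinite, and then the claim is immediate.\<close>
  obtain Y where Y: "(\<integral>\<^sup>+y. ennreal (f y) * indicator L y \<partial>M) = ennreal Y" "0 \<le> Y"
    using fin by (cases "(\<integral>\<^sup>+y. ennreal (f y) * indicator L y \<partial>M)") auto
  show ?thesis
  proof (cases "(\<integral>\<^sup>+y. ennreal (f y) * indicator D y \<partial>M)")
    case (real X)
    have cm: "0 \<le> c * measure M L" using c by simp
    have "ennreal (Y + e * Q) \<le> ennreal (X + (e * P + e * (c * measure M L)))"
      using main unfolding Y(1) real(2) using P0 cm e Y(2) real(1)
      by (simp add: ennreal_mult'[symmetric] ennreal_plus[symmetric] del: ennreal_plus)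
    then have "Y + e * Q \<le> X + (e * P + e * (c * measure M L))"
      using P0 cm e real(1) by (subst (asm) ennreal_le_iff) auto
    moreover have "e * (P + c * measure M L) < e * Q" using QP e by simp
    ultimately have "Y < X" unfolding distrib_left by linarith
    then show ?thesis unfolding Y(1) real(2) using Y(2) by (simp add: ennreal_less_iff)
  next
    case top
    then show ?thesis using fin by simp
  qed
qed

lemma emeasure_mu_hyperplane:
  assumes f: "continuous_on UNIV f" and K: "K \<in> sets borel"
  shows "emeasure (mu_hyperplane f \<xi>) (K \<inter> {\<xi>}\<^sup>\<bottom>) = (\<integral>\<^sup>+y. ennreal (f y) * indicator K y \<partial>lborel_subspace ({\<xi>}\<^sup>\<bottom>))"
proof -
  let ?V = "{\<xi>}\<^sup>\<bottom>"
  have V: "subspace ?V" by (rule subspace_orthogonal_comp)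
  have Vs: "?V \<in> sets borel" using closed_subspace[OF V] by (rule borel_closed)
  have s: "sets (lborel_subspace ?V) = sets borel" by (simp add: lborel_subspace_def Let_def)
  have [measurable_cong]: "sets (lborel_subspace ?V) = sets borel" by (rule s)
  have [measurable]: "f \<in> borel_measurable borel" using f by (rule borel_measurable_continuous_onI)
  have "emeasure (mu_hyperplane f \<xi>) (K \<inter> ?V) = (\<integral>\<^sup>+y. ennreal (f y) * indicator (K \<inter> ?V) y \<partial>lborel_subspace ?V)"
    unfolding mu_hyperplane_def using K Vs s by (intro emeasure_density) auto
  also have "\<dots> = (\<integral>\<^sup>+y. ennreal (f y) * indicator K y \<partial>lborel_subspace ?V)"
    by (rule nn_integral_cong_AE, rule AE_mp[OF AE_lborel_subspace[OF V]], rule AE_I2) (simp add: indicator_def)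
  finally show ?thesis .
qed

lemma emeasure_mu:
  assumes f: "continuous_on UNIV f" and K: "K \<in> sets borel"
  shows "emeasure (mu f) K = (\<integral>\<^sup>+y. ennreal (f y) * indicator K y \<partial>lborel)"
proof -
  have [measurable]: "f \<in> borel_measurable borel" using f by (rule borel_measurable_continuous_onI)
  show ?thesis unfolding mu_def using K by (intro emeasure_density) auto
qed

text \<open>A Stone-Weierstrass approximant is averaged with its reflection; the error is preserved
  because \<open>S\<close> and \<open>g\<close> are symmetric.\<close>

lemma even_polynomial_approximation:
  fixes g :: "'a::euclidean_space \<Rightarrow> real"
  assumes S: "compact S" "\<And>x. x \<in> S \<Longrightarrow> - x \<in> S" and g: "continuous_on S g" "\<And>x. g (- x) = g x" and e: "0 < e"
  obtains k where "real_polynomial_function k" "\<And>x. k (- x) = k x" "\<And>x. x \<in> S \<Longrightarrow> \<bar>k x - g x\<bar> < e"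
proof -
  obtain q where q: "real_polynomial_function q" "\<And>x. x \<in> S \<Longrightarrow> \<bar>g x - q x\<bar> < e"
    using Stone_Weierstrass_real_polynomial_function[OF S(1) g(1) e] by blast
  have "bounded_linear (uminus :: 'a \<Rightarrow> 'a)" by (intro bounded_linear_minus bounded_linear_ident)
  then have "polynomial_function (uminus :: 'a \<Rightarrow> 'a)" by (rule polynomial_function_bounded_linear)
  then have "real_polynomial_function (q \<circ> uminus)" using q(1) real_polynomial_function_compose by blast
  then have q': "real_polynomial_function (\<lambda>x. q (- x))" by (simp add: o_def)
  show thesis
  proof (rule that[of "\<lambda>x. 1/2 * (q x + q (- x))"])
    show "real_polynomial_function (\<lambda>x. 1/2 * (q x + q (- x)))"
      by (intro real_polynomial_function.intros(2-4) q(1) q')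
    show "1/2 * (q (- x) + q (- (- x))) = 1/2 * (q x + q (- x))" for x by simp
    show "\<bar>1/2 * (q x + q (- x)) - g x\<bar> < e" if "x \<in> S" for x
    proof -
      have "1/2 * (a + b) - c = ((a - c) + (b - c)) / 2" for a b c :: real by (simp add: field_simps)
      then have "1/2 * (q x + q (- x)) - g x = ((q x - g x) + (q (- x) - g x)) / 2" .
      moreover have "\<bar>g x - q x\<bar> < e" "\<bar>g x - q (- x)\<bar> < e" using q(2)[OF that] q(2)[OF S(2)[OF that]] g(2)[of x] by auto
      moreover have "\<bar>(a + b) / 2\<bar> < e" if "\<bar>a\<bar> < e" "\<bar>b\<bar> < e" for a b
        using abs_triangle_ineq[of a b] that by simp
      ultimately show ?thesis by (metis abs_minus_commute)
    qed
  qed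
qed

section \<open>The comparison body \<open>D\<close>\<close>

theorem theorem2:
  fixes f_n f_n1 :: "real^'n \<Rightarrow> real"
    and L :: "(real^'n) set"
    and h :: "real^'n \<Rightarrow> real"
  assumes "CARD('n) \<ge> 2"
    and "\<And>x. f_n x \<ge> 0" and "\<And>x. f_n1 x \<ge> 0"
    and "\<And>x. f_n (- x) = f_n x" and "\<And>x. f_n1 (- x) = f_n1 x"
    and "continuous_on UNIV f_n" and "continuous_on UNIV f_n1"
    and "\<And>x. x \<in> sphere 0 1 \<Longrightarrow>
           mono_on {0<..} (\<lambda>t::real. t * (f_n (t *\<^sub>R x) / f_n1 (t *\<^sub>R x)))"
    and "smooth_on (- {0}) f_n1"
    and "\<And>x. x \<noteq> 0 \<Longrightarrow> f_n1 x > 0"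
    and "convex_body L" and "origin_symmetric L" and "smooth_positively_curved L"
    and h_def: "h = (\<lambda>x. inverse (minkowski_functional L x) *
           (f_n (x /\<^sub>R minkowski_functional L x) / f_n1 (x /\<^sub>R minkowski_functional L x)))"
    and "smooth_on (- {0}) h"
    and "\<not> positive_definite (distribution_of h)"
  shows "\<exists>D. convex_body D \<and> origin_symmetric D \<and>
           (\<forall>\<xi>\<in>sphere 0 1. emeasure (mu_hyperplane f_n1 \<xi>) (D \<inter> {\<xi>}\<^sup>\<bottom>)
                         \<le> emeasure (mu_hyperplane f_n1 \<xi>) (L \<inter> {\<xi>}\<^sup>\<bottom>)) \<and>
           emeasure (mu f_n) D > emeasure (mu f_n) L"
proof -
  note n2 = assms(1) and F0 = assms(2) and f0 = assms(3) and Fev = assms(4) and fev = assms(5)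
    and Fc = assms(6) and fc = assms(7) and mono = assms(8) and fpos = assms(10)
  interpret symmetric_body L by standard fact+
  let ?S = "frontier L"
  \<comment> \<open>The polar weight is \<open>r ^ N\<close> on hyperplanes and
    \<open>r ^ (N + 1)\<close> on the whole space.\<close>
  define N where "N = CARD('n) - 2"
  have N: "CARD('n) = N + 2" using n2 by (simp add: N_def)
  have m1: "CARD('n) - 1 - 1 = N" "CARD('n) - 1 = N + 1" using N by simp_all
  have SL: "?S \<subseteq> L" by (rule frontier_subset_closed[OF body_basic(3)])
  have cS: "compact ?S" by (rule compact_frontier[OF body_basic(1)])
  have S1: "p x = 1" if "x \<in> ?S" for x using that by (simp add: frontier_gauge)
  have S0: "x \<noteq> 0" if "x \<in> ?S" for x using S1[OF that] by auto
  have Sm: "- x \<in> ?S" if "x \<in> ?S" for x using that by (simp add: frontier_gauge gauge_minus)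
  have Lb: "L \<in> sets borel" using body_basic(3) by (rule borel_closed)
  have pm[measurable]: "p \<in> borel_measurable borel" by (rule borel_measurable_continuous_onI[OF gauge_continuous])
  have Fm[measurable]: "f_n \<in> borel_measurable borel" and fm[measurable]: "f_n1 \<in> borel_measurable borel"
    by (rule borel_measurable_continuous_onI[OF Fc], rule borel_measurable_continuous_onI[OF fc])
  have hm[measurable]: "h \<in> borel_measurable borel" unfolding h_def by measurable
  have h0: "0 \<le> h x" for x unfolding h_def using F0 f0 gauge_nonneg by simp
  have hev: "h (- x) = h x" for x
  proof -
    have "(- x) /\<^sub>R p (- x) = - (x /\<^sub>R p x)" by (simp add: gauge_minus)
    then show ?thesis unfolding h_def by (simp only: gauge_minus Fev fev)
  qed
  have hS: "h x = f_n x / f_n1 x" if "x \<in> ?S" for x unfolding h_def using S1[OF that] by simp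
  \<comment> \<open>Homogeneity of degree \<open>-1\<close>: it lowers the weight
    \<open>r ^ (N + 1)\<close> of the whole space to the weight \<open>r ^ N\<close> in
    \<open>G\<close>.\<close>
  have hr: "h (r *\<^sub>R x) = h x / r" if "x \<in> ?S" "0 < r" for r x
  proof -
    have pr: "p (r *\<^sub>R x) = r" using gauge_scale[of r x] S1[OF that(1)] that(2) by simp
    have "(r *\<^sub>R x) /\<^sub>R r = x" using that(2) by simp
    then show ?thesis unfolding hS[OF that(1)] unfolding h_def pr by (simp add: divide_inverse mult.commute)
  qed
  obtain u c where c: "0 < c" and u1: "\<And>x. x \<in> ?S \<Longrightarrow> u x \<bullet> x = 1"
    and uc: "\<And>x y. x \<in> ?S \<Longrightarrow> y \<in> ?S \<Longrightarrow> c * (norm (x - y))\<^sup>2 \<le> u x \<bullet> (x - y)"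
    by (rule uniformly_convex_boundary[OF assms(11) zero_interior assms(13)]) (rule that; blast)
  obtain \<psi> C where \<psi>c: "continuous_on UNIV \<psi>" and \<psi>ev: "\<forall>x. \<psi> (- x) = \<psi> x"
    and \<psi>C: "\<forall>x. \<bar>\<psi> x\<bar> \<le> C / (1 + norm x) ^ (CARD('n) + 1)"
    and hint: "integrable lborel (\<lambda>x. h x * \<psi> x)" and hneg: "(LINT x|lborel. h x * \<psi> x) < 0"
    and \<psi>V: "\<forall>\<xi>\<in>sphere 0 1. 0 \<le> (LINT x|lborel_subspace ({\<xi>}\<^sup>\<bottom>). \<psi> x)"
    by (rule ex_negative_test_function[OF assms(16) hev n2])
  have \<psi>C': "\<bar>\<psi> x\<bar> \<le> C / (1 + norm x) ^ (N + 3)" for x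
    using spec[OF \<psi>C, of x] unfolding N by (simp add: numeral_3_eq_3)
  have \<psi>m[measurable]: "\<psi> \<in> borel_measurable borel" by (rule borel_measurable_continuous_onI[OF \<psi>c])
  define G where "G x = (LINT r|lborel. indicator {0<..} r * (r ^ N * \<psi> (r *\<^sub>R x)))" for x
  \<comment> \<open>The radial comparisons take place in \<open>ennreal\<close>, so the positive and
    negative parts of \<open>\<psi>\<close> are integrated separately; \<open>G\<close> is the
    difference of the results.\<close>
  define Gp where "Gp x = (LINT r|lborel. indicator {0<..} r * (r ^ N * max 0 (\<psi> (r *\<^sub>R x))))" for x
  define Gm where "Gm x = (LINT r|lborel. indicator {0<..} r * (r ^ N * max 0 (- \<psi> (r *\<^sub>R x))))" for x
  have pc: "continuous_on UNIV (\<lambda>x. max 0 (\<psi> x))" "continuous_on UNIV (\<lambda>x. max 0 (- \<psi> x))"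
    by (intro continuous_intros \<psi>c)+
  have pC: "\<bar>max 0 (\<psi> x)\<bar> \<le> C / (1 + norm x) ^ (N + 3)" "\<bar>max 0 (- \<psi> x)\<bar> \<le> C / (1 + norm x) ^ (N + 3)" for x
    using \<psi>C'[of x] by linarith+
  note ip = ray_integrable[OF pC(1) pc(1)] and im = ray_integrable[OF pC(2) pc(2)]
  have Gpm: "G x = Gp x - Gm x" if "x \<noteq> 0" for x
  proof -
    have "Gp x - Gm x = (LINT r|lborel. indicator {0<..} r * (r ^ N * max 0 (\<psi> (r *\<^sub>R x))) - indicator {0<..} r * (r ^ N * max 0 (- \<psi> (r *\<^sub>R x))))"
      unfolding Gp_def Gm_def by (rule Bochner_Integration.integral_diff[OF ip[OF that] im[OF that], symmetric])
    also have "\<dots> = G x" unfolding G_def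
      by (intro Bochner_Integration.integral_cong) (auto simp: max_def indicator_def)
    finally show ?thesis ..
  qed
  have G0: "0 \<le> Gp x" "0 \<le> Gm x" for x
    unfolding Gp_def Gm_def by (auto intro!: integral_nonneg_AE AE_I2 simp: indicator_def)
  obtain r0 R0 where r0: "0 < r0" "0 < R0" "\<forall>x. norm x / R0 \<le> p x" "\<forall>x. p x \<le> norm x / r0" by (rule gauge_bounds)
  have Sr: "r0 \<le> norm x" if "x \<in> ?S" for x
    using spec[OF r0(4), of x] S1[OF that] r0(1) by (simp add: pos_le_divide_eq)
  have Gc: "continuous_on ?S G" unfolding G_def by (rule ray_integral_continuous[OF \<psi>C' \<psi>c r0(1) Sr])
  have Gev: "G (- x) = G x" for x unfolding G_def by (simp add: \<psi>ev)
  have SNE: "?S \<noteq> {}"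
  proof -
    obtain i :: 'n where True by simp
    have "axis i (1::real) \<noteq> (0 :: real^'n)" by (simp add: axis_eq_0_iff)
    from normalized_frontier[OF this] show ?thesis by blast
  qed
  have fcS: "continuous_on ?S f_n1" using fc continuous_on_subset by blast
  obtain x1 where x1: "x1 \<in> ?S" "\<forall>x\<in>?S. f_n1 x1 \<le> f_n1 x" using continuous_attains_inf[OF cS SNE fcS] by blast
  obtain x2 where x2: "x2 \<in> ?S" "\<forall>x\<in>?S. f_n1 x \<le> f_n1 x2" using continuous_attains_sup[OF cS SNE fcS] by blast
  define b B where "b = f_n1 x1" and "B = f_n1 x2"
  have bB: "0 < b" "0 < B" "b \<le> B" using fpos[OF S0[OF x1(1)]] fpos[OF S0[OF x2(1)]] x1 x2 by (auto simp: b_def B_def)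
  have fb: "b \<le> f_n1 x" "f_n1 x \<le> B" if "x \<in> ?S" for x using x1 x2 that by (auto simp: b_def B_def)
  have hcS: "continuous_on ?S (\<lambda>x. f_n x / f_n1 x)"
    using fcS continuous_on_subset[OF Fc] fpos S0 by (intro continuous_on_divide) (force, force, force)
  obtain x3 where x3: "x3 \<in> ?S" "\<forall>x\<in>?S. f_n x / f_n1 x \<le> f_n x3 / f_n1 x3" using continuous_attains_sup[OF cS SNE hcS] by blast
  define Hm where "Hm = h x3"
  have Hm: "0 \<le> Hm" "h x \<le> Hm" if "x \<in> ?S" for x
    using h0[of x3] x3(2) that hS[OF that] hS[OF x3(1)] by (auto simp: Hm_def)
  have Hm0: "0 \<le> Hm" by (rule Hm(1)[OF x3(1)])
  define J where "J = - (LINT x|lborel. h x * \<psi> x)"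
  have J: "0 < J" using hneg by (simp add: J_def)
  define vol where "vol = measure (lborel :: (real^'n) measure) L"
  have vol: "0 \<le> vol" by (simp add: vol_def)
  \<comment> \<open>\<open>\<eta>\<close> is the loss allowed on each ray beyond
    \<open>- e * G x\<close>. The denominator makes the total loss \<open>c1 * vol\<close> smaller
    than the margin \<open>J\<close>; its summand \<open>1\<close> covers
    \<open>Hm * vol = 0\<close>.\<close>
  define \<eta> where "\<eta> = J / (real CARD('n) * Hm * vol + 1)"
  have den: "0 < real CARD('n) * Hm * vol + 1" using Hm0 vol by (simp add: add_nonneg_pos)
  have \<eta>: "0 < \<eta>" using J den by (simp add: \<eta>_def)
  \<comment> \<open>The factor \<open>CARD('n)\<close> compensates the ray integral of the polar
    weight up to \<open>1\<close>, so that the constant \<open>c1\<close> on \<open>L\<close>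
    contributes exactly \<open>Hm * \<eta>\<close> at each boundary point.\<close>
  define c1 where "c1 = real CARD('n) * (Hm * \<eta>)"
  have c1: "0 \<le> c1" using Hm0 \<eta> by (simp add: c1_def)
  have c1J: "c1 * vol < J"
  proof -
    have "c1 * vol < (real CARD('n) * Hm * vol + 1) * \<eta>" using \<eta> by (simp add: c1_def algebra_simps)
    also have "\<dots> = J" using den by (simp add: \<eta>_def)
    finally show ?thesis .
  qed
  \<comment> \<open>The shift by \<open>2 * \<eta>1\<close> and an approximation error below
    \<open>\<eta>1\<close> put \<open>k x\<close> between \<open>\<eta>1\<close> and
    \<open>3 * \<eta>1\<close> above \<open>G x / f_n1 x\<close>. With the tolerance
    \<open>\<eta>1 * b\<close> of the ray expansion the total loss is at most
    \<open>4 * \<eta>1 * B = \<eta>\<close>.\<close>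
  define \<eta>1 where "\<eta>1 = \<eta> / (4 * B)"
  have \<eta>1: "0 < \<eta>1" using \<eta> bB by (simp add: \<eta>1_def)
  define k0 where "k0 x = G x / f_n1 x + 2 * \<eta>1" for x
  have k0c: "continuous_on ?S k0" unfolding k0_def
    using fpos S0 by (intro continuous_intros Gc fcS) force
  have k0ev: "k0 (- x) = k0 x" for x by (simp add: k0_def Gev fev)
  obtain k where k: "real_polynomial_function k" and kev: "\<And>x. k (- x) = k x"
    and kk: "\<And>x. x \<in> ?S \<Longrightarrow> \<bar>k x - k0 x\<bar> < \<eta>1"
    by (rule even_polynomial_approximation[OF cS Sm k0c k0ev \<eta>1]) (assumption+, (rule that; blast))
  have kf: "G x + \<eta>1 * b \<le> k x * f_n1 x" "k x * f_n1 x \<le> G x + 3 * \<eta>1 * B" if "x \<in> ?S" for x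
  proof -
    have fx: "0 < f_n1 x" using fpos[OF S0[OF that]] .
    have eq: "(G x / f_n1 x + d) * f_n1 x = G x + d * f_n1 x" for d using fx by (simp add: distrib_right)
    have "G x / f_n1 x + \<eta>1 \<le> k x" "k x \<le> G x / f_n1 x + 3 * \<eta>1" using kk[OF that] unfolding k0_def by linarith+
    then have "(G x / f_n1 x + \<eta>1) * f_n1 x \<le> k x * f_n1 x" "k x * f_n1 x \<le> (G x / f_n1 x + 3 * \<eta>1) * f_n1 x"
      using fx by (auto intro!: mult_right_mono)
    then have "G x + \<eta>1 * f_n1 x \<le> k x * f_n1 x" "k x * f_n1 x \<le> G x + 3 * \<eta>1 * f_n1 x"
      unfolding eq by auto
    moreover have "\<eta>1 * b \<le> \<eta>1 * f_n1 x" "3 * \<eta>1 * f_n1 x \<le> 3 * \<eta>1 * B"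
      using fb[OF that] \<eta>1 by (auto intro!: mult_left_mono)
    ultimately show "G x + \<eta>1 * b \<le> k x * f_n1 x" "k x * f_n1 x \<le> G x + 3 * \<eta>1 * B" by linarith+
  qed
  obtain K where K: "0 < K" "\<And>x. x \<in> ?S \<Longrightarrow> \<bar>k x\<bar> \<le> K"
  proof -
    have "continuous_on ?S k" using continuous_real_polymonial_function[OF k] continuous_at_imp_continuous_on by blast
    then have "bounded (k ` ?S)" using cS compact_continuous_image compact_imp_bounded by blast
    then obtain K where "0 < K" "\<forall>y\<in>k ` ?S. norm y \<le> K" unfolding bounded_pos by blast
    then show thesis by (intro that[of K]) auto
  qed
  have fB: "\<bar>f_n1 x\<bar> \<le> B" if "x \<in> ?S" for x using fb[OF that] f0[of x] by simp
  have \<sigma>: "0 < \<eta>1 * b" using \<eta>1 bB by simp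
  obtain e1 where e1: "0 < e1" and exp1: "\<And>e x. 0 < e \<Longrightarrow> e \<le> e1 \<Longrightarrow> x \<in> ?S \<Longrightarrow>
     \<bar>(LINT r|lborel. indicator {0<..1 / (1 + e * k x)} r * (r ^ N * f_n1 (r *\<^sub>R x)))
       - (LINT r|lborel. indicator {0<..1} r * (r ^ N * f_n1 (r *\<^sub>R x))) + e * k x * f_n1 x\<bar> \<le> e * (\<eta>1 * b)"
    by (rule uniform_ray_expansion[where N=N, OF fc cS K bB(2) fB \<sigma>]) (assumption+, (rule that; blast))
  obtain e2 where e2: "0 < e2" and pert: "\<And>e. 0 < e \<Longrightarrow> e \<le> e2 \<Longrightarrow>
    \<exists>D. convex_body D \<and> origin_symmetric D \<and>
      (\<forall>x\<in>?S. 1/2 \<le> 1 + e * k x \<and> (\<forall>t>0. t *\<^sub>R x \<in> D \<longleftrightarrow> t * (1 + e * k x) \<le> 1))"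
    by (rule perturbed_body[OF c u1 uc k kev]) (assumption+, (rule that; blast))
  define e where "e = min e1 e2"
  have e: "0 < e" "e \<le> e1" "e \<le> e2" using e1 e2 by (auto simp: e_def)
  obtain D where D: "convex_body D" "origin_symmetric D"
    and DS: "\<forall>x\<in>?S. 1/2 \<le> 1 + e * k x \<and> (\<forall>t>0. t *\<^sub>R x \<in> D \<longleftrightarrow> t * (1 + e * k x) \<le> 1)"
    using pert[OF e(1,3)] by blast
  have Db: "D \<in> sets borel" using D(1) by (auto simp: convex_body_def intro: borel_compact)
  define T where "T x = 1 / (1 + e * k x)" for x
  have T: "0 < T x" "\<And>r. 0 < r \<Longrightarrow> r *\<^sub>R x \<in> D \<longleftrightarrow> r \<le> T x" if "x \<in> ?S" for x
  proof -
    have "1/2 \<le> 1 + e * k x" using DS that by blast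
    then have pos: "0 < 1 + e * k x" by linarith
    then show "0 < T x" by (simp add: T_def)
    show "r *\<^sub>R x \<in> D \<longleftrightarrow> r \<le> T x" if "0 < r" for r
    proof -
      have "r *\<^sub>R x \<in> D \<longleftrightarrow> r * (1 + e * k x) \<le> 1" using DS \<open>x \<in> ?S\<close> that by blast
      then show ?thesis unfolding T_def pos_le_divide_eq[OF pos] .
    qed
  qed
  have Lr: "r *\<^sub>R x \<in> L \<longleftrightarrow> r \<le> 1" if "x \<in> ?S" "0 < r" for x r
    using gauge_scale[of r x] S1[OF that(1)] that(2) by (simp add: mem_iff_gauge)
  define A where "A T x = (LINT r|lborel. indicator {0<..T} r * (r ^ N * f_n1 (r *\<^sub>R x)))" for T x
  define A' where "A' T x = (LINT r|lborel. indicator {0<..T} r * (r ^ (N + 1) * f_n (r *\<^sub>R x)))" for T x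
  have A0: "0 \<le> A T x" "0 \<le> A' T x" for T x
    unfolding A_def A'_def using F0 f0 by (auto intro!: integral_nonneg_AE AE_I2 simp: indicator_def)
  \<comment> \<open>\<open>k x * f_n1 x\<close> exceeds \<open>G x\<close> by at least
    \<open>\<eta>1 * b\<close>, exactly the tolerance of the expansion, so the upper bound holds
    without any loss.\<close>
  have AT: "A (T x) x - A 1 x \<le> - (e * G x)" "- (e * (G x + \<eta>)) \<le> A (T x) x - A 1 x" if "x \<in> ?S" for x
  proof -
    have "\<bar>A (T x) x - A 1 x + e * (k x * f_n1 x)\<bar> \<le> e * (\<eta>1 * b)"
      using exp1[OF e(1,2) that] by (simp add: A_def T_def mult.assoc)
    moreover have "e * (G x + \<eta>1 * b) \<le> e * (k x * f_n1 x)" "e * (k x * f_n1 x) \<le> e * (G x + 3 * \<eta>1 * B)"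
      using kf[OF that] e(1) by (auto intro!: mult_left_mono)
    moreover have "e * (3 * \<eta>1 * B + \<eta>1 * b) \<le> e * \<eta>"
    proof (rule mult_left_mono)
      have "\<eta>1 * b \<le> \<eta>1 * B" using bB \<eta>1 by (intro mult_left_mono) auto
      moreover have "4 * (\<eta>1 * B) = \<eta>" using bB by (simp add: \<eta>1_def)
      ultimately show "3 * \<eta>1 * B + \<eta>1 * b \<le> \<eta>" by linarith
    qed (use e in simp)
    ultimately show "A (T x) x - A 1 x \<le> - (e * G x)" "- (e * (G x + \<eta>)) \<le> A (T x) x - A 1 x"
      unfolding distrib_left by linarith+
  qed
  have A'T: "h x * (A (T x) x - A 1 x) \<le> A' (T x) x - A' 1 x" if x: "x \<in> ?S" for x
  proof -
    \<comment> \<open>The monotonicity assumption concerns unit vectors; rescaling transfers it to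
      the ray parametrized by the boundary point \<open>x\<close>, where
      \<open>q 1 = h x\<close>.\<close>
    define q where "q r = r * (f_n (r *\<^sub>R x) / f_n1 (r *\<^sub>R x))" for r
    have mq: "mono_on {0<..} q"
    proof (rule mono_onI)
      fix r s :: real assume rs: "r \<in> {0<..}" "s \<in> {0<..}" "r \<le> s"
      have nx: "0 < norm x" using S0[OF x] by simp
      have sp: "sgn x \<in> sphere 0 1" using S0[OF x] by (simp add: norm_sgn)
      have sx: "(t * norm x) *\<^sub>R sgn x = t *\<^sub>R x" for t using S0[OF x] by (simp add: sgn_div_norm)
      have q: "q t = inverse (norm x) * ((t * norm x) * (f_n ((t * norm x) *\<^sub>R sgn x) / f_n1 ((t * norm x) *\<^sub>R sgn x)))" for t
        unfolding sx q_def using S0[OF x] by simp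
      have "(r * norm x) * (f_n ((r * norm x) *\<^sub>R sgn x) / f_n1 ((r * norm x) *\<^sub>R sgn x)) \<le>
        (s * norm x) * (f_n ((s * norm x) *\<^sub>R sgn x) / f_n1 ((s * norm x) *\<^sub>R sgn x))"
        by (rule mono_onD[OF mono[OF sp]]) (use rs nx in auto)
      then show "q r \<le> q s" unfolding q using nx by (intro mult_left_mono) auto
    qed
    have vq: "r ^ (N + 1) * f_n (r *\<^sub>R x) = (r ^ N * f_n1 (r *\<^sub>R x)) * q r" if "0 < r" for r
    proof -
      have "f_n1 (r *\<^sub>R x) \<noteq> 0" using fpos[of "r *\<^sub>R x"] S0[OF x] that by force
      then show ?thesis by (simp add: q_def)
    qed
    have cw: "continuous_on UNIV (\<lambda>r. r ^ N * f_n1 (r *\<^sub>R x))"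
      by (intro continuous_intros continuous_on_compose2[OF fc]) auto
    have cv: "continuous_on UNIV (\<lambda>r. r ^ (N + 1) * f_n (r *\<^sub>R x))"
      by (intro continuous_intros continuous_on_compose2[OF Fc]) auto
    have "q 1 * (A (T x) x - A 1 x) \<le> A' (T x) x - A' 1 x"
      unfolding A_def A'_def by (rule ray_mono[OF cw cv T(1)[OF x] _ vq mq]) (use f0 in auto)
    moreover have "q 1 = h x" using hS[OF x] by (simp add: q_def)
    ultimately show ?thesis by simp
  qed
  \<comment> \<open>Every ray is examined at its boundary point of \<open>L\<close>, where
    \<open>L\<close> ends at \<open>r = 1\<close> and \<open>D\<close> at
    \<open>r = T x\<close>.\<close>
  have normalize: "\<exists>s>0. s *\<^sub>R x \<in> ?S" if "x \<noteq> 0" for x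
    using normalized_frontier[OF that] gauge_pos[OF that] by (intro exI[of _ "inverse (p x)"]) simp
  have "emeasure (mu_hyperplane f_n1 \<xi>) (D \<inter> {\<xi>}\<^sup>\<bottom>) \<le> emeasure (mu_hyperplane f_n1 \<xi>) (L \<inter> {\<xi>}\<^sup>\<bottom>)"
    if \<xi>: "\<xi> \<in> sphere 0 1" for \<xi>
  proof -
    let ?M = "lborel_subspace ({\<xi>}\<^sup>\<bottom>)"
    have "\<xi> \<noteq> 0" using \<xi> by auto
    then have "dim ({\<xi>}\<^sup>\<bottom>) = CARD('n) - 1"
      using dim_hyperplane[of \<xi>] by (simp add: orthogonal_comp_def orthogonal_def)
    then have dimV: "dim ({\<xi>}\<^sup>\<bottom>) = N + 1" using m1 by simp
    have M: "homogeneous_measure ?M (N + 1)"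
      using homogeneous_measure_lborel_subspace[OF subspace_orthogonal_comp, of "{\<xi>}"] unfolding dimV by simp
    have \<psi>i: "integrable ?M \<psi>"
    proof (rule integrable_decay[OF M \<psi>m])
      fix x :: "real^'n"
      have C0: "0 \<le> C" using order_trans[OF abs_ge_zero \<psi>C'[of 0]] by simp
      have "C / (1 + norm x) ^ (N + 3) \<le> C / (1 + norm x) ^ (N + 1 + 1)"
        using C0 by (intro divide_left_mono power_increasing mult_pos_pos zero_less_power) (auto simp: add_pos_nonneg)
      then show "norm (\<psi> x) \<le> C / (1 + norm x) ^ (N + 1 + 1)" using \<psi>C'[of x] by simp
    qed
    have "(\<integral>\<^sup>+y. ennreal (f_n1 y) * indicator D y \<partial>?M) \<le> (\<integral>\<^sup>+y. ennreal (f_n1 y) * indicator L y \<partial>?M)"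
    proof (rule section_comparison[OF M fm Db Lb \<psi>m \<psi>i bspec[OF \<psi>V \<xi>] e(1)])
      fix x :: "real^'n" assume "x \<noteq> 0"
      then obtain s where s: "0 < s" "s *\<^sub>R x \<in> ?S" using normalize by blast
      let ?y = "s *\<^sub>R x"
      have r1: "radial (N + 1) (\<lambda>y. ennreal (f_n1 y) * indicator D y) ?y = ennreal (A (T ?y) ?y)"
        using radial_indicator[OF f0 fc T(2)[OF s(2)], of "N + 1"] by (simp add: A_def)
      have r2: "radial (N + 1) (\<lambda>y. ennreal (f_n1 y) * indicator L y) ?y = ennreal (A 1 ?y)"
        using radial_indicator[OF f0 fc Lr[OF s(2)], of "N + 1"] by (simp add: A_def)
      have r3: "radial (N + 1) (\<lambda>y. ennreal (max 0 (\<psi> y))) ?y = ennreal (Gp ?y)"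
        using radial_eq_integral[of "\<lambda>y. max 0 (\<psi> y)" "N + 1" ?y] ip[OF S0[OF s(2)]] by (simp add: Gp_def del: ennreal_max_0 ennreal_max_0')
      have r4: "radial (N + 1) (\<lambda>y. ennreal (max 0 (- \<psi> y))) ?y = ennreal (Gm ?y)"
        using radial_eq_integral[of "\<lambda>y. max 0 (- \<psi> y)" "N + 1" ?y] im[OF S0[OF s(2)]] by (simp add: Gm_def del: ennreal_max_0 ennreal_max_0')
      have "A (T ?y) ?y + e * Gp ?y \<le> A 1 ?y + e * Gm ?y"
        using AT(1)[OF s(2)] Gpm[OF S0[OF s(2)]] by (simp add: right_diff_distrib)
      then have "ennreal (A (T ?y) ?y) + ennreal e * ennreal (Gp ?y) \<le> ennreal (A 1 ?y) + ennreal e * ennreal (Gm ?y)"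
        using A0 G0 e(1) by (simp add: ennreal_mult[symmetric] ennreal_plus[symmetric] ennreal_leI del: ennreal_plus)
      then show "\<exists>s>0. radial (N + 1) (\<lambda>y. ennreal (f_n1 y) * indicator D y) (s *\<^sub>R x) + ennreal e * radial (N + 1) (\<lambda>y. ennreal (max 0 (\<psi> y))) (s *\<^sub>R x)
       \<le> radial (N + 1) (\<lambda>y. ennreal (f_n1 y) * indicator L y) (s *\<^sub>R x) + ennreal e * radial (N + 1) (\<lambda>y. ennreal (max 0 (- \<psi> y))) (s *\<^sub>R x)"
        using s(1) by (intro exI[of _ s]) (simp only: r1 r2 r3 r4 simp_thms)
    qed
    then show ?thesis by (simp only: emeasure_mu_hyperplane[OF fc Db] emeasure_mu_hyperplane[OF fc Lb])
  qed
  moreover have "emeasure (mu f_n) L < emeasure (mu f_n) D"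
    unfolding emeasure_mu[OF Fc Lb] emeasure_mu[OF Fc Db]
  proof (rule volume_comparison[OF homogeneous_measure_lborel Fm Db Lb \<psi>m hm h0 hint _ _ c1 e(1)])
    show "emeasure lborel L < \<infinity>" using emeasure_bounded_finite[OF body_basic(4)] by simp
    show "(LINT y|lborel. h y * \<psi> y) + c1 * measure lborel L < 0" using c1J by (simp add: J_def vol_def)
    show "(\<integral>\<^sup>+y. ennreal (f_n y) * indicator L y \<partial>lborel) < \<infinity>"
    proof -
      have "continuous_on L f_n" using Fc continuous_on_subset by blast
      then have "set_integrable lborel L f_n" unfolding set_integrable_def by (rule borel_integrable_compact[OF body_basic(1)])
      then have "(\<integral>\<^sup>+y. ennreal (norm (indicator L y *\<^sub>R f_n y)) \<partial>lborel) < \<infinity>"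
        unfolding set_integrable_def integrable_iff_bounded by simp
      moreover have "ennreal (norm (indicator L y *\<^sub>R f_n y)) = ennreal (f_n y) * indicator L y" for y
        using F0[of y] by (simp add: indicator_def)
      ultimately show ?thesis by simp
    qed
    fix x :: "real^'n" assume "x \<noteq> 0"
    then obtain s where s: "0 < s" "s *\<^sub>R x \<in> ?S" using normalize by blast
    let ?y = "s *\<^sub>R x"
    let ?n = "DIM(real^'n)"
    have n1: "?n - 1 = N + 1" using m1 by simp
    have r1: "radial ?n (\<lambda>y. ennreal (f_n y) * indicator D y) ?y = ennreal (A' (T ?y) ?y)"
      using radial_indicator[OF F0 Fc T(2)[OF s(2)], of ?n] unfolding n1 A'_def .
    have r2: "radial ?n (\<lambda>y. ennreal (f_n y) * indicator L y) ?y = ennreal (A' 1 ?y)"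
      using radial_indicator[OF F0 Fc Lr[OF s(2)], of ?n] unfolding n1 A'_def .
    have hG: "radial ?n (\<lambda>y. ennreal (h y * g y)) ?y = ennreal (h ?y * (LINT r|lborel. indicator {0<..} r * (r ^ N * g (r *\<^sub>R ?y))))"
      if g0: "\<And>y. 0 \<le> g y" and gi: "integrable lborel (\<lambda>r. indicator {0<..} r * (r ^ N * g (r *\<^sub>R ?y)))" for g
    proof -
      have eq: "indicator {0<..} r * (r ^ (?n - 1) * (h (r *\<^sub>R ?y) * g (r *\<^sub>R ?y))) = h ?y * (indicator {0<..} r * (r ^ N * g (r *\<^sub>R ?y)))" for r
      proof (cases "0 < r")
        case True
        then show ?thesis unfolding n1 hr[OF s(2) True] by simp
      qed simp
      show ?thesis
        using radial_eq_integral[of "\<lambda>y. h y * g y" ?n ?y] h0 g0 gi unfolding eq by simp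
    qed
    have r3: "radial ?n (\<lambda>y. ennreal (h y * max 0 (\<psi> y))) ?y = ennreal (h ?y * Gp ?y)"
      unfolding Gp_def by (rule hG[OF _ ip[OF S0[OF s(2)]]]) simp
    have r4: "radial ?n (\<lambda>y. ennreal (h y * max 0 (- \<psi> y))) ?y = ennreal (h ?y * Gm ?y)"
      unfolding Gm_def by (rule hG[OF _ im[OF S0[OF s(2)]]]) simp
    have r5: "radial ?n (\<lambda>y. ennreal c1 * indicator L y) ?y = ennreal (Hm * \<eta>)"
    proof -
      have "radial ?n (\<lambda>y. ennreal c1 * indicator L y) ?y = ennreal (LINT r|lborel. indicator {0<..1} r * (r ^ (?n - 1) * c1))"
        by (rule radial_indicator[OF c1 continuous_on_const Lr[OF s(2)]])
      also have "(LINT r|lborel. indicator {0<..1} r * (r ^ (?n - 1) * c1)) = (LINT r|lborel. indicator {0<..1} r * r ^ (?n - 1)) * c1"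
        by (simp only: mult.assoc[symmetric] integral_mult_left_zero)
      also have "(LINT r|lborel. indicator {0<..1::real} r * r ^ (?n - 1)) = 1 / real ?n"
      proof -
        have "(\<integral>\<^sup>+r. ennreal (indicator {0<..1::real} r * r ^ (?n - 1)) \<partial>lborel) = (\<integral>\<^sup>+r. ennreal (r ^ (?n - 1)) * indicator {0..1} r \<partial>lborel)"
          by (rule nn_integral_cong_AE, rule AE_mp[OF AE_lborel_singleton[of 0]], rule AE_I2) (auto simp: indicator_def)
        also have "\<dots> = ennreal (1 / real ?n)" using n2 by (intro nn_integral_radial_power_unit) simp
        finally have nn: "(\<integral>\<^sup>+r. ennreal (indicator {0<..1::real} r * r ^ (?n - 1)) \<partial>lborel) = ennreal (1 / real ?n)" .
        have "(LINT r|lborel. indicator {0<..1::real} r * r ^ (?n - 1)) = enn2real (\<integral>\<^sup>+r. ennreal (indicator {0<..1::real} r * r ^ (?n - 1)) \<partial>lborel)"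
          by (rule integral_eq_nn_integral) (auto simp: indicator_def)
        then show ?thesis unfolding nn by simp
      qed
      finally show ?thesis using n2 by (simp add: c1_def)
    qed
    \<comment> \<open>\<open>A'T\<close> is combined with the lower bound in \<open>AT\<close>;
      replacing \<open>h ?y\<close> by \<open>Hm\<close> in the loss makes it the same on all
      rays.\<close>
    have "A' 1 ?y + e * (h ?y * Gm ?y) \<le> A' (T ?y) ?y + (e * (h ?y * Gp ?y) + e * (Hm * \<eta>))"
    proof -
      have "h ?y * (- (e * (G ?y + \<eta>))) \<le> h ?y * (A (T ?y) ?y - A 1 ?y)"
        using AT(2)[OF s(2)] h0 by (intro mult_left_mono) auto
      moreover have "h ?y * (- (e * (G ?y + \<eta>))) = e * (h ?y * Gm ?y) - e * (h ?y * Gp ?y) - e * (h ?y * \<eta>)"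
        unfolding Gpm[OF S0[OF s(2)]] by (simp add: algebra_simps)
      moreover have "e * (h ?y * \<eta>) \<le> e * (Hm * \<eta>)"
        using Hm(2)[OF s(2)] \<eta> e(1) by (intro mult_left_mono mult_right_mono) auto
      ultimately show ?thesis using A'T[OF s(2)] by linarith
    qed
    then have "ennreal (A' 1 ?y) + ennreal e * ennreal (h ?y * Gm ?y)
       \<le> ennreal (A' (T ?y) ?y) + (ennreal e * ennreal (h ?y * Gp ?y) + ennreal e * ennreal (Hm * \<eta>))"
      using A0 G0 e(1) h0 Hm0 \<eta>
      by (simp add: ennreal_mult[symmetric] ennreal_plus[symmetric] ennreal_leI del: ennreal_plus)
    then show "\<exists>s>0. radial ?n (\<lambda>y. ennreal (f_n y) * indicator L y) (s *\<^sub>R x) + ennreal e * radial ?n (\<lambda>y. ennreal (h y * max 0 (- \<psi> y))) (s *\<^sub>R x)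
       \<le> radial ?n (\<lambda>y. ennreal (f_n y) * indicator D y) (s *\<^sub>R x)
         + (ennreal e * radial ?n (\<lambda>y. ennreal (h y * max 0 (\<psi> y))) (s *\<^sub>R x) + ennreal e * radial ?n (\<lambda>y. ennreal c1 * indicator L y) (s *\<^sub>R x))"
      using s(1) by (intro exI[of _ s]) (simp only: r1 r2 r3 r4 r5 simp_thms)
  qed
  ultimately show ?thesis using D by blast
qed

end
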